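(* Let $\mathbf H=\mathbf H_{t,c}$ be a rational Cherednik algebra, let $M$ be an $\mathbf H$-module, and let $\mathcal B$ be an abelian subalgebra of $\ker\delta_d\cap(\mathbf H\otimes C^{even}(V))$. Suppose $\sigma\otimes\beta$ is an isotypical component in $H^{\bullet}(\mathfrak h^*,M)$, where $\sigma$ is an irreducible $W$-module and $\beta:\mathcal B\to\mathbb C$ is a character of $\mathcal B$ (that is, $H^\bullet(\mathfrak h^*,M)$ contains a $W$-submodule isomorphic to $\sigma$ on which $\mathcal B$ acts through $\beta$). Then $$\zeta_d^*(\sigma\otimes\chi)=\beta .$$ Similarly, if $\mathcal B$ is an abelian subalgebra of $\ker\delta_\partial\cap(\mathbf H\otimes C^{even}(V))$ and $\sigma\otimes\beta$ is an isotypical component in $H_\bullet(\mathfrak h,M)$, then $\zeta_\partial^*(\sigma\otimes\chi)=\beta$.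
   Context: **Rational Cherednik algebra.** $\mathfrak h$ is a finite-dimensional complex vector space, $n=\dim\mathfrak h$, $W\subset GL(\mathfrak h)$ a finite complex reflection group, $\mathcal R\subset W$ its set of (pseudo-)reflections, $\langle\ ,\ \rangle$ the natural pairing between $\mathfrak h$ and $\mathfrak h^*$. For $s\in\mathcal R$, $\alpha_s\in\mathfrak h^*$ is a nonzero vector vanishing on the hyperplane of $\mathfrak h$ fixed by $s$, $\alpha_s^\vee\in\mathfrak h$ a nonzero vector vanishing on the hyperplane of $\mathfrak h^*$ fixed by $s$, and $\lambda_s=\det_{\mathfrak h}(s)$. Let $t\in\mathbb C$ and $c:\mathcal R\to\mathbb C$ be conjugation-invariant. $\mathbf H=\mathbf H_{t,c}$ is the quotient of $T(\mathfrak h\oplus\mathfrak h^* )\rtimes\mathbb C[W]$ by the relations $[x,x']=0$, $[y,y']=0$, $[y,x]=t\langle y,x\rangle-\sum_{s\in\mathcal R}c(s)\frac{\langle y,\alpha_s\rangle\langle\alpha_s^\vee,x\rangle}{\langle\alpha_s^\vee,\alpha_s\rangle}s$ for $x,x'\in\mathfrak h^*$, $y,y'\in\mathfrak h$. Fix a basis $y_1,\dots,y_n$ of $\mathfrak h$ with dual basis $x_1,\dots,x_n$ of $\mathfrak h^*$. **Clifford algebra, spinors, $\widetilde W$, $\chi$.** $V=\mathfrak h\oplus\mathfrak h^*$ with symmetric form $\langle x_i,x_j\rangle=\langle y_i,y_j\rangle=0$, $\langle x_i,y_j\rangle=\delta_{ij}$. $C(V)$ is the tensor algebra of $V$ modulo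 $x_ix_j+x_jx_i=0=y_iy_j+y_jy_i$, $x_iy_j+y_jx_i=-2\delta_{ij}$; $C^{even}(V)$, $C^{odd}(V)$ are its even and odd parts. The spinor module is $S=\wedge^\bullet\mathfrak h$, where $y\in\mathfrak h$ acts by $y\wedge\cdot$ and $x\in\mathfrak h^*$ by $x(y_{i_1}\wedge\dots\wedge y_{i_p})=2\sum_j(-1)^j\langle x,y_{i_j}\rangle y_{i_1}\wedge\dots\widehat{y_{i_j}}\dots\wedge y_{i_p}$. $\widetilde W\subset C(V)^\times$ is the group generated by the elements $\pm\mu_s$, $s\in\mathcal R$, where $\mu_s=\frac{\sqrt{\lambda_s}-1/\sqrt{\lambda_s}}{2\langle\alpha_s^\vee,\alpha_s\rangle}\alpha_s\alpha_s^\vee+\sqrt{\lambda_s}$; it is a double cover $p:\widetilde W\to W$ with kernel $\{\pm1\}$ and $p(\pm\mu_s)=s$. A $\widetilde W$-module is genuine if $-1\in\widetilde W$ acts by $-1$. $\chi:\widetilde W\to\mathbb C^\times$ is the genuine character by which $\widetilde W$ acts on $\wedge^0\mathfrak h\subset S$; it satisfies $\chi^2(\widetilde w)=\det_{\mathfrak h^*}(p(\widetilde w))$, and $S\cong\chi\otimes\wedge^\bullet\mathfrak h$ as $\widetilde W$-modules, where $W$ acts naturally on $\wedge^\bullet\mathfrak h$. $\Delta:\mathbb C[\widetilde W]\to\mathbf H\otimes C(V)$ is the linear extension of $\widetilde w\mapsto p(\widetilde w)\otimes\widetilde w$. **(Co)homology.** $H^\bullet(\mathfrak h^*,M)=\bigoplus_pH^p(\mathfrak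 h^*,M)$ is the cohomology of the complex $M\otimes\wedge^\bullet\mathfrak h$ with $d(m\otimes\omega)=\sum_jx_jm\otimes y_j\wedge\omega$. $H_\bullet(\mathfrak h,M)=\bigoplus_pH_p(\mathfrak h,M)$ is the homology of $M\otimes\wedge^\bullet\mathfrak h$ with $\partial(m\otimes y_{i_1}\wedge\dots\wedge y_{i_p})=\sum_k(-1)^ky_{i_k}m\otimes y_{i_1}\wedge\dots\widehat{y_{i_k}}\dots\wedge y_{i_p}$. Both are $W$-modules via the diagonal action. **Half-Dirac operators.** $D_x=\sum_ix_i\otimes y_i$, $D_y=\sum_iy_i\otimes x_i$ in $\mathbf H\otimes C(V)$; they act on $M\otimes S$, commute with $\Delta(\mathbb C[\widetilde W])$ and satisfy $D_x^2=D_y^2=0$. Identifying $S=\wedge^\bullet\mathfrak h$ one has $D_x=d$, $D_y=2\partial$ as operators, so $\ker D_x/\mathrm{im}\,D_x\cong H^\bullet(\mathfrak h^*,M)\otimes\chi$ and $\ker D_y/\mathrm{im}\,D_y\cong H_\bullet(\mathfrak h,M)\otimes\chi$ as $\widetilde W$-modules. **$\mathbf A$, $\delta_d$, $\delta_\partial$.** $\mathbb C^*$ acts on $\mathbf H$ and $C(V)$ by algebra automorphisms with $\lambda\cdot x=\lambda^{-1}x$, $\lambda\cdot y=\lambda y$ and (on $\mathbf H$) $\lambda\cdot w=w$. $\mathbf A=(\mathbf H\otimes C(V))^{\mathbb C^*}$, and $\mathbf A^{\widetilde W}$ is the subalgebra of invariants under conjugation by $\Delta(\widetilde W)$. Let $\epsilon=\pm1$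 on $\mathbf H\otimes C^{even}(V)$, resp. $\mathbf H\otimes C^{odd}(V)$. Define $\delta_d,\delta_\partial:\mathbf A^{\widetilde W}\to\mathbf A^{\widetilde W}$ by $\delta_d(a)=D_xa-\epsilon(a)D_x$, $\delta_\partial(a)=D_ya-\epsilon(a)D_y$. **Vogan's morphism.** One has $\ker\delta_d=\mathrm{im}\,\delta_d\oplus\Delta(\mathbb C[\widetilde W]^{\widetilde W})$, and likewise for $\delta_\partial$. An abelian subalgebra $\mathcal B\subset\ker\delta_d\cap(\mathbf H\otimes C^{even}(V))$ commutes with $D_x$ and $\Delta(\mathbb C[\widetilde W])$, hence acts on $\ker D_x/\mathrm{im}\,D_x$, and so on $H^\bullet(\mathfrak h^*,M)$ through the identification above (commuting with $W$). $\zeta_d:\mathcal B\to\Delta(\mathbb C[\widetilde W]^{\widetilde W})$ is the restriction to $\mathcal B$ of the projection in the direct sum; it is an algebra homomorphism. For a genuine irreducible $\widetilde W$-module $\widetilde\sigma$, $\zeta_d^*(\widetilde\sigma)\in\mathrm{Spec}\,\mathcal B$ is the character of $\mathcal B$ sending $b$ to the scalar by which any $z\in\mathbb C[\widetilde W]^{\widetilde W}$ with $\Delta(z)=\zeta_d(b)$ acts on $\widetilde\sigma$. $\zeta_\partial,\zeta_\partial^*$ are defined in the same way from $\delta_\partial$ and $D_y$. *)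

theory Defs
  imports
    "HOL-Algebra.QuotRing"
    "HOL-Algebra.Subrings"
    "HOL-Algebra.Generated_Groups"
    "HOL-Library.Poly_Mapping"
    "HOL-Library.Product_Plus"
    "HOL-Library.Function_Algebras"
    "HOL-Library.Set_Algebras"
    "Jordan_Normal_Form.Determinant"
    "Jordan_Normal_Form.Matrix_Kernel"
begin

section \<open>Free algebras and their tensor products\<close>

text \<open>
  The free monoid, written additively so that \<open>'g word \<Rightarrow>\<^sub>0 complex\<close>, with the convolution product of
  \<^theory>\<open>HOL-Library.Poly_Mapping\<close>, is the free algebra, and
  \<open>'g word \<times> 'k word \<Rightarrow>\<^sub>0 complex\<close> is the tensor product of two free algebras.
\<close>

datatype 'g word = Word (letters: "'g list")

instantiation word :: (type) monoid_add
begin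

definition zero_word :: "'a word" where
  "zero_word = Word []"

definition plus_word :: "'a word \<Rightarrow> 'a word \<Rightarrow> 'a word" where
  "plus_word u v = Word (letters u @ letters v)"

instance
  by standard (simp_all add: zero_word_def plus_word_def)

end

definition words :: "'g set \<Rightarrow> 'g word set" where
  "words G = {u. set (letters u) \<subseteq> G}"

definition monoid_algebra :: "'a::monoid_add set \<Rightarrow> ('a \<Rightarrow>\<^sub>0 complex) ring" where
  "monoid_algebra S =
    \<lparr>carrier = {f. Poly_Mapping.keys f \<subseteq> S}, mult = (*), one = 1, zero = 0, add = (+)\<rparr>"

definition scalar :: "complex \<Rightarrow> ('a::monoid_add \<Rightarrow>\<^sub>0 complex)" where
  "scalar k = Poly_Mapping.single 0 k"

definition gen :: "'g \<Rightarrow> ('g word \<Rightarrow>\<^sub>0 complex)" where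
  "gen g = Poly_Mapping.single (Word [g]) 1"

definition tens ::
  "('a \<Rightarrow>\<^sub>0 complex) \<Rightarrow> ('b \<Rightarrow>\<^sub>0 complex) \<Rightarrow> ('a \<times> 'b \<Rightarrow>\<^sub>0 complex)" where
  "tens f g = (\<Sum>u\<in>Poly_Mapping.keys f. \<Sum>v\<in>Poly_Mapping.keys g.
      Poly_Mapping.single (u, v) (Poly_Mapping.lookup f u * Poly_Mapping.lookup g v))"

text \<open>The linear map multiplying every basis element \<open>u\<close> by the scalar \<open>\<phi> u\<close>.\<close>

definition rescale :: "('a \<Rightarrow> complex) \<Rightarrow> ('a \<Rightarrow>\<^sub>0 complex) \<Rightarrow> ('a \<Rightarrow>\<^sub>0 complex)" where
  "rescale \<phi> f = (\<Sum>u\<in>Poly_Mapping.keys f. Poly_Mapping.single u (\<phi> u * Poly_Mapping.lookup f u))"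


section \<open>Complex reflection groups\<close>

text \<open>
  A basis \<open>y\<^sub>0, \<dots>, y\<^sub>n\<^sub>-\<^sub>1\<close> of \<open>\<hh>\<close> is fixed, with dual basis \<open>x\<^sub>0, \<dots>, x\<^sub>n\<^sub>-\<^sub>1\<close> of \<open>\<hh>\<^sup>*\<close>.  Elements of
  \<open>\<hh>\<close> and of \<open>\<hh>\<^sup>*\<close> are coordinate vectors in \<^term>\<open>carrier_vec n\<close>, and the natural pairing of
  \<open>\<hh>\<close> with \<open>\<hh>\<^sup>*\<close> is \<^term>\<open>scalar_prod\<close>.
\<close>

record cherednik_data =
  dm :: nat
  grp :: "complex mat set"
  root :: "complex mat \<Rightarrow> complex vec"
  coroot :: "complex mat \<Rightarrow> complex vec"
  tpar :: complex
  cpar :: "complex mat \<Rightarrow> complex"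

definition GL :: "nat \<Rightarrow> complex mat monoid" where
  "GL n = units_of (ring_mat TYPE(complex) n ())"

text \<open>The matrix of the action of \<open>g\<close> on \<open>\<hh>\<^sup>*\<close>.\<close>

definition dual_mat :: "nat \<Rightarrow> complex mat \<Rightarrow> complex mat" where
  "dual_mat n g = transpose_mat (inv\<^bsub>GL n\<^esub> g)"

definition refl_set :: "cherednik_data \<Rightarrow> complex mat set" where
  "refl_set D = {s \<in> grp D. Suc (kernel_dim (s - 1\<^sub>m (dm D))) = dm D}"

definition cherednik :: "cherednik_data \<Rightarrow> bool" where
  "cherednik D \<longleftrightarrow>
    subgroup (grp D) (GL (dm D)) \<and> finite (grp D) \<and>
    grp D = generate (GL (dm D)) (refl_set D) \<and>
    (\<forall>s\<in>refl_set D.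
      root D s \<in> carrier_vec (dm D) \<and> root D s \<noteq> 0\<^sub>v (dm D) \<and>
      (\<forall>y\<in>carrier_vec (dm D). s *\<^sub>v y = y \<longrightarrow> y \<bullet> root D s = 0) \<and>
      coroot D s \<in> carrier_vec (dm D) \<and> coroot D s \<noteq> 0\<^sub>v (dm D) \<and>
      (\<forall>x\<in>carrier_vec (dm D). dual_mat (dm D) s *\<^sub>v x = x \<longrightarrow> coroot D s \<bullet> x = 0)) \<and>
    (\<forall>s\<in>refl_set D. \<forall>w\<in>grp D. cpar D (w * s * inv\<^bsub>GL (dm D)\<^esub> w) = cpar D s)"


section \<open>The rational Cherednik algebra\<close>

datatype hgen = HX nat | HY nat | HW "complex mat"

type_synonym h_free = "hgen word \<Rightarrow>\<^sub>0 complex"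

definition hgens :: "cherednik_data \<Rightarrow> hgen set" where
  "hgens D = HX ` {..<dm D} \<union> HY ` {..<dm D} \<union> HW ` grp D"

definition H_free :: "cherednik_data \<Rightarrow> h_free ring" where
  "H_free D = monoid_algebra (words (hgens D))"

definition hx :: "nat \<Rightarrow> complex vec \<Rightarrow> h_free" where
  "hx n v = (\<Sum>i<n. scalar (v $ i) * gen (HX i))"

definition hy :: "nat \<Rightarrow> complex vec \<Rightarrow> h_free" where
  "hy n v = (\<Sum>i<n. scalar (v $ i) * gen (HY i))"

text \<open>
  The first four families of relations present \<open>T(\<hh> \<oplus> \<hh>\<^sup>*) \<rtimes> \<complex>[W]\<close>; the remaining ones are the
  defining relations of the rational Cherednik algebra, stated on basis vectors.
\<close>

definition H_rels :: "cherednik_data \<Rightarrow> h_free set" where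
  "H_rels D =
    {gen (HW (1\<^sub>m (dm D))) - 1} \<union>
    {gen (HW g) * gen (HW h) - gen (HW (g * h)) | g h. g \<in> grp D \<and> h \<in> grp D} \<union>
    {gen (HW g) * gen (HX i) - hx (dm D) (dual_mat (dm D) g *\<^sub>v unit_vec (dm D) i) * gen (HW g)
      | g i. g \<in> grp D \<and> i < dm D} \<union>
    {gen (HW g) * gen (HY i) - hy (dm D) (g *\<^sub>v unit_vec (dm D) i) * gen (HW g)
      | g i. g \<in> grp D \<and> i < dm D} \<union>
    {gen (HX i) * gen (HX j) - gen (HX j) * gen (HX i) | i j. i < dm D \<and> j < dm D} \<union>
    {gen (HY i) * gen (HY j) - gen (HY j) * gen (HY i) | i j. i < dm D \<and> j < dm D} \<union>
    {gen (HY i) * gen (HX j) - gen (HX j) * gen (HY i)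
      - (scalar (tpar D * (unit_vec (dm D) i \<bullet> unit_vec (dm D) j))
         - (\<Sum>s\<in>refl_set D.
              scalar (cpar D s
                * ((unit_vec (dm D) i \<bullet> root D s) * (coroot D s \<bullet> unit_vec (dm D) j)
                   / (coroot D s \<bullet> root D s)))
              * gen (HW s)))
      | i j. i < dm D \<and> j < dm D}"

definition H_alg :: "cherednik_data \<Rightarrow> h_free set ring" where
  "H_alg D = H_free D Quot (Idl\<^bsub>H_free D\<^esub> (H_rels D))"

definition h_class :: "cherednik_data \<Rightarrow> h_free \<Rightarrow> h_free set" where
  "h_class D f = (Idl\<^bsub>H_free D\<^esub> (H_rels D)) +>\<^bsub>H_free D\<^esub> f"

text \<open>
  Left modules; the complex vector space structure is the action of the scalars of the algebra.
\<close>

definition H_module ::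
  "cherednik_data \<Rightarrow> (h_free set \<Rightarrow> 'm::ab_group_add \<Rightarrow> 'm) \<Rightarrow> bool" where
  "H_module D act \<longleftrightarrow>
    (\<forall>a\<in>carrier (H_alg D). \<forall>m m'. act a (m + m') = act a m + act a m') \<and>
    (\<forall>a\<in>carrier (H_alg D). \<forall>b\<in>carrier (H_alg D). \<forall>m.
      act (a \<oplus>\<^bsub>H_alg D\<^esub> b) m = act a m + act b m \<and>
      act (a \<otimes>\<^bsub>H_alg D\<^esub> b) m = act a (act b m)) \<and>
    (\<forall>m. act \<one>\<^bsub>H_alg D\<^esub> m = m)"

definition mscale ::
  "cherednik_data \<Rightarrow> (h_free set \<Rightarrow> 'm::ab_group_add \<Rightarrow> 'm) \<Rightarrow> complex \<Rightarrow> 'm \<Rightarrow> 'm" where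
  "mscale D act k = act (h_class D (scalar k))"


section \<open>The Clifford algebra and the spinor module\<close>

datatype vgen = VX nat | VY nat

type_synonym c_free = "vgen word \<Rightarrow>\<^sub>0 complex"

definition vgens :: "nat \<Rightarrow> vgen set" where
  "vgens n = VX ` {..<n} \<union> VY ` {..<n}"

definition C_free :: "nat \<Rightarrow> c_free ring" where
  "C_free n = monoid_algebra (words (vgens n))"

definition C_rels :: "nat \<Rightarrow> c_free set" where
  "C_rels n =
    {gen (VX i) * gen (VX j) + gen (VX j) * gen (VX i) | i j. i < n \<and> j < n} \<union>
    {gen (VY i) * gen (VY j) + gen (VY j) * gen (VY i) | i j. i < n \<and> j < n} \<union>
    {gen (VX i) * gen (VY j) + gen (VY j) * gen (VX i) - scalar (if i = j then - 2 else 0)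
      | i j. i < n \<and> j < n}"

definition C_alg :: "nat \<Rightarrow> c_free set ring" where
  "C_alg n = C_free n Quot (Idl\<^bsub>C_free n\<^esub> (C_rels n))"

definition c_class :: "nat \<Rightarrow> c_free \<Rightarrow> c_free set" where
  "c_class n f = (Idl\<^bsub>C_free n\<^esub> (C_rels n)) +>\<^bsub>C_free n\<^esub> f"

definition cx :: "nat \<Rightarrow> complex vec \<Rightarrow> c_free" where
  "cx n v = (\<Sum>i<n. scalar (v $ i) * gen (VX i))"

definition cy :: "nat \<Rightarrow> complex vec \<Rightarrow> c_free" where
  "cy n v = (\<Sum>i<n. scalar (v $ i) * gen (VY i))"

text \<open>
  For an abelian group \<open>M\<close>, an element of \<open>M \<otimes> \<And>\<hh>\<close> is written as
  \<open>\<Sum>\<^sub>I \<psi>(I) \<otimes> y\<^sub>I\<close> with \<open>y\<^sub>I = y\<^bsub>i\<^sub>1\<^esub> \<and> \<dots> \<and> y\<^bsub>i\<^sub>p\<^esub>\<close> for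
  \<open>I = {i\<^sub>1 < \<dots> < i\<^sub>p} \<subseteq> {..<n}\<close>; the spinor module \<open>S = \<And>\<hh>\<close> itself is the case \<open>M = \<complex>\<close>.
  \<open>creat j\<close> is \<open>y\<^sub>j \<and> _\<close>.  \<open>contr j\<close> sends \<open>y\<^bsub>i\<^sub>1\<^esub> \<and> \<dots> \<and> y\<^bsub>i\<^sub>p\<^esub>\<close> with \<open>i\<^sub>k = j\<close>, \<open>1 \<le> k \<le> p\<close>, to
  \<open>(-1)\<^sup>k\<close> times the product with the factor \<open>y\<^sub>j\<close> omitted.
\<close>

definition sgn_mult :: "nat \<Rightarrow> 'm::ab_group_add \<Rightarrow> 'm" where
  "sgn_mult k m = (if even k then m else - m)"

definition creat :: "nat \<Rightarrow> (nat set \<Rightarrow> 'm::ab_group_add) \<Rightarrow> nat set \<Rightarrow> 'm" where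
  "creat j \<psi> = (\<lambda>I. if j \<in> I then sgn_mult (card {i \<in> I. i < j}) (\<psi> (I - {j})) else 0)"

definition contr :: "nat \<Rightarrow> (nat set \<Rightarrow> 'm::ab_group_add) \<Rightarrow> nat set \<Rightarrow> 'm" where
  "contr j \<psi> = (\<lambda>I. if j \<notin> I then sgn_mult (Suc (card {i \<in> I. i < j})) (\<psi> (insert j I)) else 0)"

fun spin_gen :: "vgen \<Rightarrow> (nat set \<Rightarrow> 'm::ab_group_add) \<Rightarrow> nat set \<Rightarrow> 'm" where
  "spin_gen (VY j) \<psi> = creat j \<psi>"
| "spin_gen (VX j) \<psi> = contr j \<psi> + contr j \<psi>"

definition spin_word :: "vgen word \<Rightarrow> (nat set \<Rightarrow> 'm::ab_group_add) \<Rightarrow> nat set \<Rightarrow> 'm" where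
  "spin_word v = foldr spin_gen (letters v)"

definition spin_act :: "c_free set \<Rightarrow> (nat set \<Rightarrow> complex) \<Rightarrow> nat set \<Rightarrow> complex" where
  "spin_act X \<phi> = (let f = (SOME f. f \<in> X) in
    (\<lambda>I. \<Sum>v\<in>Poly_Mapping.keys f. Poly_Mapping.lookup f v * spin_word v \<phi> I))"

definition vac :: "nat set \<Rightarrow> complex" where
  "vac I = (if I = {} then 1 else 0)"


section \<open>The double cover of the reflection group\<close>

definition mu :: "cherednik_data \<Rightarrow> complex mat \<Rightarrow> c_free set" where
  "mu D s = c_class (dm D)
    (scalar ((csqrt (det s) - 1 / csqrt (det s)) / (2 * (coroot D s \<bullet> root D s)))
       * cx (dm D) (root D s) * cy (dm D) (coroot D s)
     + scalar (csqrt (det s)))"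

definition Wt :: "cherednik_data \<Rightarrow> c_free set set" where
  "Wt D = generate (units_of (C_alg (dm D)))
    (mu D ` refl_set D \<union> (\<lambda>s. \<ominus>\<^bsub>C_alg (dm D)\<^esub> mu D s) ` refl_set D)"

text \<open>
  The covering homomorphism \<open>p\<close> with \<open>p(\<plusminus>\<mu>\<^sub>s) = s\<close>: its graph is the subgroup of
  \<open>C(V)\<^sup>\<times> \<times> GL(\<hh>)\<close> generated by the pairs \<open>(\<plusminus>\<mu>\<^sub>s, s)\<close>.
\<close>

definition cover :: "cherednik_data \<Rightarrow> c_free set \<Rightarrow> complex mat" where
  "cover D w = (THE g. (w, g) \<in> generate (units_of (C_alg (dm D)) \<times>\<times> GL (dm D))
    ((\<lambda>s. (mu D s, s)) ` refl_set D \<union> (\<lambda>s. (\<ominus>\<^bsub>C_alg (dm D)\<^esub> mu D s, s)) ` refl_set D))"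

definition chi :: "c_free set \<Rightarrow> complex" where
  "chi w = spin_act w vac {}"


section \<open>The tensor product of the two algebras\<close>

type_synonym hc_free = "hgen word \<times> vgen word \<Rightarrow>\<^sub>0 complex"

text \<open>
  For algebras \<open>A/I\<close> and \<open>B/J\<close>, the tensor product is \<open>(A \<otimes> B)/(I \<otimes> B + A \<otimes> J)\<close>, and
  \<open>I \<otimes> B + A \<otimes> J\<close> is generated by \<open>r \<otimes> 1\<close> and \<open>1 \<otimes> r'\<close> for generators \<open>r\<close> of \<open>I\<close> and \<open>r'\<close> of \<open>J\<close>.
\<close>

definition HC_free :: "cherednik_data \<Rightarrow> hc_free ring" where
  "HC_free D = monoid_algebra (words (hgens D) \<times> words (vgens (dm D)))"

definition HC_rels :: "cherednik_data \<Rightarrow> hc_free set" where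
  "HC_rels D = (\<lambda>r. tens r 1) ` H_rels D \<union> (\<lambda>r. tens 1 r) ` C_rels (dm D)"

definition HC :: "cherednik_data \<Rightarrow> hc_free set ring" where
  "HC D = HC_free D Quot (Idl\<^bsub>HC_free D\<^esub> (HC_rels D))"

definition hc_class :: "cherednik_data \<Rightarrow> hc_free \<Rightarrow> hc_free set" where
  "hc_class D f = (Idl\<^bsub>HC_free D\<^esub> (HC_rels D)) +>\<^bsub>HC_free D\<^esub> f"

text \<open>The pure tensor of two classes; the union is over equal cosets.\<close>

definition ctens :: "cherednik_data \<Rightarrow> h_free set \<Rightarrow> c_free set \<Rightarrow> hc_free set" where
  "ctens D X Y = (\<Union>f\<in>X. \<Union>g\<in>Y. hc_class D (tens f g))"

definition hc_scalar :: "cherednik_data \<Rightarrow> complex \<Rightarrow> hc_free set" where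
  "hc_scalar D k = hc_class D (scalar k)"

definition HC_even :: "cherednik_data \<Rightarrow> hc_free set set" where
  "HC_even D = {hc_class D f | f. f \<in> carrier (HC_free D) \<and>
    (\<forall>(u, v)\<in>Poly_Mapping.keys f. even (length (letters v)))}"

text \<open>
  A rescaling of the basis words that is compatible with the relations maps cosets to cosets, so
  that the induced map of the quotient is the image map.
\<close>

definition parity :: "hc_free set \<Rightarrow> hc_free set" where
  "parity X = rescale (\<lambda>(u, v). (- 1) ^ length (letters v)) ` X"

fun h_weight :: "hgen \<Rightarrow> int" where
  "h_weight (HX i) = - 1"
| "h_weight (HY i) = 1"
| "h_weight (HW g) = 0"

fun v_weight :: "vgen \<Rightarrow> int" where
  "v_weight (VX i) = - 1"
| "v_weight (VY i) = 1"

definition torus :: "complex \<Rightarrow> hc_free set \<Rightarrow> hc_free set" where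
  "torus l X = rescale
    (\<lambda>(u, v). l powi (sum_list (map h_weight (letters u)) + sum_list (map v_weight (letters v)))) ` X"

definition A_alg :: "cherednik_data \<Rightarrow> hc_free set set" where
  "A_alg D = {a \<in> carrier (HC D). \<forall>l. l \<noteq> 0 \<longrightarrow> torus l a = a}"

definition Delta_grp :: "cherednik_data \<Rightarrow> c_free set \<Rightarrow> hc_free set" where
  "Delta_grp D w = ctens D (h_class D (gen (HW (cover D w)))) w"

text \<open>
  An element of the group algebra of \<^term>\<open>Wt D\<close> is a finitely supported function on \<^term>\<open>Wt D\<close>;
  the invariants are taken for the conjugation action.
\<close>

definition Delta :: "cherednik_data \<Rightarrow> (c_free set \<Rightarrow>\<^sub>0 complex) \<Rightarrow> hc_free set" where
  "Delta D z = (\<Oplus>\<^bsub>HC D\<^esub>w\<in>Poly_Mapping.keys z.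
    hc_scalar D (Poly_Mapping.lookup z w) \<otimes>\<^bsub>HC D\<^esub> Delta_grp D w)"

definition Wt_inv :: "cherednik_data \<Rightarrow> (c_free set \<Rightarrow>\<^sub>0 complex) set" where
  "Wt_inv D = {z. Poly_Mapping.keys z \<subseteq> Wt D \<and>
    (\<forall>u\<in>Wt D. \<forall>w\<in>Wt D.
      Poly_Mapping.lookup z
        (u \<otimes>\<^bsub>C_alg (dm D)\<^esub> w \<otimes>\<^bsub>C_alg (dm D)\<^esub> inv\<^bsub>C_alg (dm D)\<^esub> u)
      = Poly_Mapping.lookup z w)}"

definition A_inv :: "cherednik_data \<Rightarrow> hc_free set set" where
  "A_inv D = {a \<in> A_alg D. \<forall>w\<in>Wt D.
    Delta_grp D w \<otimes>\<^bsub>HC D\<^esub> a \<otimes>\<^bsub>HC D\<^esub> inv\<^bsub>HC D\<^esub> (Delta_grp D w) = a}"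


section \<open>Half-Dirac operators\<close>

definition Dx :: "cherednik_data \<Rightarrow> hc_free set" where
  "Dx D = (\<Oplus>\<^bsub>HC D\<^esub>i\<in>{..<dm D}.
    ctens D (h_class D (gen (HX i))) (c_class (dm D) (gen (VY i))))"

definition Dy :: "cherednik_data \<Rightarrow> hc_free set" where
  "Dy D = (\<Oplus>\<^bsub>HC D\<^esub>i\<in>{..<dm D}.
    ctens D (h_class D (gen (HY i))) (c_class (dm D) (gen (VX i))))"

text \<open>\<open>delta D (Dx D)\<close> and \<open>delta D (Dy D)\<close> are the two derivations \<open>\<delta>\<^sub>d\<close> and \<open>\<delta>\<^sub>\<partial>\<close>.\<close>

definition delta :: "cherednik_data \<Rightarrow> hc_free set \<Rightarrow> hc_free set \<Rightarrow> hc_free set" where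
  "delta D E a = E \<otimes>\<^bsub>HC D\<^esub> a \<ominus>\<^bsub>HC D\<^esub> parity a \<otimes>\<^bsub>HC D\<^esub> E"

definition ker_delta :: "cherednik_data \<Rightarrow> hc_free set \<Rightarrow> hc_free set set" where
  "ker_delta D E = {a \<in> A_inv D. delta D E a = \<zero>\<^bsub>HC D\<^esub>}"

definition im_delta :: "cherednik_data \<Rightarrow> hc_free set \<Rightarrow> hc_free set set" where
  "im_delta D E = delta D E ` A_inv D"


section \<open>Abelian subalgebras and Vogan's morphism\<close>

definition abelian_subalgebra :: "cherednik_data \<Rightarrow> hc_free set set \<Rightarrow> bool" where
  "abelian_subalgebra D B \<longleftrightarrow> subcring B (HC D) \<and> (\<forall>k. hc_scalar D k \<in> B)"

definition alg_character :: "cherednik_data \<Rightarrow> hc_free set set \<Rightarrow> (hc_free set \<Rightarrow> complex) \<Rightarrow> bool" where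
  "alg_character D B \<beta> \<longleftrightarrow>
    (\<forall>a\<in>B. \<forall>b\<in>B. \<beta> (a \<oplus>\<^bsub>HC D\<^esub> b) = \<beta> a + \<beta> b \<and> \<beta> (a \<otimes>\<^bsub>HC D\<^esub> b) = \<beta> a * \<beta> b) \<and>
    (\<forall>k. \<beta> (hc_scalar D k) = k)"

text \<open>
  \<open>\<zeta>\<close> agrees on \<open>B\<close> with the projection of \<open>ker \<delta> = im \<delta> \<oplus> \<Delta>(\<complex>[Wt]\<^bsup>Wt\<^esup>)\<close> onto the second summand:
  \<open>\<zeta> b\<close> lies in the second summand and \<open>b - \<zeta> b\<close> in the first.  Since the sum is direct, this
  determines \<open>\<zeta>\<close> on \<open>B\<close>.
\<close>

definition vogan_morphism ::
  "cherednik_data \<Rightarrow> hc_free set \<Rightarrow> hc_free set set \<Rightarrow> (hc_free set \<Rightarrow> hc_free set) \<Rightarrow> bool" where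
  "vogan_morphism D E B \<zeta> \<longleftrightarrow>
    (\<forall>b\<in>B. \<zeta> b \<in> Delta D ` Wt_inv D \<and> b \<ominus>\<^bsub>HC D\<^esub> \<zeta> b \<in> im_delta D E)"

definition group_alg_act ::
  "(complex \<Rightarrow> 'u::ab_group_add \<Rightarrow> 'u) \<Rightarrow> (c_free set \<Rightarrow> 'u \<Rightarrow> 'u) \<Rightarrow>
    (c_free set \<Rightarrow>\<^sub>0 complex) \<Rightarrow> 'u \<Rightarrow> 'u" where
  "group_alg_act sc \<tau> z u = (\<Sum>w\<in>Poly_Mapping.keys z. sc (Poly_Mapping.lookup z w) (\<tau> w u))"

definition zeta_star ::
  "cherednik_data \<Rightarrow> (hc_free set \<Rightarrow> hc_free set) \<Rightarrow> (complex \<Rightarrow> 'u::ab_group_add \<Rightarrow> 'u) \<Rightarrow>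
    (c_free set \<Rightarrow> 'u \<Rightarrow> 'u) \<Rightarrow> hc_free set \<Rightarrow> complex" where
  "zeta_star D \<zeta> sc \<tau> b =
    (THE k. \<forall>z\<in>Wt_inv D. Delta D z = \<zeta> b \<longrightarrow> (\<forall>u. group_alg_act sc \<tau> z u = sc k u))"


section \<open>Representations of the reflection group\<close>

definition irreducible_rep ::
  "cherednik_data \<Rightarrow> (complex \<Rightarrow> 'u::ab_group_add \<Rightarrow> 'u) \<Rightarrow> (complex mat \<Rightarrow> 'u \<Rightarrow> 'u) \<Rightarrow> bool" where
  "irreducible_rep D sc \<sigma> \<longleftrightarrow>
    vector_space sc \<and>
    (\<forall>g\<in>grp D. Vector_Spaces.linear sc sc (\<sigma> g)) \<and>
    \<sigma> (1\<^sub>m (dm D)) = id \<and>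
    (\<forall>g\<in>grp D. \<forall>h\<in>grp D. \<sigma> (g * h) = \<sigma> g \<circ> \<sigma> h) \<and>
    (\<exists>u::'u. u \<noteq> 0) \<and>
    (\<forall>U. Modules.module.subspace sc U \<and> (\<forall>g\<in>grp D. \<sigma> g ` U \<subseteq> U) \<longrightarrow> U = {0} \<or> U = UNIV)"

definition twist_chi ::
  "cherednik_data \<Rightarrow> (complex \<Rightarrow> 'u \<Rightarrow> 'u) \<Rightarrow> (complex mat \<Rightarrow> 'u \<Rightarrow> 'u) \<Rightarrow> c_free set \<Rightarrow> 'u \<Rightarrow> 'u" where
  "twist_chi D sc \<sigma> w u = sc (chi w) (\<sigma> (cover D w) u)"


section \<open>Cohomology and homology\<close>

definition MS :: "nat \<Rightarrow> (nat set \<Rightarrow> 'm::zero) set" where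
  "MS n = {\<psi>. \<forall>I. \<not> I \<subseteq> {..<n} \<longrightarrow> \<psi> I = 0}"

text \<open>The action of \<open>H \<otimes> C(V)\<close> on \<open>M \<otimes> S\<close>, given by \<open>(h \<otimes> c)(m \<otimes> s) = hm \<otimes> cs\<close>.\<close>

definition hc_act ::
  "cherednik_data \<Rightarrow> (h_free set \<Rightarrow> 'm::ab_group_add \<Rightarrow> 'm) \<Rightarrow> hc_free set \<Rightarrow>
    (nat set \<Rightarrow> 'm) \<Rightarrow> nat set \<Rightarrow> 'm" where
  "hc_act D act X \<psi> = (let f = (SOME f. f \<in> X) in
    (\<lambda>I. \<Sum>(u, v)\<in>Poly_Mapping.keys f.
      act (h_class D (Poly_Mapping.single u (Poly_Mapping.lookup f (u, v)))) (spin_word v \<psi> I)))"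

definition d_op ::
  "cherednik_data \<Rightarrow> (h_free set \<Rightarrow> 'm::ab_group_add \<Rightarrow> 'm) \<Rightarrow>
    (nat set \<Rightarrow> 'm) \<Rightarrow> nat set \<Rightarrow> 'm" where
  "d_op D act \<psi> = (\<lambda>I. \<Sum>j<dm D. act (h_class D (gen (HX j))) (creat j \<psi> I))"

definition bd_op ::
  "cherednik_data \<Rightarrow> (h_free set \<Rightarrow> 'm::ab_group_add \<Rightarrow> 'm) \<Rightarrow>
    (nat set \<Rightarrow> 'm) \<Rightarrow> nat set \<Rightarrow> 'm" where
  "bd_op D act \<psi> = (\<lambda>I. \<Sum>j<dm D. act (h_class D (gen (HY j))) (contr j \<psi> I))"

text \<open>\<open>w_wedge n w I\<close> is \<open>w y\<^bsub>i\<^sub>1\<^esub> \<and> \<dots> \<and> w y\<^bsub>i\<^sub>p\<^esub>\<close> for \<open>I = {i\<^sub>1 < \<dots> < i\<^sub>p}\<close>.\<close>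

definition wedge_vec :: "nat \<Rightarrow> complex vec \<Rightarrow> (nat set \<Rightarrow> complex) \<Rightarrow> nat set \<Rightarrow> complex" where
  "wedge_vec n y \<phi> = (\<lambda>I. \<Sum>j<n. y $ j * creat j \<phi> I)"

definition w_wedge :: "nat \<Rightarrow> complex mat \<Rightarrow> nat set \<Rightarrow> nat set \<Rightarrow> complex" where
  "w_wedge n w I = foldr (\<lambda>i. wedge_vec n (w *\<^sub>v unit_vec n i)) (sorted_list_of_set I) vac"

text \<open>The diagonal action of \<open>W\<close> on \<open>M \<otimes> \<And>\<hh>\<close>.\<close>

definition w_diag ::
  "cherednik_data \<Rightarrow> (h_free set \<Rightarrow> 'm::ab_group_add \<Rightarrow> 'm) \<Rightarrow> complex mat \<Rightarrow>
    (nat set \<Rightarrow> 'm) \<Rightarrow> nat set \<Rightarrow> 'm" where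
  "w_diag D act w \<psi> = (\<lambda>K. \<Sum>I\<in>Pow {..<dm D}.
    mscale D act (w_wedge (dm D) w I K) (act (h_class D (gen (HW w))) (\<psi> I)))"

text \<open>
  The total (co)homology of the complex \<open>(M \<otimes> \<And>\<hh>, \<partial>)\<close> is \<open>ker \<partial> / im \<partial>\<close>, which is the direct sum
  over all degrees.  Its elements are the cosets \<open>\<psi> + im \<partial>\<close>, added as sets.  \<open>on_cosets\<close> is the map
  induced on the cosets by an operator \<open>f\<close> preserving \<open>im \<partial>\<close>, as a union of equal cosets.
\<close>

definition total_im :: "nat \<Rightarrow> ((nat set \<Rightarrow> 'm::zero) \<Rightarrow> nat set \<Rightarrow> 'm) \<Rightarrow> (nat set \<Rightarrow> 'm) set" where
  "total_im n op = op ` MS n"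

definition total_coh ::
  "nat \<Rightarrow> ((nat set \<Rightarrow> 'm::ab_group_add) \<Rightarrow> nat set \<Rightarrow> 'm) \<Rightarrow> (nat set \<Rightarrow> 'm) set set" where
  "total_coh n op = {\<psi> +o total_im n op | \<psi>. \<psi> \<in> MS n \<and> op \<psi> = 0}"

definition on_cosets ::
  "nat \<Rightarrow> ((nat set \<Rightarrow> 'm::ab_group_add) \<Rightarrow> nat set \<Rightarrow> 'm) \<Rightarrow>
    ((nat set \<Rightarrow> 'm) \<Rightarrow> nat set \<Rightarrow> 'm) \<Rightarrow> (nat set \<Rightarrow> 'm) set \<Rightarrow> (nat set \<Rightarrow> 'm) set" where
  "on_cosets n op f X = (\<Union>\<psi>\<in>X. f \<psi> +o total_im n op)"

text \<open>
  \<open>\<sigma> \<otimes> \<beta>\<close> is an isotypical component: there is an injective linear map from \<open>\<sigma>\<close> to the (co)homology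
  commuting with the diagonal \<open>W\<close>-action, on whose image \<open>B\<close> acts by \<open>\<beta>\<close>.  As \<open>\<And>\<hh> = S\<close> as vector
  spaces, \<open>B\<close> acts on the (co)homology by its action on \<open>M \<otimes> S\<close>.
\<close>

definition isotypical_component ::
  "cherednik_data \<Rightarrow> (h_free set \<Rightarrow> 'm::ab_group_add \<Rightarrow> 'm) \<Rightarrow>
    ((nat set \<Rightarrow> 'm) \<Rightarrow> nat set \<Rightarrow> 'm) \<Rightarrow> hc_free set set \<Rightarrow>
    (complex \<Rightarrow> 'u::ab_group_add \<Rightarrow> 'u) \<Rightarrow> (complex mat \<Rightarrow> 'u \<Rightarrow> 'u) \<Rightarrow>
    (hc_free set \<Rightarrow> complex) \<Rightarrow> bool" where
  "isotypical_component D act op B sc \<sigma> \<beta> \<longleftrightarrow>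
    (\<exists>\<phi> :: 'u \<Rightarrow> (nat set \<Rightarrow> 'm) set.
      inj \<phi> \<and> range \<phi> \<subseteq> total_coh (dm D) op \<and>
      (\<forall>u v. \<phi> (u + v) = \<phi> u + \<phi> v) \<and>
      (\<forall>k u. \<phi> (sc k u) = on_cosets (dm D) op (\<lambda>\<psi> I. mscale D act k (\<psi> I)) (\<phi> u)) \<and>
      (\<forall>w\<in>grp D. \<forall>u. \<phi> (\<sigma> w u) = on_cosets (dm D) op (w_diag D act w) (\<phi> u)) \<and>
      (\<forall>b\<in>B. \<forall>u. on_cosets (dm D) op (hc_act D act b) (\<phi> u)
        = on_cosets (dm D) op (\<lambda>\<psi> I. mscale D act (\<beta> b) (\<psi> I)) (\<phi> u)))"

end

theory Submission
  imports Defs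
begin

text \<open>
  Let \<open>\<psi>\<close> be a cycle representing an element of the isotypical component that corresponds to \<open>u\<close> in
  \<open>\<sigma>\<close>, and write \<open>b - \<zeta>(b) = E a - \<epsilon>(a) E\<close> with \<open>E\<close> the half-Dirac operator.  Since \<open>E \<psi> = 0\<close>, the
  difference \<open>b \<psi> - \<zeta>(b) \<psi> = E (a \<psi>)\<close> is a boundary, so \<open>b\<close> and \<open>\<zeta>(b) = \<Delta>(z)\<close> agree on (co)homology.
  There \<open>b\<close> acts by \<open>\<beta>(b)\<close>, while \<open>\<Delta>(w)\<close> acts by \<open>\<chi>(w)\<close> times the diagonal action of \<open>p(w)\<close>, hence
  \<open>\<Delta>(z)\<close> acts as \<open>z\<close> does on \<open>\<sigma> \<otimes> \<chi>\<close>.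

  The identity \<open>S = \<chi> \<otimes> \<And>\<hh>\<close> comes from two properties of the lifts \<open>\<mu>\<^sub>s\<close> that pass to the group they
  generate: \<open>\<mu>\<^sub>s y = s(y) \<mu>\<^sub>s\<close> in \<open>C(V)\<close> for \<open>y\<close> in \<open>\<hh>\<close>, and \<open>\<mu>\<^sub>s\<close> preserves the vacuum line.  They rest on
  the form \<open>s(y) = y + k \<langle>y, \<alpha>\<rangle> \<alpha>\<^sup>\<or>\<close> of a reflection with \<open>det s = 1 + k \<langle>\<alpha>\<^sup>\<or>, \<alpha>\<rangle>\<close>, where finite order
  forces \<open>\<langle>\<alpha>\<^sup>\<or>, \<alpha>\<rangle> \<noteq> 0\<close>.
\<close>

section \<open>Algebras given by generators and relations, and their modules\<close>

text \<open>The operators in the statement are defined through choices: \<open>hc_act\<close> and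
  \<open>spin_act\<close> evaluate an arbitrary representative of a coset, \<open>ctens\<close> and
  \<open>parity\<close> are a union and an image over cosets, \<open>cover\<close> is a definite
  description. For the two actions the locales below settle well-definedness once: an action of the
  basis monoid extends to the free algebra, and descends to the quotient as soon as the relations
  act by zero. A second obstacle is that M is only an abelian group, on which complex numbers act
  through H. The Clifford generators have integer matrices on the monomials of S, so they commute
  with every additive map of coefficients; this carries identities proved on S over to M \<otimes> S
  through the matrix of a Clifford element. For the covering map to be well defined, vectors of
  \<hh> must be distinguishable in C(V). This is read off the spinor module: y applied to the vacuum
  gives back the coordinates of y. The comparison on (co)homology is made for an arbitrary z with
  \<open>Delta D z = \<zeta> b\<close>, since \<open>zeta_star\<close> quantifies over all such
  z.\<close>

lemma poly_mapping_sum_single: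
  "(\<Sum>u\<in>Poly_Mapping.keys f. Poly_Mapping.single u (Poly_Mapping.lookup f u)) = f"
  by (rule poly_mapping_eqI)
    (auto simp: lookup_sum lookup_single when_def in_keys_iff if_distrib cong: if_cong)

lemma carrier_monoid_algebra [simp]:
  "f \<in> carrier (monoid_algebra S) \<longleftrightarrow> Poly_Mapping.keys f \<subseteq> S"
  and mult_monoid_algebra [simp]: "f \<otimes>\<^bsub>monoid_algebra S\<^esub> g = f * g"
  and add_monoid_algebra [simp]: "f \<oplus>\<^bsub>monoid_algebra S\<^esub> g = f + g"
  and one_monoid_algebra [simp]: "\<one>\<^bsub>monoid_algebra S\<^esub> = 1"
  and zero_monoid_algebra [simp]: "\<zero>\<^bsub>monoid_algebra S\<^esub> = 0"
  by (simp_all add: monoid_algebra_def)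

lemma monoid_algebra_induct [consumes 1, case_names zero single add]:
  assumes "f \<in> carrier (monoid_algebra S)"
    and "P 0"
    and "\<And>u k. u \<in> S \<Longrightarrow> P (Poly_Mapping.single u k)"
    and "\<And>f g. f \<in> carrier (monoid_algebra S) \<Longrightarrow> g \<in> carrier (monoid_algebra S) \<Longrightarrow>
      P f \<Longrightarrow> P g \<Longrightarrow> P (f + g)"
  shows "P f"
proof -
  \<comment> \<open>The support bound is carried along with \<open>P\<close> because the additive
    case demands that both summands lie in the carrier.\<close>
  have "Poly_Mapping.keys (\<Sum>u\<in>U. Poly_Mapping.single u (Poly_Mapping.lookup f u)) \<subseteq> S
      \<and> P (\<Sum>u\<in>U. Poly_Mapping.single u (Poly_Mapping.lookup f u))"
    if "U \<subseteq> Poly_Mapping.keys f" for U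
    using finite_subset[OF that finite_keys] that
  proof (induction U rule: finite_induct)
    case (insert u U)
    have k: "Poly_Mapping.keys (Poly_Mapping.single u (Poly_Mapping.lookup f u)) \<subseteq> S"
      using insert assms(1) by auto
    have "P (Poly_Mapping.single u (Poly_Mapping.lookup f u)
        + (\<Sum>u\<in>U. Poly_Mapping.single u (Poly_Mapping.lookup f u)))"
      using insert assms k by (intro assms(4)) auto
    with k insert show ?case
      using keys_add[of "Poly_Mapping.single u (Poly_Mapping.lookup f u)"
        "\<Sum>u\<in>U. Poly_Mapping.single u (Poly_Mapping.lookup f u)"] by auto
  qed (use assms in auto)
  from this[OF order_refl] show ?thesis by (simp add: poly_mapping_sum_single)
qed

text \<open>The basis is any additive monoid, not only words, so that C(V), H and their tensor
  product are handled together; for the last the monoid consists of pairs of words.\<close>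

locale submonoid_algebra =
  fixes S :: "'a::monoid_add set"
  assumes zero_mem: "0 \<in> S"
    and add_mem: "u \<in> S \<Longrightarrow> v \<in> S \<Longrightarrow> u + v \<in> S"
begin

abbreviation "F \<equiv> monoid_algebra S"

lemma F_add: "f \<in> carrier F \<Longrightarrow> g \<in> carrier F \<Longrightarrow> f + g \<in> carrier F"
  using keys_add[of f g] by auto

lemma F_uminus: "f \<in> carrier F \<Longrightarrow> - f \<in> carrier F"
  by (simp add: in_keys_iff subset_eq)

lemma F_diff: "f \<in> carrier F \<Longrightarrow> g \<in> carrier F \<Longrightarrow> f - g \<in> carrier F"
  using F_add[of f "- g"] F_uminus[of g] by simp

lemma F_mult: "f \<in> carrier F \<Longrightarrow> g \<in> carrier F \<Longrightarrow> f * g \<in> carrier F"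
  using keys_mult[of f g] add_mem by fastforce

lemma F_zero: "0 \<in> carrier F" by simp

lemma F_one: "1 \<in> carrier F" using zero_mem by simp

lemma F_scalar: "scalar k \<in> carrier F" using zero_mem by (simp add: scalar_def)

lemma F_sum: "(\<And>i. i \<in> I \<Longrightarrow> f i \<in> carrier F) \<Longrightarrow> sum f I \<in> carrier F"
  by (induction I rule: infinite_finite_induct) (use F_add F_zero in \<open>simp_all del: carrier_monoid_algebra\<close>)

lemmas F_closed = F_add F_uminus F_diff F_mult F_zero F_one F_scalar F_sum

lemma ring_F: "ring F"
proof (rule ringI)
  show "abelian_group F"
  proof (rule abelian_groupI)
    fix x assume "x \<in> carrier F"
    then show "\<exists>y\<in>carrier F. y \<oplus>\<^bsub>F\<^esub> x = \<zero>\<^bsub>F\<^esub>"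
      by (intro bexI[of _ "- x"] F_uminus) simp_all
  qed (use F_add in \<open>simp_all add: algebra_simps\<close>)
  show "Group.monoid F"
    by (rule monoidI) (use F_mult F_one in \<open>simp_all add: algebra_simps\<close>)
qed (simp_all add: algebra_simps)

sublocale F: ring F by (rule ring_F)

lemma a_inv_F: "f \<in> carrier F \<Longrightarrow> \<ominus>\<^bsub>F\<^esub> f = - f"
  by (rule F.minus_equality) (use F_uminus in simp_all)

end

section \<open>Quotients by ideals generated by relations\<close>

locale presented_algebra = submonoid_algebra S
  for S :: "'a::monoid_add set" +
  fixes R :: "('a \<Rightarrow>\<^sub>0 complex) set"
  assumes relations: "R \<subseteq> carrier (monoid_algebra S)"
begin

abbreviation "J \<equiv> Idl\<^bsub>F\<^esub> R"
abbreviation "Q \<equiv> F Quot J"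
abbreviation "cls f \<equiv> J +>\<^bsub>F\<^esub> f"

lemma ideal_J: "ideal J F"
  using F.genideal_ideal[OF relations] .

interpretation J: ideal J F by (rule ideal_J)

sublocale Q: ring Q by (rule J.quotient_is_ring)

lemma J_carrier: "f \<in> J \<Longrightarrow> f \<in> carrier F" by (rule J.a_Hcarr)
lemma J_rel: "r \<in> R \<Longrightarrow> r \<in> J" using F.genideal_self[OF relations] by auto
lemma J_zero: "0 \<in> J" using J.zero_closed by simp
lemma J_add: "f \<in> J \<Longrightarrow> g \<in> J \<Longrightarrow> f + g \<in> J" using J.a_closed by simp
lemma J_uminus: "f \<in> J \<Longrightarrow> - f \<in> J" using J.a_inv_closed a_inv_F J_carrier by metis
lemma J_diff: "f \<in> J \<Longrightarrow> g \<in> J \<Longrightarrow> f - g \<in> J" using J_add[of f "- g"] J_uminus by simp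
lemma J_left: "f \<in> J \<Longrightarrow> g \<in> carrier F \<Longrightarrow> g * f \<in> J" using J.I_l_closed by simp
lemma J_right: "f \<in> J \<Longrightarrow> g \<in> carrier F \<Longrightarrow> f * g \<in> J" using J.I_r_closed by simp

lemma J_sum: "(\<And>i. i \<in> I \<Longrightarrow> f i \<in> J) \<Longrightarrow> sum f I \<in> J"
  by (induction I rule: infinite_finite_induct) (simp_all add: J_zero J_add)

text \<open>The elements satisfying \<open>P\<close> form a two-sided ideal containing the
  relations, so they contain the smallest such ideal.\<close>

lemma J_induct [consumes 1, case_names rel zero add uminus left right]:
  assumes f: "f \<in> J"
    and rel: "\<And>r. r \<in> R \<Longrightarrow> P r"
    and zero: "P 0"
    and add: "\<And>f g. f \<in> carrier F \<Longrightarrow> g \<in> carrier F \<Longrightarrow> P f \<Longrightarrow> P g \<Longrightarrow> P (f + g)"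
    and uminus: "\<And>f. f \<in> carrier F \<Longrightarrow> P f \<Longrightarrow> P (- f)"
    and left: "\<And>f g. f \<in> carrier F \<Longrightarrow> g \<in> carrier F \<Longrightarrow> P f \<Longrightarrow> P (g * f)"
    and right: "\<And>f g. f \<in> carrier F \<Longrightarrow> g \<in> carrier F \<Longrightarrow> P f \<Longrightarrow> P (f * g)"
  shows "P f"
proof -
  let ?K = "{f \<in> carrier F. P f}"
  have "ideal ?K F"
  proof (rule idealI[OF ring_F])
    show "subgroup ?K (add_monoid F)"
    proof (rule subgroup.intro)
      fix x assume "x \<in> ?K"
      then show "inv\<^bsub>add_monoid F\<^esub> x \<in> ?K"
        using uminus[of x] F_uminus[of x] a_inv_F[of x] by (simp add: a_inv_def)
    qed (use zero add F_add F_zero in auto)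
  qed (use left right F_mult in auto)
  then have "J \<subseteq> ?K"
    by (rule F.genideal_minimal) (use rel relations in \<open>auto simp del: carrier_monoid_algebra\<close>)
  with f show ?thesis by auto
qed

lemma cls_closed: "f \<in> carrier F \<Longrightarrow> cls f \<in> carrier Q"
  using J.rcos_ring_hom by (rule ring_hom_closed)

lemma cls_mult: "f \<in> carrier F \<Longrightarrow> g \<in> carrier F \<Longrightarrow> cls f \<otimes>\<^bsub>Q\<^esub> cls g = cls (f * g)"
  using ring_hom_mult[OF J.rcos_ring_hom, of f g] by simp

lemma cls_add: "f \<in> carrier F \<Longrightarrow> g \<in> carrier F \<Longrightarrow> cls f \<oplus>\<^bsub>Q\<^esub> cls g = cls (f + g)"
  using ring_hom_add[OF J.rcos_ring_hom, of f g] by simp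

lemma cls_one: "\<one>\<^bsub>Q\<^esub> = cls 1"
  using ring_hom_one[OF J.rcos_ring_hom] by simp

lemma cls_zero: "\<zero>\<^bsub>Q\<^esub> = cls 0"
  using ring_hom_zero[OF J.rcos_ring_hom ring_F Q.ring_axioms] by simp

lemma cls_uminus: "f \<in> carrier F \<Longrightarrow> \<ominus>\<^bsub>Q\<^esub> cls f = cls (- f)"
  by (rule Q.minus_equality)
    (use cls_add[of "- f" f] F_uminus[of f] in \<open>simp_all add: cls_closed cls_zero del: carrier_monoid_algebra\<close>)

lemma cls_minus: "f \<in> carrier F \<Longrightarrow> g \<in> carrier F \<Longrightarrow> cls f \<ominus>\<^bsub>Q\<^esub> cls g = cls (f - g)"
  using cls_add[of f "- g"] F_uminus[of g]
  by (simp add: a_minus_def cls_uminus del: carrier_monoid_algebra)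

lemma cls_eq_iff: "f \<in> carrier F \<Longrightarrow> g \<in> carrier F \<Longrightarrow> cls f = cls g \<longleftrightarrow> f - g \<in> J"
  using F.quotient_eq_iff_same_a_r_cos[OF ideal_J, of f g] a_inv_F[of g]
  by (simp add: a_minus_def)

lemma cls_self: "f \<in> carrier F \<Longrightarrow> f \<in> cls f"
  by (rule J.a_rcos_self)

lemma carrier_Q_cases:
  assumes "X \<in> carrier Q"
  obtains f where "f \<in> carrier F" "X = cls f"
  using assms by (auto simp: FactRing_def A_RCOSETS_def')

text \<open>Serves the definitions that pick or run through arbitrary members of a coset.\<close>

lemma mem_cls:
  assumes "f \<in> carrier F" "g \<in> cls f"
  shows "g \<in> carrier F" "cls g = cls f" "g - f \<in> J"
proof -
  show g: "g \<in> carrier F"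
    using assms F.a_r_coset_subset_G[OF J.a_subset assms(1)] by blast
  show "cls g = cls f"
    using F.a_repr_independence[OF assms(2,1) J.a_subgroup] by simp
  then show "g - f \<in> J" using cls_eq_iff g assms(1) by blast
qed

lemma cls_sum:
  assumes "\<And>i. i \<in> I \<Longrightarrow> f i \<in> carrier F"
  shows "(\<Oplus>\<^bsub>Q\<^esub>i\<in>I. cls (f i)) = cls (sum f I)"
  using assms
proof (induction I rule: infinite_finite_induct)
  case (insert i I)
  then show ?case
    using F_sum[of I f] by (simp add: Q.finsum_insert cls_closed cls_add Pi_def del: carrier_monoid_algebra)
qed (simp_all add: cls_zero)

end

text \<open>
  \<open>A u k\<close> is the operator by which the multiple \<open>k u\<close> of the basis element \<open>u\<close> acts.
\<close>

locale monoid_module = submonoid_algebra S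
  for S :: "'a::monoid_add set" +
  fixes A :: "'a \<Rightarrow> complex \<Rightarrow> 'x::ab_group_add \<Rightarrow> 'x"
  assumes A_add: "u \<in> S \<Longrightarrow> A u k (x + y) = A u k x + A u k y"
    and A_add_coeff: "u \<in> S \<Longrightarrow> A u (k + l) x = A u k x + A u l x"
    and A_mult: "u \<in> S \<Longrightarrow> v \<in> S \<Longrightarrow> A (u + v) (k * l) x = A u k (A v l x)"
    and A_one: "A 0 1 x = x"
begin

text \<open>The coefficient is handed to \<open>A\<close> instead of multiplying the result, because
  the target is only an abelian group; on M \<otimes> S a scalar acts through H.\<close>

definition ev :: "('a \<Rightarrow>\<^sub>0 complex) \<Rightarrow> 'x \<Rightarrow> 'x" where
  "ev f x = (\<Sum>u\<in>Poly_Mapping.keys f. A u (Poly_Mapping.lookup f u) x)"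

lemma A_coeff_zero: "u \<in> S \<Longrightarrow> A u 0 x = 0"
  using A_add_coeff[of u 0 0 x] by simp

lemma ev_superset:
  "f \<in> carrier F \<Longrightarrow> finite U \<Longrightarrow> Poly_Mapping.keys f \<subseteq> U \<Longrightarrow> U \<subseteq> S \<Longrightarrow>
    ev f x = (\<Sum>u\<in>U. A u (Poly_Mapping.lookup f u) x)"
  unfolding ev_def by (rule sum.mono_neutral_left) (auto simp: in_keys_iff A_coeff_zero)

lemma ev_add:
  assumes "f \<in> carrier F" "g \<in> carrier F"
  shows "ev (f + g) x = ev f x + ev g x"
proof -
  let ?U = "Poly_Mapping.keys f \<union> Poly_Mapping.keys g"
  have U: "finite ?U" "?U \<subseteq> S" using assms by auto
  have "ev (f + g) x = (\<Sum>u\<in>?U. A u (Poly_Mapping.lookup (f + g) u) x)"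
    using F_add[OF assms] keys_add[of f g] U by (intro ev_superset) auto
  also have "\<dots> = (\<Sum>u\<in>?U. A u (Poly_Mapping.lookup f u) x) + (\<Sum>u\<in>?U. A u (Poly_Mapping.lookup g u) x)"
    unfolding sum.distrib[symmetric]
    by (intro sum.cong refl) (use U A_add_coeff in \<open>auto simp: lookup_add\<close>)
  finally show ?thesis
    using ev_superset[OF assms(1) U(1) _ U(2)] ev_superset[OF assms(2) U(1) _ U(2)] by simp
qed

lemma ev_zero [simp]: "ev 0 x = 0"
  by (simp add: ev_def)

lemma ev_single: "u \<in> S \<Longrightarrow> ev (Poly_Mapping.single u k) x = A u k x"
  by (cases "k = 0") (simp_all add: ev_def A_coeff_zero)

lemma ev_one [simp]: "ev 1 x = x"
  using ev_single[OF zero_mem, of 1 x] by (simp add: A_one)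

lemma ev_uminus: "f \<in> carrier F \<Longrightarrow> ev (- f) x = - ev f x"
  using ev_add[of f "- f" x] F_uminus[of f] by (simp add: eq_neg_iff_add_eq_0 add.commute)

lemma ev_diff: "f \<in> carrier F \<Longrightarrow> g \<in> carrier F \<Longrightarrow> ev (f - g) x = ev f x - ev g x"
  using ev_add[of f "- g" x] ev_uminus[of g] F_uminus[of g] by simp

lemma ev_sum: "(\<And>i. i \<in> I \<Longrightarrow> f i \<in> carrier F) \<Longrightarrow> ev (sum f I) x = (\<Sum>i\<in>I. ev (f i) x)"
proof (induction I rule: infinite_finite_induct)
  case (insert i I)
  then show ?case using F_sum[of I f] by (simp add: ev_add del: carrier_monoid_algebra)
qed simp_all

lemma ev_add_right: "f \<in> carrier F \<Longrightarrow> ev f (x + y) = ev f x + ev f y"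
  unfolding ev_def sum.distrib[symmetric] by (intro sum.cong refl) (auto simp: A_add)

lemma ev_zero_right: "f \<in> carrier F \<Longrightarrow> ev f 0 = 0"
  using ev_add_right[of f 0 0] by simp

lemma ev_mult:
  assumes f: "f \<in> carrier F" and g: "g \<in> carrier F"
  shows "ev (f * g) x = ev f (ev g x)"
  using f
proof (induction f rule: monoid_algebra_induct)
  case (single u k)
  have u: "Poly_Mapping.single u k \<in> carrier F" using single by auto
  show ?case using g
  proof (induction g rule: monoid_algebra_induct)
    case zero
    show ?case using ev_zero_right[OF u] by simp
  next
    case (single v l)
    then show ?case
      using \<open>u \<in> S\<close> add_mem by (simp add: mult_single ev_single A_mult)
  next
    case (add f g)
    then show ?case
      using u by (simp add: ev_add ev_add_right F_mult distrib_left del: carrier_monoid_algebra)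
  qed
next
  case (add f f')
  then show ?case
    using g by (simp add: ev_add F_mult distrib_right del: carrier_monoid_algebra)
qed simp

end

locale presented_module = presented_algebra S R + monoid_module S A
  for S :: "'a::monoid_add set" and R and A :: "'a \<Rightarrow> complex \<Rightarrow> 'x::ab_group_add \<Rightarrow> 'x" +
  assumes ev_rel: "r \<in> R \<Longrightarrow> ev r x = 0"
begin

text \<open>The vector is generalised because a right multiple \<open>f * g\<close> evaluates
  \<open>f\<close> at the new vector \<open>ev g x\<close>.\<close>

lemma ev_J: "f \<in> J \<Longrightarrow> ev f x = 0"
proof (induction f arbitrary: x rule: J_induct)
qed (simp_all add: ev_add ev_uminus ev_mult ev_zero_right ev_rel del: carrier_monoid_algebra)

text \<open>This is the well-definedness of \<open>spin_act\<close> and \<open>hc_act\<close>: two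
  representatives differ by an element of the ideal, which acts by zero.\<close>

lemma ev_some_representative:
  assumes "f \<in> carrier F"
  shows "ev (SOME g. g \<in> cls f) x = ev f x"
proof -
  let ?g = "SOME g. g \<in> cls f"
  have "?g \<in> cls f" using cls_self[OF assms] by (rule someI)
  note g = mem_cls[OF assms this]
  show ?thesis using ev_J[OF g(3), of x] ev_diff[OF g(1) assms, of x] by simp
qed

end

section \<open>Tensor products of free algebras\<close>

lemma lookup_tens: "Poly_Mapping.lookup (tens f g) (u, v) = Poly_Mapping.lookup f u * Poly_Mapping.lookup g v"
proof -
  have "Poly_Mapping.lookup (tens f g) (u, v)
    = (\<Sum>u'\<in>Poly_Mapping.keys f. \<Sum>v'\<in>Poly_Mapping.keys g.
        if u' = u \<and> v' = v then Poly_Mapping.lookup f u' * Poly_Mapping.lookup g v' else 0)"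
    unfolding tens_def lookup_sum lookup_single when_def by simp
  also have "\<dots> = (\<Sum>u'\<in>Poly_Mapping.keys f. if u' = u then
      (\<Sum>v'\<in>Poly_Mapping.keys g. if v' = v then Poly_Mapping.lookup f u' * Poly_Mapping.lookup g v' else 0) else 0)"
    by (intro sum.cong refl) auto
  finally show ?thesis by (auto simp: in_keys_iff)
qed

lemma tens_add_left: "tens (f + f') g = tens f g + tens f' g"
  and tens_add_right: "tens f (g + g') = tens f g + tens f g'"
  and tens_diff_left: "tens (f - f') g = tens f g - tens f' g"
  and tens_diff_right: "tens f (g - g') = tens f g - tens f g'"
  and tens_zero_left [simp]: "tens 0 g = 0"
  and tens_zero_right [simp]: "tens f 0 = 0"
  and tens_uminus_left: "tens (- f) g = - tens f g"
  and tens_uminus_right: "tens f (- g) = - tens f g"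
  by (rule poly_mapping_eqI; clarify; simp add: lookup_tens lookup_add lookup_minus algebra_simps)+

lemma tens_single: "tens (Poly_Mapping.single u k) (Poly_Mapping.single v l) = Poly_Mapping.single (u, v) (k * l)"
  by (rule poly_mapping_eqI) (auto simp: lookup_tens lookup_single when_def split: if_splits)

lemma tens_mult: "tens f g * tens f' g' = tens (f * f') (g * g')"
proof -
  \<comment> \<open>Over the full monoid the carrier condition is void, so linear induction applies
    to any element.\<close>
  have U: "h \<in> carrier (monoid_algebra UNIV)" for h :: "'z::monoid_add \<Rightarrow>\<^sub>0 complex" by simp
  have 1: "tens (Poly_Mapping.single u k) (Poly_Mapping.single v l) * tens f' g'
      = tens (Poly_Mapping.single u k * f') (Poly_Mapping.single v l * g')" for u v k l
    using U[of f']
  proof (induction f' rule: monoid_algebra_induct)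
    case (single u' k')
    show ?case using U[of g']
      by (induction g' rule: monoid_algebra_induct)
        (simp_all add: tens_single mult_single tens_add_right distrib_left mult_ac)
  qed (simp_all add: tens_add_left distrib_left)
  have 2: "tens (Poly_Mapping.single u k) g * tens f' g' = tens (Poly_Mapping.single u k * f') (g * g')" for u k
    using U[of g] by (induction g rule: monoid_algebra_induct)
      (simp_all add: 1 tens_add_right distrib_right)
  show ?thesis
    using U[of f] by (induction f rule: monoid_algebra_induct)
      (simp_all add: 2 tens_add_left distrib_right)
qed

lemma keys_tens: "Poly_Mapping.keys (tens f g) \<subseteq> Poly_Mapping.keys f \<times> Poly_Mapping.keys g"
  by (auto simp: in_keys_iff lookup_tens)

section \<open>Diagonal rescalings of the basis\<close>

lemma lookup_rescale: "Poly_Mapping.lookup (rescale \<phi> f) u = \<phi> u * Poly_Mapping.lookup f u"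
  unfolding rescale_def lookup_sum lookup_single when_def
  by (simp add: in_keys_iff)

lemma rescale_add: "rescale \<phi> (f + g) = rescale \<phi> f + rescale \<phi> g"
  and rescale_uminus: "rescale \<phi> (- f) = - rescale \<phi> f"
  and rescale_zero: "rescale \<phi> 0 = 0"
  by (rule poly_mapping_eqI; simp add: lookup_rescale lookup_add algebra_simps)+

lemma rescale_single: "rescale \<phi> (Poly_Mapping.single u k) = Poly_Mapping.single u (\<phi> u * k)"
  by (rule poly_mapping_eqI) (auto simp: lookup_rescale lookup_single when_def)

lemma rescale_mult:
  assumes "\<And>u v. \<phi> (u + v) = \<phi> u * \<phi> v"
  shows "rescale \<phi> (f * g) = rescale \<phi> f * rescale \<phi> g"
proof -
  have U: "h \<in> carrier (monoid_algebra UNIV)" for h :: "'z::monoid_add \<Rightarrow>\<^sub>0 complex" by simp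
  show ?thesis using U[of f]
  proof (induction f rule: monoid_algebra_induct)
    case (single u k)
    show ?case using U[of g]
      by (induction g rule: monoid_algebra_induct)
        (simp_all add: rescale_single rescale_add rescale_zero mult_single assms distrib_left mult_ac)
  qed (simp_all add: rescale_add rescale_zero distrib_right)
qed

section \<open>Complex reflections\<close>

text \<open>A vector of the hyperplane outside the kernel, added to a basis of the (n-1)-dimensional
  kernel, would give a basis of the whole space contained in the hyperplane, and \<alpha> would
  vanish.\<close>

lemma hyperplane_subset_kernel:
  fixes A :: "complex mat"
  assumes A: "A \<in> carrier_mat n n" and dim: "Suc (kernel_dim A) = n"
    and \<alpha>: "\<alpha> \<in> carrier_vec n" "\<alpha> \<noteq> 0\<^sub>v n"
    and van: "\<And>v. v \<in> carrier_vec n \<Longrightarrow> A *\<^sub>v v = 0\<^sub>v n \<Longrightarrow> v \<bullet> \<alpha> = 0"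
    and v: "v \<in> carrier_vec n" "v \<bullet> \<alpha> = 0"
  shows "A *\<^sub>v v = 0\<^sub>v n"
proof (rule ccontr)
  assume nv: "A *\<^sub>v v \<noteq> 0\<^sub>v n"
  interpret kernel n n A by unfold_locales (rule A)
  obtain B where fin: "finite B" and B: "basis B"
    using kernel_basis_exists[OF A] by blast
  have BK: "B \<subseteq> mat_kernel A" and liB: "\<not> Ker.lin_dep B" and spanB: "Ker.span B = mat_kernel A"
    using B unfolding Ker.basis_def by auto
  have cardB: "Suc (card B) = n"
    using Ker.dim_basis[OF fin B] dim kernel_dim by simp
  have BV: "B \<subseteq> carrier_vec n" using BK mat_kernel_carrier[OF A] by auto
  have vB: "v \<notin> mat_kernel A" using nv mat_kernelD[OF A] by auto
  have li: "\<not> NC.lin_dep (B \<union> {v})"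
    using NC.lin_dep_iff_in_span[of B v] BV v(1) liB vB BK lindep_same[OF BK] span_same[OF BK] spanB
    by auto
  have "NC.basis (B \<union> {v})"
    by (rule NC.dim_li_is_basis) (use fin BV v(1) li cardB vB BK NC.dim_is_n in \<open>auto simp: card_insert_if\<close>)
  then have span: "NC.span (B \<union> {v}) = carrier_vec n"
    unfolding NC.basis_def by simp
  let ?N = "{u \<in> carrier_vec n. u \<bullet> \<alpha> = 0}"
  have "submodule class_ring ?N NC.V"
    unfolding submodule_def using \<alpha> NC.module_axioms
    by (auto simp: module_vec_simps class_ring_simps add_scalar_prod_distrib[of _ n])
  moreover have "B \<union> {v} \<subseteq> ?N"
    using BV v BK van mat_kernelD[OF A] by auto
  ultimately have "carrier_vec n \<subseteq> ?N"
    using NC.span_is_subset span by metis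
  then have "\<alpha> $ i = 0" if "i < n" for i
    using that \<alpha> by (auto dest!: subsetD[of _ _ "unit_vec n i"])
  then have "\<alpha> = 0\<^sub>v n" using \<alpha>(1) by (intro eq_vecI) auto
  with \<alpha>(2) show False by simp
qed

text \<open>The matrix determinant lemma. Multiplying the block matrix with rows (1 + b a, b) and
  (0, 1) by unipotent block matrices on both sides gives the one with rows (1, b) and (0, a b + 1);
  compare determinants.\<close>

lemma det_one_plus_rank_one:
  fixes a b :: "complex mat"
  assumes a: "a \<in> carrier_mat 1 n" and b: "b \<in> carrier_mat n 1"
  shows "det (1\<^sub>m n + b * a) = 1 + (a * b) $$ (0, 0)"
proof -
  let ?s = "1\<^sub>m n + b * a"
  let ?M1 = "four_block_mat (1\<^sub>m n) (0\<^sub>m n 1) a (1\<^sub>m 1)"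
  let ?M2 = "four_block_mat ?s b (0\<^sub>m 1 n) (1\<^sub>m 1)"
  let ?M3 = "four_block_mat (1\<^sub>m n) (0\<^sub>m n 1) (- a) (1\<^sub>m 1)"
  have s: "?s \<in> carrier_mat n n" using a b by auto
  have ma: "- a \<in> carrier_mat 1 n" using a by auto
  have M: "?M1 \<in> carrier_mat (n + 1) (n + 1)" "?M2 \<in> carrier_mat (n + 1) (n + 1)"
    "?M3 \<in> carrier_mat (n + 1) (n + 1)"
    by (rule four_block_carrier_mat[OF one_carrier_mat one_carrier_mat]
        four_block_carrier_mat[OF s one_carrier_mat])+
  have "?s * 1\<^sub>m n + b * (- a) = 1\<^sub>m n"
    using a b by (intro eq_matI) auto
  then have "?M2 * ?M3 = four_block_mat (1\<^sub>m n) b (- a) (1\<^sub>m 1)"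
    using mult_four_block_mat[OF s b zero_carrier_mat one_carrier_mat
      one_carrier_mat zero_carrier_mat ma one_carrier_mat] a b ma by simp
  moreover have "a + - a = 0\<^sub>m 1 n"
    using a by (intro eq_matI) auto
  moreover have "(1\<^sub>m n + - 0\<^sub>m n n :: complex mat) = 1\<^sub>m n"
    by (intro eq_matI) auto
  ultimately have "?M1 * (?M2 * ?M3) = four_block_mat (1\<^sub>m n) b (0\<^sub>m 1 n) (a * b + 1\<^sub>m 1)"
    using mult_four_block_mat[OF one_carrier_mat zero_carrier_mat a one_carrier_mat
      one_carrier_mat b ma one_carrier_mat] a b ma by simp
  then have "det (?M1 * (?M2 * ?M3)) = det (a * b + 1\<^sub>m 1)"
    using det_four_block_mat_lower_left_zero[OF one_carrier_mat b refl, of "a * b + 1\<^sub>m 1"] a b by simp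
  also have "\<dots> = 1 + (a * b) $$ (0, 0)"
    using a b by (subst det_single) auto
  finally have "det ?M1 * (det ?M2 * det ?M3) = 1 + (a * b) $$ (0, 0)"
    using det_mult[OF M(1), of "?M2 * ?M3"] det_mult[OF M(2,3)] M by simp
  then show ?thesis
    using det_four_block_mat_upper_right_zero[OF one_carrier_mat refl a one_carrier_mat]
      det_four_block_mat_upper_right_zero[OF one_carrier_mat refl ma one_carrier_mat]
      det_four_block_mat_lower_left_zero[OF s b refl one_carrier_mat] by simp
qed

lemma det_rank_one_update:
  fixes s :: "complex mat"
  assumes s: "s \<in> carrier_mat n n" and \<alpha>: "\<alpha> \<in> carrier_vec n" and \<beta>: "\<beta> \<in> carrier_vec n"
    and act: "\<And>y. y \<in> carrier_vec n \<Longrightarrow> s *\<^sub>v y = y + (k * (y \<bullet> \<alpha>)) \<cdot>\<^sub>v \<beta>"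
  shows "det s = 1 + k * (\<beta> \<bullet> \<alpha>)"
proof -
  define a where "a = mat 1 n (\<lambda>(i, j). \<alpha> $ j)"
  define b where "b = mat n 1 (\<lambda>(i, j). k * \<beta> $ i)"
  have ab: "a \<in> carrier_mat 1 n" "b \<in> carrier_mat n 1" by (simp_all add: a_def b_def)
  have "s = 1\<^sub>m n + b * a"
  proof (rule eq_matI)
    fix i j assume "i < dim_row (1\<^sub>m n + b * a)" "j < dim_col (1\<^sub>m n + b * a)"
    then have ij: "i < n" "j < n" using ab by auto
    have "s $$ (i, j) = (s *\<^sub>v unit_vec n j) $ i"
      using s ij by simp
    also have "\<dots> = (unit_vec n j + (k * (unit_vec n j \<bullet> \<alpha>)) \<cdot>\<^sub>v \<beta>) $ i"
      using act[of "unit_vec n j"] by simp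
    also have "\<dots> = (if i = j then 1 else 0) + k * \<alpha> $ j * \<beta> $ i"
      using ij \<alpha> \<beta> by simp
    finally show "s $$ (i, j) = (1\<^sub>m n + b * a) $$ (i, j)"
      using ij \<alpha> \<beta> ab by (simp add: a_def b_def scalar_prod_def)
  qed (use s ab in auto)
  moreover have "(a * b) $$ (0, 0) = k * (\<beta> \<bullet> \<alpha>)"
    using \<alpha> \<beta> by (simp add: a_def b_def scalar_prod_def sum_distrib_left mult_ac)
  ultimately show ?thesis using det_one_plus_rank_one[OF ab] by simp
qed

lemma GL_carrierD:
  assumes "g \<in> carrier (GL n)"
  shows "g \<in> carrier_mat n n" "inv\<^bsub>GL n\<^esub> g \<in> carrier_mat n n"
    "g * inv\<^bsub>GL n\<^esub> g = 1\<^sub>m n" "inv\<^bsub>GL n\<^esub> g * g = 1\<^sub>m n"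
proof -
  interpret M: ring "ring_mat TYPE(complex) n ()" by (rule ring_mat)
  have g: "g \<in> Units (ring_mat TYPE(complex) n ())"
    using assms by (simp add: GL_def units_of_carrier)
  show "g \<in> carrier_mat n n" "inv\<^bsub>GL n\<^esub> g \<in> carrier_mat n n"
    "g * inv\<^bsub>GL n\<^esub> g = 1\<^sub>m n" "inv\<^bsub>GL n\<^esub> g * g = 1\<^sub>m n"
    using M.Units_closed[OF g] M.Units_inv_closed[OF g] M.Units_r_inv[OF g] M.Units_l_inv[OF g]
      M.units_of_inv[OF g]
    by (simp_all add: GL_def ring_mat_def)
qed

lemma GL_simps [simp]: "\<one>\<^bsub>GL n\<^esub> = 1\<^sub>m n" "g \<otimes>\<^bsub>GL n\<^esub> h = g * h"
  by (simp_all add: GL_def units_of_def ring_mat_def)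

lemma GL_group: "group (GL n)"
proof -
  interpret M: ring "ring_mat TYPE(complex) n ()" by (rule ring_mat)
  show ?thesis unfolding GL_def by (rule M.units_group)
qed

text \<open>Here \<beta> stands for the coroot. Since s - 1 kills the hyperplane of \<alpha>, it
  equals y \<mapsto> \<langle>y, \<alpha>\<rangle> u, where u is its value at a vector pairing to 1
  with \<alpha>. Every x orthogonal to u is fixed by the transpose of s, hence by its inverse, the
  dual matrix; so \<beta> vanishes on all such x and is a multiple c u. The constant is 1/c.\<close>

lemma reflection_rank_one:
  assumes g: "s \<in> carrier (GL n)" and dim: "Suc (kernel_dim (s - 1\<^sub>m n)) = n"
    and \<alpha>: "\<alpha> \<in> carrier_vec n" "\<alpha> \<noteq> 0\<^sub>v n"
    and fix\<alpha>: "\<And>y. y \<in> carrier_vec n \<Longrightarrow> s *\<^sub>v y = y \<Longrightarrow> y \<bullet> \<alpha> = 0"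
    and \<beta>: "\<beta> \<in> carrier_vec n" "\<beta> \<noteq> 0\<^sub>v n"
    and fix\<beta>: "\<And>x. x \<in> carrier_vec n \<Longrightarrow> dual_mat n s *\<^sub>v x = x \<Longrightarrow> \<beta> \<bullet> x = 0"
  obtains k where "k \<noteq> 0" "\<And>y. y \<in> carrier_vec n \<Longrightarrow> s *\<^sub>v y = y + (k * (y \<bullet> \<alpha>)) \<cdot>\<^sub>v \<beta>"
proof -
  note s = GL_carrierD[OF g]
  let ?A = "s - 1\<^sub>m n"
  have A: "?A \<in> carrier_mat n n" by auto
  have Av: "?A *\<^sub>v y = s *\<^sub>v y - y" if "y \<in> carrier_vec n" for y
    using minus_mult_distrib_mat_vec[OF s(1) one_carrier_mat that] that by simp
  have fixed: "s *\<^sub>v y = y" if "y \<in> carrier_vec n" "?A *\<^sub>v y = 0\<^sub>v n" for y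
  proof (rule eq_vecI)
    fix i assume "i < dim_vec y"
    then have "i < n" using that by simp
    then have "(s *\<^sub>v y - y) $ i = 0" using that Av by simp
    then show "(s *\<^sub>v y) $ i = y $ i" using \<open>i < n\<close> that(1) s(1) by simp
  qed (use that s in auto)
  have hyp: "?A *\<^sub>v y = 0\<^sub>v n" if "y \<in> carrier_vec n" "y \<bullet> \<alpha> = 0" for y
    by (rule hyperplane_subset_kernel[OF A dim \<alpha> _ that]) (use fixed fix\<alpha> in auto)
  obtain i where i: "i < n" "\<alpha> $ i \<noteq> 0"
    using \<alpha> by (metis carrier_vecD eq_vecI index_zero_vec)
  define y0 where "y0 = (1 / \<alpha> $ i) \<cdot>\<^sub>v unit_vec n i"
  have y0: "y0 \<in> carrier_vec n" "y0 \<bullet> \<alpha> = 1" using i \<alpha> by (simp_all add: y0_def)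
  define u where "u = ?A *\<^sub>v y0"
  have u: "u \<in> carrier_vec n" using A y0 by (simp add: u_def)
  have su: "s *\<^sub>v y = y + (y \<bullet> \<alpha>) \<cdot>\<^sub>v u" if y: "y \<in> carrier_vec n" for y
  proof -
    let ?z = "y - (y \<bullet> \<alpha>) \<cdot>\<^sub>v y0"
    have z: "?z \<in> carrier_vec n" using y y0 by simp
    have "?z \<bullet> \<alpha> = 0"
      using y y0 \<alpha> by (simp add: minus_scalar_prod_distrib[of _ n])
    with z have "?A *\<^sub>v ?z = 0\<^sub>v n" by (rule hyp)
    then have "?A *\<^sub>v y - (y \<bullet> \<alpha>) \<cdot>\<^sub>v u = 0\<^sub>v n"
      using y y0 A by (simp add: u_def mult_minus_distrib_mat_vec[OF A] mult_mat_vec[OF A])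
    then have *: "(?A *\<^sub>v y) $ j = ((y \<bullet> \<alpha>) \<cdot>\<^sub>v u) $ j" if "j < n" for j
      using that u y A by (metis carrier_vecD eq_iff_diff_eq_0 index_minus_vec(1) index_smult_vec(2) index_zero_vec(1))
    show ?thesis
    proof (rule eq_vecI)
      fix j assume "j < dim_vec (y + (y \<bullet> \<alpha>) \<cdot>\<^sub>v u)"
      then have "j < n" using u by simp
      with * [of j] show "(s *\<^sub>v y) $ j = (y + (y \<bullet> \<alpha>) \<cdot>\<^sub>v u) $ j"
        using Av[OF y] y u s(1) by (simp add: algebra_simps)
    qed (use s u in auto)
  qed
  have u0: "u \<noteq> 0\<^sub>v n"
  proof
    assume "u = 0\<^sub>v n"
    then have "s *\<^sub>v y0 = y0" using su[OF y0(1)] y0 by simp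
    then show False using fix\<alpha>[OF y0(1)] y0(2) by simp
  qed
  have dual: "\<beta> \<bullet> x = 0" if x: "x \<in> carrier_vec n" "u \<bullet> x = 0" for x
  proof (rule fix\<beta>[OF x(1)])
    have sx: "transpose_mat s *\<^sub>v x = x"
    proof (rule eq_vecI)
      fix j assume "j < dim_vec x"
      then have j: "j < n" using x by simp
      have "(transpose_mat s *\<^sub>v x) $ j = col s j \<bullet> x" using j s by simp
      also have "col s j = s *\<^sub>v unit_vec n j" using j s
        by (intro eq_vecI) auto
      also have "\<dots> = unit_vec n j + (unit_vec n j \<bullet> \<alpha>) \<cdot>\<^sub>v u" by (rule su) simp
      also have "\<dots> \<bullet> x = x $ j" using j x u \<alpha> by (simp add: add_scalar_prod_distrib[of _ n])
      finally show "(transpose_mat s *\<^sub>v x) $ j = x $ j" .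
    qed (use s x in auto)
    have "dual_mat n s * transpose_mat s = transpose_mat (s * inv\<^bsub>GL n\<^esub> s)"
      unfolding dual_mat_def by (rule transpose_mult[OF s(1,2), symmetric])
    then have "dual_mat n s * transpose_mat s = 1\<^sub>m n" using s(3) by simp
    moreover have "dual_mat n s *\<^sub>v (transpose_mat s *\<^sub>v x) = (dual_mat n s * transpose_mat s) *\<^sub>v x"
      by (rule assoc_mult_mat_vec[symmetric]) (use s x in \<open>auto simp: dual_mat_def\<close>)
    ultimately show "dual_mat n s *\<^sub>v x = x" using x sx by simp
  qed
  obtain j where j: "j < n" "u $ j \<noteq> 0"
    using u u0 by (metis carrier_vecD eq_vecI index_zero_vec)
  define c where "c = \<beta> $ j / u $ j"
  have \<beta>u: "\<beta> = c \<cdot>\<^sub>v u"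
  proof (rule eq_vecI)
    fix i assume "i < dim_vec (c \<cdot>\<^sub>v u)"
    then have i: "i < n" using u by simp
    \<comment> \<open>A vector orthogonal to u that involves only the coordinates i and j; pairing
      it with \<beta> compares the i-th coordinates of \<beta> and c u.\<close>
    let ?x = "unit_vec n i - (u $ i / u $ j) \<cdot>\<^sub>v unit_vec n j"
    have "u \<bullet> ?x = 0" using u i j by (simp add: scalar_prod_minus_distrib[of _ n])
    then have "\<beta> \<bullet> ?x = 0" by (intro dual) simp_all
    then show "\<beta> $ i = (c \<cdot>\<^sub>v u) $ i"
      using u \<beta> i j by (simp add: scalar_prod_minus_distrib[of _ n] c_def field_simps)
  qed (use u \<beta> in auto)
  have "c \<noteq> 0"
  proof
    assume "c = 0"
    then have "\<beta> = 0\<^sub>v n" using \<beta>u u by (intro eq_vecI) auto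
    with \<beta>(2) show False ..
  qed
  show ?thesis
  proof (rule that[of "1 / c"])
    fix y :: "complex vec" assume "y \<in> carrier_vec n"
    then show "s *\<^sub>v y = y + (1 / c * (y \<bullet> \<alpha>)) \<cdot>\<^sub>v \<beta>"
      using su[of y] \<beta>u \<open>c \<noteq> 0\<close> by (simp add: smult_smult_assoc)
  qed (use \<open>c \<noteq> 0\<close> in simp)
qed

text \<open>If the pairing vanished, s would be a transvection, whose m-th power adds m times the
  same rank-one term; all powers would differ, contradicting the finiteness of the group.\<close>

lemma finite_order_pairing_nonzero:
  fixes s :: "complex mat"
  assumes G: "subgroup G (GL n)" "finite G" "s \<in> G"
    and k: "k \<noteq> 0" and \<alpha>: "\<alpha> \<in> carrier_vec n" "\<alpha> \<noteq> 0\<^sub>v n" and \<beta>: "\<beta> \<in> carrier_vec n" "\<beta> \<noteq> 0\<^sub>v n"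
    and act: "\<And>y. y \<in> carrier_vec n \<Longrightarrow> s *\<^sub>v y = y + (k * (y \<bullet> \<alpha>)) \<cdot>\<^sub>v \<beta>"
  shows "\<beta> \<bullet> \<alpha> \<noteq> 0"
proof
  assume 0: "\<beta> \<bullet> \<alpha> = 0"
  have s: "s \<in> carrier_mat n n"
    using GL_carrierD(1) subgroup.subset[OF G(1)] G(3) by blast
  have pow: "s ^\<^sub>m m \<in> G" for m
  proof (induction m)
    case 0
    then show ?case using subgroup.one_closed[OF G(1)] s by simp
  next
    case (Suc m)
    then show ?case using subgroup.m_closed[OF G(1) _ G(3)] by simp
  qed
  have pact: "s ^\<^sub>m m *\<^sub>v y = y + (of_nat m * k * (y \<bullet> \<alpha>)) \<cdot>\<^sub>v \<beta>" if y: "y \<in> carrier_vec n" for m y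
    using y
  proof (induction m arbitrary: y)
    case 0
    then show ?case using s \<beta> by (intro eq_vecI) auto
  next
    case (Suc m)
    let ?z = "y + (k * (y \<bullet> \<alpha>)) \<cdot>\<^sub>v \<beta>"
    have z: "?z \<in> carrier_vec n" using Suc.prems \<beta> by simp
    have "s ^\<^sub>m Suc m *\<^sub>v y = s ^\<^sub>m m *\<^sub>v ?z"
      using act[OF Suc.prems] Suc.prems s by (simp add: assoc_mult_mat_vec[of _ n n _ n])
    also have "\<dots> = ?z + (of_nat m * k * (?z \<bullet> \<alpha>)) \<cdot>\<^sub>v \<beta>" by (rule Suc.IH[OF z])
    also have "?z \<bullet> \<alpha> = y \<bullet> \<alpha>"
      using Suc.prems \<alpha> \<beta> 0 by (simp add: add_scalar_prod_distrib[of _ n])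
    finally show ?case
      using Suc.prems \<beta> by (intro eq_vecI) (auto simp: algebra_simps)
  qed
  have "\<not> inj (\<lambda>m. s ^\<^sub>m m)"
    using finite_subset[of "range (\<lambda>m. s ^\<^sub>m m)" G] pow G(2) finite_imageD infinite_UNIV_nat by blast
  then obtain i j where ij: "i \<noteq> j" "s ^\<^sub>m i = s ^\<^sub>m j" by (auto simp: inj_def)
  \<comment> \<open>Coordinates at which \<alpha> and \<beta> do not vanish: entry (q, l) of the two
    equal powers forces the exponents to agree.\<close>
  obtain l where l: "l < n" "\<alpha> $ l \<noteq> 0"
    using \<alpha> by (metis carrier_vecD eq_vecI index_zero_vec)
  obtain q where q: "q < n" "\<beta> $ q \<noteq> 0"
    using \<beta> by (metis carrier_vecD eq_vecI index_zero_vec)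
  have "s ^\<^sub>m i *\<^sub>v unit_vec n l = s ^\<^sub>m j *\<^sub>v unit_vec n l" using ij by simp
  then have "(s ^\<^sub>m i *\<^sub>v unit_vec n l) $ q = (s ^\<^sub>m j *\<^sub>v unit_vec n l) $ q" by simp
  then have "of_nat i * k * \<alpha> $ l * \<beta> $ q = (of_nat j * k * \<alpha> $ l * \<beta> $ q :: complex)"
    using pact[of "unit_vec n l"] l q \<alpha> \<beta> by simp
  with l q k ij show False by simp
qed

section \<open>Scalars and generators\<close>

lemma scalar_add: "scalar (k + l) = scalar k + scalar l"
  and scalar_diff: "scalar (k - l) = scalar k - scalar l"
  and scalar_uminus: "scalar (- k) = - scalar k"
  and scalar_mult: "scalar (k * l) = scalar k * scalar l"
  and scalar_zero [simp]: "scalar 0 = 0"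
  and scalar_one [simp]: "scalar 1 = 1"
  by (simp_all add: scalar_def single_add single_diff single_uminus mult_single)

lemma scalar_sum: "scalar (sum f I) = (\<Sum>i\<in>I. scalar (f i))"
  by (induction I rule: infinite_finite_induct) (simp_all add: scalar_add)

lemma scalar_commute: "f * scalar k = scalar k * f"
proof -
  have "f \<in> carrier (monoid_algebra UNIV)" by simp
  then show ?thesis
    by (induction f rule: monoid_algebra_induct)
      (simp_all add: scalar_def mult_single algebra_simps)
qed

lemma scalar_left_commute: "f * (scalar k * g) = scalar k * (f * g)"
  by (metis scalar_commute mult.assoc)

lemma words_zero: "0 \<in> words G"
  and words_add: "u \<in> words G \<Longrightarrow> v \<in> words G \<Longrightarrow> u + v \<in> words G"
  by (auto simp: words_def zero_word_def plus_word_def)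

lemma words_submonoid: "submonoid_algebra (words G)"
  by unfold_locales (rule words_zero, rule words_add)

lemma sum_fun_apply: "(\<Sum>i\<in>I. f i) x = (\<Sum>i\<in>I. f i x)" for f :: "'i \<Rightarrow> 'a \<Rightarrow> 'b::ab_group_add"
  by (induction I rule: infinite_finite_induct) simp_all

lemma gen_carrier: "g \<in> G \<Longrightarrow> gen g \<in> carrier (monoid_algebra (words G))"
  by (simp add: gen_def words_def)

section \<open>The spinor module\<close>

text \<open>Sign bookkeeping. The operators with index j count the elements of I below j; changing I
  at a smaller index shifts this count by one, and a change at j or above leaves it alone.\<close>

lemma even_card_remove:
  fixes i j :: nat
  assumes "i < j" "i \<in> I"
  shows "even (card {l \<in> I - {i}. l < j}) \<longleftrightarrow> odd (card {l \<in> I. l < j})"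
proof -
  have "{l \<in> I. l < j} = insert i {l \<in> I - {i}. l < j}" using assms by auto
  then have "card {l \<in> I. l < j} = Suc (card {l \<in> I - {i}. l < j})" by simp
  then show ?thesis by simp
qed

lemma even_card_insert:
  fixes i j :: nat
  assumes "i < j" "i \<notin> I"
  shows "even (card {l \<in> insert i I. l < j}) \<longleftrightarrow> odd (card {l \<in> I. l < j})"
proof -
  have "{l \<in> insert i I. l < j} = insert i {l \<in> I. l < j}" using assms by auto
  moreover have "finite {l \<in> I. l < j}" "i \<notin> {l \<in> I. l < j}" using assms by auto
  ultimately show ?thesis by simp
qed

lemma card_remove_above:
  fixes i j :: nat
  assumes "j \<le> i"
  shows "{l \<in> I - {i}. l < j} = {l \<in> I. l < j}" "{l \<in> insert i I. l < j} = {l \<in> I. l < j}"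
  using assms by auto

text \<open>For i < j only the operator with index j notices whether i has been removed already, so
  the two orders differ by exactly one sign.\<close>

lemma creat_creat: "creat i (creat j \<psi>) + creat j (creat i \<psi>) = 0"
proof -
  have *: "creat i (creat j \<psi>) I + creat j (creat i \<psi>) I = 0" if "i < j" for i j I
  proof -
    have "I - {i} - {j} = I - {j} - {i}" by auto
    then show ?thesis
      using that even_card_remove[OF that, of I] card_remove_above[of i j I]
      by (auto simp: creat_def sgn_mult_def)
  qed
  have "creat i (creat j \<psi>) I + creat j (creat i \<psi>) I = 0" for I
  proof (cases i j rule: linorder_cases)
    case less
    then show ?thesis by (rule *)
  next
    case equal
    then show ?thesis by (simp add: creat_def sgn_mult_def)
  next
    case greater
    then show ?thesis using *[of j i I] by (simp only: add.commute)
  qed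
  then show ?thesis by (simp add: fun_eq_iff)
qed

lemma contr_contr: "contr i (contr j \<psi>) + contr j (contr i \<psi>) = 0"
proof -
  have *: "contr i (contr j \<psi>) I + contr j (contr i \<psi>) I = 0" if "i < j" for i j I
  proof -
    have "insert i (insert j I) = insert j (insert i I)" by auto
    then show ?thesis
      using that even_card_insert[OF that, of I] card_remove_above[of i j I]
      by (auto simp: contr_def sgn_mult_def)
  qed
  have "contr i (contr j \<psi>) I + contr j (contr i \<psi>) I = 0" for I
  proof (cases i j rule: linorder_cases)
    case less
    then show ?thesis by (rule *)
  next
    case equal
    then show ?thesis by (simp add: contr_def sgn_mult_def)
  next
    case greater
    then show ?thesis using *[of j i I] by (simp only: add.commute)
  qed
  then show ?thesis by (simp add: fun_eq_iff)
qed

text \<open>For equal indices the minus sign is the \<open>Suc\<close> in \<open>contr\<close>,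
  where positions are counted from 1. The doubling of \<open>contr\<close> in
  \<open>spin_gen\<close> then produces the -2 of the Clifford relation.\<close>

lemma contr_creat: "contr i (creat j \<psi>) + creat j (contr i \<psi>) = (if i = j then - \<psi> else 0)"
proof -
  have "contr i (creat j \<psi>) I + creat j (contr i \<psi>) I = (if i = j then - \<psi> I else 0)" for I
  proof (cases i j rule: linorder_cases)
    case less
    have "insert i (I - {j}) = insert i I - {j}" using less by auto
    then show ?thesis
      using less even_card_insert[OF less, of I] card_remove_above[of i j I]
      by (auto simp: creat_def contr_def sgn_mult_def)
  next
    case equal
    then show ?thesis
      using card_remove_above[of i i I]
      by (auto simp: creat_def contr_def sgn_mult_def insert_absorb)
  next
    case greater
    have "insert i (I - {j}) = insert i I - {j}" using greater by auto
    then show ?thesis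
      using greater even_card_remove[OF greater, of I] card_remove_above[of j i I]
      by (auto simp: creat_def contr_def sgn_mult_def)
  qed
  then show ?thesis by (auto simp: fun_eq_iff)
qed

lemma sgn_mult_add: "sgn_mult k (a + b) = sgn_mult k a + sgn_mult k b"
  by (simp add: sgn_mult_def)

lemma creat_add: "creat j (\<phi> + \<psi>) = creat j \<phi> + creat j \<psi>"
  and contr_add: "contr j (\<phi> + \<psi>) = contr j \<phi> + contr j \<psi>"
  by (auto simp: creat_def contr_def sgn_mult_add)

text \<open>The generators act by integer coefficients, which additive maps respect. The map
  \<open>h\<close> may be a scalar multiplication, the action of an element of H, or the map k
  \<mapsto> k m from complex numbers to M.\<close>

lemma spin_gen_natural:
  assumes "additive h"
  shows "spin_gen v (\<lambda>I. h (\<psi> I)) = (\<lambda>I. h (spin_gen v \<psi> I))"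
  using additive.zero[OF assms] additive.minus[OF assms] additive.add[OF assms]
  by (cases v) (auto simp: creat_def contr_def sgn_mult_def fun_eq_iff)

lemma spin_word_natural:
  assumes "additive h"
  shows "spin_word v (\<lambda>I. h (\<psi> I)) = (\<lambda>I. h (spin_word v \<psi> I))"
proof -
  have "foldr spin_gen vs (\<lambda>I. h (\<psi> I)) = (\<lambda>I. h (foldr spin_gen vs \<psi> I))" for vs
    by (induction vs) (simp_all add: spin_gen_natural[OF assms])
  then show ?thesis by (simp add: spin_word_def)
qed

lemma spin_gen_add: "spin_gen v (\<phi> + \<psi>) = spin_gen v \<phi> + spin_gen v \<psi>"
  by (cases v) (simp_all add: creat_add contr_add)

lemma spin_word_add: "spin_word v (\<phi> + \<psi>) = spin_word v \<phi> + spin_word v \<psi>"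
proof -
  have "foldr spin_gen vs (\<phi> + \<psi>) = foldr spin_gen vs \<phi> + foldr spin_gen vs \<psi>" for vs
    by (induction vs) (simp_all only: foldr.simps comp_apply id_apply spin_gen_add)
  then show ?thesis by (simp add: spin_word_def)
qed

lemma spin_word_plus: "spin_word (u + v) \<psi> = spin_word u (spin_word v \<psi>)"
  and spin_word_zero: "spin_word 0 \<psi> = \<psi>"
  and spin_word_single: "spin_word (Word [x]) \<psi> = spin_gen x \<psi>"
  by (simp_all add: spin_word_def plus_word_def zero_word_def)

lemma spin_gen_clifford:
  "spin_gen (VX i) (spin_gen (VX j) \<psi>) + spin_gen (VX j) (spin_gen (VX i) \<psi>) = 0"
  "spin_gen (VY i) (spin_gen (VY j) \<psi>) + spin_gen (VY j) (spin_gen (VY i) \<psi>) = 0"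
  "spin_gen (VX i) (spin_gen (VY j) \<psi>) + spin_gen (VY j) (spin_gen (VX i) \<psi>) =
    (if i = j then - \<psi> - \<psi> else 0)"
proof -
  show "spin_gen (VY i) (spin_gen (VY j) \<psi>) + spin_gen (VY j) (spin_gen (VY i) \<psi>) = 0"
    by (simp add: creat_creat)
  have "spin_gen (VX i) (spin_gen (VX j) \<psi>) + spin_gen (VX j) (spin_gen (VX i) \<psi>)
    = (contr i (contr j \<psi>) + contr j (contr i \<psi>)) + (contr i (contr j \<psi>) + contr j (contr i \<psi>))
      + (contr i (contr j \<psi>) + contr j (contr i \<psi>)) + (contr i (contr j \<psi>) + contr j (contr i \<psi>))"
    by (simp add: contr_add algebra_simps)
  then show "spin_gen (VX i) (spin_gen (VX j) \<psi>) + spin_gen (VX j) (spin_gen (VX i) \<psi>) = 0"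
    by (simp add: contr_contr)
  have "spin_gen (VX i) (spin_gen (VY j) \<psi>) + spin_gen (VY j) (spin_gen (VX i) \<psi>)
    = (contr i (creat j \<psi>) + creat j (contr i \<psi>)) + (contr i (creat j \<psi>) + creat j (contr i \<psi>))"
    by (simp add: creat_add algebra_simps)
  then show "spin_gen (VX i) (spin_gen (VY j) \<psi>) + spin_gen (VY j) (spin_gen (VX i) \<psi>) =
    (if i = j then - \<psi> - \<psi> else 0)"
    by (simp add: contr_creat)
qed

text \<open>Evaluation depends on the action but not on the set of words, so a single constant
  serves the interpretations for all n.\<close>

definition spin_ev :: "c_free \<Rightarrow> (nat set \<Rightarrow> complex) \<Rightarrow> nat set \<Rightarrow> complex" where
  "spin_ev = monoid_module.ev (\<lambda>v k \<phi> I. k * spin_word v \<phi> I)"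

lemma additive_times: "additive ((*) (k::complex))"
  by unfold_locales (simp add: distrib_left)

lemma spin_word_times: "spin_word v (\<lambda>I. (k::complex) * \<phi> I) = (\<lambda>I. k * spin_word v \<phi> I)"
  by (rule spin_word_natural[OF additive_times])

lemma C_gen: "i < n \<Longrightarrow> gen (VX i) \<in> carrier (C_free n)" "i < n \<Longrightarrow> gen (VY i) \<in> carrier (C_free n)"
  using gen_carrier[of _ "vgens n"] by (auto simp: C_free_def vgens_def simp del: carrier_monoid_algebra)

lemmas C_closed = submonoid_algebra.F_closed[OF words_submonoid[of "vgens n"], folded C_free_def] for n

lemma C_rels_carrier: "C_rels n \<subseteq> carrier (C_free n)"
  unfolding C_rels_def by (auto intro!: C_gen C_closed)

interpretation C: presented_algebra "words (vgens n)" "C_rels n"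
  rewrites "monoid_algebra (words (vgens n)) = C_free n"
    and "a_r_coset (C_free n) (Idl\<^bsub>C_free n\<^esub> (C_rels n)) = c_class n"
    and "C_free n Quot (Idl\<^bsub>C_free n\<^esub> (C_rels n)) = C_alg n"
  for n
  by unfold_locales (use C_rels_carrier[of n] words_zero words_add in \<open>simp_all add: C_free_def c_class_def[abs_def] C_alg_def\<close>)

interpretation spin: monoid_module "words (vgens n)" "\<lambda>v k \<phi> I. k * spin_word v \<phi> I"
  rewrites "monoid_algebra (words (vgens n)) = C_free n"
    and "monoid_module.ev (\<lambda>v k \<phi> I. k * spin_word v \<phi> I) = spin_ev"
  for n
  by unfold_locales
    (auto simp: C_free_def spin_ev_def spin_word_plus spin_word_zero spin_word_times spin_word_add
      fun_eq_iff algebra_simps)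

lemma spin_ev_gen: "spin_ev (gen v) \<phi> = spin_gen v \<phi>"
proof -
  \<comment> \<open>Any n beyond the index of the generator will do, as \<open>spin_ev\<close> does
    not mention n.\<close>
  obtain n where "v \<in> vgens n"
    by (cases v) (auto simp: vgens_def intro: that[of "Suc _"])
  then show ?thesis
    using spin.ev_single[of "Word [v]" n 1 \<phi>] by (simp add: gen_def words_def spin_word_single)
qed

lemma spin_ev_scalar: "spin_ev (scalar k) \<phi> = (\<lambda>I. k * \<phi> I)"
  using spin.ev_single[of 0 0 k \<phi>] by (simp add: scalar_def words_zero spin_word_zero)

lemma spin_ev_rel:
  assumes "r \<in> C_rels n"
  shows "spin_ev r \<phi> = 0"
  using assms unfolding C_rels_def
  by (auto simp: spin.ev_add[of _ n] spin.ev_diff[of _ n] spin.ev_mult[of _ n] C_gen C_closed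
      spin_ev_gen spin_ev_scalar spin_gen_clifford simp del: spin_gen.simps)

interpretation spinor: presented_module "words (vgens n)" "C_rels n" "\<lambda>v k \<phi> I. k * spin_word v \<phi> I"
  rewrites "monoid_algebra (words (vgens n)) = C_free n"
    and "monoid_module.ev (\<lambda>v k \<phi> I. k * spin_word v \<phi> I) = spin_ev"
    and "a_r_coset (C_free n) (Idl\<^bsub>C_free n\<^esub> (C_rels n)) = c_class n"
    and "C_free n Quot (Idl\<^bsub>C_free n\<^esub> (C_rels n)) = C_alg n"
  for n
  by unfold_locales
    (auto simp: C_free_def[symmetric] spin_ev_def[symmetric] c_class_def[abs_def] C_alg_def spin_ev_rel
      simp del: carrier_monoid_algebra)

lemma spin_ev_eq: "spin_ev f \<phi> = (\<lambda>I. \<Sum>v\<in>Poly_Mapping.keys f. Poly_Mapping.lookup f v * spin_word v \<phi> I)"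
proof -
  have "spin_ev f \<phi> = (\<Sum>v\<in>Poly_Mapping.keys f. (\<lambda>I. Poly_Mapping.lookup f v * spin_word v \<phi> I))"
    unfolding spin_ev_def by (rule monoid_module.ev_def[OF spin.monoid_module_axioms[of 0]])
  then show ?thesis by (simp add: fun_eq_iff sum_fun_apply)
qed

lemma spin_act_class: "f \<in> carrier (C_free n) \<Longrightarrow> spin_act (c_class n f) \<phi> = spin_ev f \<phi>"
  using spinor.ev_some_representative[of f n \<phi>]
  by (simp add: spin_act_def Let_def spin_ev_eq)

lemma spin_ev_times: "spin_ev f (\<lambda>I. k * \<phi> I) = (\<lambda>I. k * spin_ev f \<phi> I)"
  by (simp add: spin_ev_eq spin_word_times sum_distrib_left mult_ac)

lemma spin_act_mult:
  assumes "X \<in> carrier (C_alg n)" "Y \<in> carrier (C_alg n)"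
  shows "spin_act (X \<otimes>\<^bsub>C_alg n\<^esub> Y) \<phi> = spin_act X (spin_act Y \<phi>)"
  using assms by (elim C.carrier_Q_cases)
    (simp add: C.cls_mult spin_act_class C_closed spin.ev_mult)

lemma spin_act_one: "spin_act \<one>\<^bsub>C_alg n\<^esub> \<phi> = \<phi>"
  by (simp add: C.cls_one spin_act_class C_closed)

lemma spin_act_times:
  "X \<in> carrier (C_alg n) \<Longrightarrow> spin_act X (\<lambda>I. k * \<phi> I) = (\<lambda>I. k * spin_act X \<phi> I)"
  by (elim C.carrier_Q_cases) (simp add: spin_act_class spin_ev_times)

lemma spin_act_uminus: "X \<in> carrier (C_alg n) \<Longrightarrow> spin_act (\<ominus>\<^bsub>C_alg n\<^esub> X) \<phi> = - spin_act X \<phi>"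
  by (elim C.carrier_Q_cases) (simp add: C.cls_uminus spin_act_class C_closed spin.ev_uminus[of _ n])

section \<open>Vectors and reflections in the Clifford algebra\<close>

lemma cx_carrier: "cx n v \<in> carrier (C_free n)"
  and cy_carrier: "cy n v \<in> carrier (C_free n)"
  unfolding cx_def cy_def by (intro C_closed C_gen; simp)+

text \<open>A bilinear combination of the defining relations: swapping the two sums in the second
  product makes its coefficients agree with those of the first. The next two lemmas follow the same
  pattern.\<close>

lemma cx_cx: "cx n u * cx n v + cx n v * cx n u \<in> Idl\<^bsub>C_free n\<^esub> (C_rels n)"
proof -
  have "cx n u * cx n v + cx n v * cx n u
    = (\<Sum>i<n. \<Sum>j<n. scalar (u $ i * v $ j) * (gen (VX i) * gen (VX j) + gen (VX j) * gen (VX i)))"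
    (is "_ = (\<Sum>i<n. \<Sum>j<n. ?c i j * (?f i j + ?f j i))")
  proof -
    have "cx n u * cx n v = (\<Sum>i<n. \<Sum>j<n. scalar (u $ i * v $ j) * ?f i j)" for u v
      by (simp add: cx_def sum_product scalar_mult scalar_left_commute[of "gen _"] mult.assoc)
    moreover have "(\<Sum>i<n. \<Sum>j<n. scalar (v $ i * u $ j) * ?f i j) = (\<Sum>i<n. \<Sum>j<n. ?c i j * ?f j i)"
      by (subst sum.swap) (simp add: mult.commute)
    ultimately show ?thesis by (simp only: distrib_left sum.distrib)
  qed
  also have "\<dots> \<in> Idl\<^bsub>C_free n\<^esub> (C_rels n)"
    by (intro C.J_sum C.J_left C.J_rel) (auto simp: C_rels_def intro!: C_closed)
  finally show ?thesis .
qed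

lemma cy_cy: "cy n u * cy n v + cy n v * cy n u \<in> Idl\<^bsub>C_free n\<^esub> (C_rels n)"
proof -
  have "cy n u * cy n v + cy n v * cy n u
    = (\<Sum>i<n. \<Sum>j<n. scalar (u $ i * v $ j) * (gen (VY i) * gen (VY j) + gen (VY j) * gen (VY i)))"
    (is "_ = (\<Sum>i<n. \<Sum>j<n. ?c i j * (?f i j + ?f j i))")
  proof -
    have "cy n u * cy n v = (\<Sum>i<n. \<Sum>j<n. scalar (u $ i * v $ j) * ?f i j)" for u v
      by (simp add: cy_def sum_product scalar_mult scalar_left_commute[of "gen _"] mult.assoc)
    moreover have "(\<Sum>i<n. \<Sum>j<n. scalar (v $ i * u $ j) * ?f i j) = (\<Sum>i<n. \<Sum>j<n. ?c i j * ?f j i)"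
      by (subst sum.swap) (simp add: mult.commute)
    ultimately show ?thesis by (simp only: distrib_left sum.distrib)
  qed
  also have "\<dots> \<in> Idl\<^bsub>C_free n\<^esub> (C_rels n)"
    by (intro C.J_sum C.J_left C.J_rel) (auto simp: C_rels_def intro!: C_closed)
  finally show ?thesis .
qed

lemma cx_cy:
  assumes "u \<in> carrier_vec n" "v \<in> carrier_vec n"
  shows "cx n u * cy n v + cy n v * cx n u + scalar (2 * (v \<bullet> u)) \<in> Idl\<^bsub>C_free n\<^esub> (C_rels n)"
proof -
  let ?c = "\<lambda>i j. scalar (u $ i * v $ j)" and ?d = "\<lambda>i j. if i = j then - 2 else 0 :: complex"
  have "cx n u * cy n v = (\<Sum>i<n. \<Sum>j<n. ?c i j * (gen (VX i) * gen (VY j)))"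
    by (simp add: cx_def cy_def sum_product scalar_mult scalar_left_commute[of "gen _"] mult.assoc)
  moreover have "cy n v * cx n u = (\<Sum>j<n. \<Sum>i<n. scalar (v $ j * u $ i) * (gen (VY j) * gen (VX i)))"
    by (simp add: cx_def cy_def sum_product scalar_mult scalar_left_commute[of "gen _"] mult.assoc)
  moreover have "(\<Sum>j<n. \<Sum>i<n. scalar (v $ j * u $ i) * (gen (VY j) * gen (VX i)))
      = (\<Sum>i<n. \<Sum>j<n. ?c i j * (gen (VY j) * gen (VX i)))"
    by (subst sum.swap) (simp add: mult.commute)
  moreover have "scalar (2 * (v \<bullet> u)) = - (\<Sum>i<n. \<Sum>j<n. ?c i j * scalar (?d i j))"
  proof -
    have "2 * (v \<bullet> u) = - (\<Sum>i<n. \<Sum>j<n. u $ i * v $ j * ?d i j)"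
      using assms by (simp add: scalar_prod_def if_distrib sum_distrib_left sum_negf[symmetric]
          atLeast0LessThan mult_ac cong: if_cong)
    then show ?thesis by (simp only: scalar_uminus scalar_sum scalar_mult)
  qed
  ultimately have "cx n u * cy n v + cy n v * cx n u + scalar (2 * (v \<bullet> u))
    = (\<Sum>i<n. \<Sum>j<n. ?c i j * (gen (VX i) * gen (VY j) + gen (VY j) * gen (VX i) - scalar (?d i j)))"
    by (simp only: distrib_left right_diff_distrib sum.distrib sum_subtractf) simp
  also have "\<dots> \<in> Idl\<^bsub>C_free n\<^esub> (C_rels n)"
  proof (intro C.J_sum C.J_left C.J_rel)
    fix i j assume "i \<in> {..<n}" "j \<in> {..<n}"
    then show "gen (VX i) * gen (VY j) + gen (VY j) * gen (VX i) - scalar (?d i j) \<in> C_rels n"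
      unfolding C_rels_def by (intro UnI2) blast
  qed (rule C_closed)
  finally show ?thesis .
qed

lemma spin_ev_cy: "spin_ev (cy n v) \<phi> = wedge_vec n v \<phi>"
  unfolding cy_def
  by (subst spin.ev_sum[of _ _ n])
    (auto simp: spin.ev_mult[of _ n] C_gen C_closed spin_ev_gen spin_ev_scalar wedge_vec_def fun_eq_iff
      sum_fun_apply)

lemma spin_ev_cx_vac: "spin_ev (cx n v) vac = 0"
proof -
  have "contr i vac = 0" for i
    by (auto simp: contr_def vac_def sgn_mult_def fun_eq_iff)
  then show ?thesis
    unfolding cx_def
    by (subst spin.ev_sum[of _ _ n])
      (auto simp: spin.ev_mult[of _ n] C_gen C_closed spin_ev_gen spin_ev_scalar fun_eq_iff sum_fun_apply)
qed

section \<open>Lifts of reflections\<close>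

lemma scalar_scalar: "scalar k * scalar l = scalar (k * l)"
  and scalar_scalar_left: "scalar k * (scalar l * f) = scalar (k * l) * f"
  by (simp_all add: scalar_mult mult.assoc)

lemmas scalar_simps = scalar_add scalar_diff scalar_uminus scalar_scalar scalar_scalar_left

text \<open>With \<beta> the coroot, the lift of s is the case q = sqrt(det s) and k = (q - 1/q) /
  (2 \<langle>\<beta>, \<alpha>\<rangle>). Both parameters are left free because the inverse has the
  same shape, with -k and 1/q.\<close>

definition mu_rep :: "nat \<Rightarrow> complex vec \<Rightarrow> complex vec \<Rightarrow> complex \<Rightarrow> complex \<Rightarrow> c_free" where
  "mu_rep n \<alpha> \<beta> k q = scalar k * (cx n \<alpha> * cy n \<beta>) + scalar q"

lemma mu_rep_carrier: "mu_rep n \<alpha> \<beta> k q \<in> carrier (C_free n)"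
  unfolding mu_rep_def by (intro C_closed cx_carrier cy_carrier)

text \<open>Anticommutation of a vector with itself gives its square only doubled; the ideal is
  closed under multiplication by 1/2.\<close>

lemma square_in_ideal:
  assumes "f \<in> carrier (C_free n)" "f * f + f * f \<in> Idl\<^bsub>C_free n\<^esub> (C_rels n)"
  shows "f * f \<in> Idl\<^bsub>C_free n\<^esub> (C_rels n)"
proof -
  have "scalar (1 / 2) * (f * f + f * f) = (scalar (1 / 2) + scalar (1 / 2)) * (f * f)"
    by (simp add: distrib_left distrib_right)
  also have "\<dots> = f * f" by (simp flip: scalar_add)
  finally show ?thesis using C.J_left[OF assms(2), of "scalar (1 / 2)"] C_closed by metis
qed

text \<open>Put e = \<alpha> \<beta> and N = 2 \<langle>\<beta>, \<alpha>\<rangle>. Modulo the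
  relations e^2 = -N e, so (k e + q)(l e + p) = (k p + q l - N k l) e + p q, and the two numerical
  hypotheses make this 1.\<close>

lemma mu_rep_mult:
  assumes \<alpha>: "\<alpha> \<in> carrier_vec n" and \<beta>: "\<beta> \<in> carrier_vec n"
    and pq: "p * q = 1" and kl: "k * p + q * l = 2 * (\<beta> \<bullet> \<alpha>) * (k * l)"
  shows "mu_rep n \<alpha> \<beta> k q * mu_rep n \<alpha> \<beta> l p - 1 \<in> Idl\<^bsub>C_free n\<^esub> (C_rels n)"
proof -
  let ?J = "Idl\<^bsub>C_free n\<^esub> (C_rels n)"
  define a b N where "a = cx n \<alpha>" and "b = cy n \<beta>" and "N = 2 * (\<beta> \<bullet> \<alpha>)"
  have ab: "a \<in> carrier (C_free n)" "b \<in> carrier (C_free n)"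
    by (simp_all add: a_def b_def cx_carrier cy_carrier)
  have aa: "a * a \<in> ?J"
    using square_in_ideal[OF ab(1)] cx_cx[of n \<alpha> \<alpha>] by (simp add: a_def)
  define r where "r = a * b + b * a + scalar N"
  have r: "r \<in> ?J" using cx_cy[OF \<alpha> \<beta>] by (simp add: r_def a_def b_def N_def)
  define e where "e = a * b"
  have e: "e \<in> carrier (C_free n)" unfolding e_def by (intro C_closed ab)
  \<comment> \<open>Expanding the anticommutator \<open>r\<close> between a and b produces a a b b,
    e e and N e.\<close>
  have "e * e + scalar N * e = a * r * b - a * a * (b * b)"
    by (simp add: e_def r_def algebra_simps scalar_commute[of a] scalar_left_commute[of a])
  then have ee: "e * e + scalar N * e \<in> ?J"
    using C.J_diff[OF C.J_right[OF C.J_left[OF r ab(1)] ab(2)] C.J_right[OF aa, of "b * b"]] C_closed ab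
    by metis
  have "mu_rep n \<alpha> \<beta> k q * mu_rep n \<alpha> \<beta> l p - 1
    = scalar (k * l) * (e * e) + scalar (k * p + q * l) * e + (scalar (p * q) - 1)"
    by (simp add: mu_rep_def a_def[symmetric] b_def[symmetric] e_def[symmetric] scalar_simps
        algebra_simps scalar_commute[of e] scalar_left_commute[of e])
  also have "\<dots> = scalar (k * l) * (e * e + scalar N * e)"
    unfolding pq kl by (simp add: N_def scalar_simps algebra_simps)
  also have "\<dots> \<in> ?J" by (intro C.J_left ee C_closed)
  finally show ?thesis .
qed

text \<open>Modulo the relations e Y - Y e = 2 c b and b e = -N b, with c = \<langle>y,
  \<alpha>\<rangle>. The difference is thus a multiple of b with coefficient c (2 k + N k m - m q),
  which is zero by hypothesis.\<close>

lemma mu_rep_conj: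
  assumes \<alpha>: "\<alpha> \<in> carrier_vec n" and \<beta>: "\<beta> \<in> carrier_vec n" and y: "y \<in> carrier_vec n"
    and kq: "2 * k + 2 * (\<beta> \<bullet> \<alpha>) * k * m = m * q"
  shows "mu_rep n \<alpha> \<beta> k q * cy n y - cy n (y + (m * (y \<bullet> \<alpha>)) \<cdot>\<^sub>v \<beta>) * mu_rep n \<alpha> \<beta> k q
    \<in> Idl\<^bsub>C_free n\<^esub> (C_rels n)"
proof -
  let ?J = "Idl\<^bsub>C_free n\<^esub> (C_rels n)"
  define a b Y N c where "a = cx n \<alpha>" and "b = cy n \<beta>" and "Y = cy n y"
    and "N = 2 * (\<beta> \<bullet> \<alpha>)" and "c = y \<bullet> \<alpha>"
  have ab: "a \<in> carrier (C_free n)" "b \<in> carrier (C_free n)" "Y \<in> carrier (C_free n)"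
    by (simp_all add: a_def b_def Y_def cx_carrier cy_carrier)
  have bb: "b * b \<in> ?J"
    using square_in_ideal[OF ab(2)] cy_cy[of n \<beta> \<beta>] by (simp add: b_def)
  define r where "r = a * b + b * a + scalar N"
  have r: "r \<in> ?J" using cx_cy[OF \<alpha> \<beta>] by (simp add: r_def a_def b_def N_def)
  define r' where "r' = a * Y + Y * a + scalar (2 * c)"
  have r': "r' \<in> ?J" using cx_cy[OF \<alpha> y] by (simp add: r'_def a_def Y_def c_def)
  define r2 where "r2 = b * Y + Y * b"
  have r2: "r2 \<in> ?J" using cy_cy[of n \<beta> y] by (simp add: r2_def b_def Y_def)
  define e where "e = a * b"
  have e: "e \<in> carrier (C_free n)" unfolding e_def by (intro C_closed ab)
  define f1 where "f1 = e * Y - Y * e - scalar (2 * c) * b"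
  have "f1 = a * r2 - r' * b"
    by (simp add: f1_def e_def r2_def r'_def algebra_simps)
  then have f1: "f1 \<in> ?J"
    using C.J_diff[OF C.J_left[OF r2 ab(1)] C.J_right[OF r' ab(2)]] by simp
  define f2 where "f2 = b * e + scalar N * b"
  have "f2 = r * b - a * (b * b)"
    by (simp add: f2_def e_def r_def algebra_simps)
  then have f2: "f2 \<in> ?J"
    using C.J_diff[OF C.J_right[OF r ab(2)] C.J_left[OF bb ab(1)]] by simp
  have cyy: "cy n (y + (m * (y \<bullet> \<alpha>)) \<cdot>\<^sub>v \<beta>) = Y + scalar (m * c) * b"
    using y \<beta> by (simp add: cy_def Y_def b_def c_def scalar_add scalar_mult distrib_right sum.distrib
        sum_distrib_left mult.assoc)
  have mc: "m * c * q = 2 * c * k + k * m * c * N"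
    using arg_cong[OF kq, of "\<lambda>z. c * z"] by (simp add: N_def algebra_simps)
  have "mu_rep n \<alpha> \<beta> k q * Y - (Y + scalar (m * c) * b) * mu_rep n \<alpha> \<beta> k q
    = scalar k * e * Y + scalar q * Y
      - (scalar k * (Y * e) + scalar q * Y + scalar (k * m * c) * (b * e) + scalar (m * c * q) * b)"
    by (simp add: mu_rep_def a_def[symmetric] b_def[symmetric] e_def[symmetric] algebra_simps
        scalar_commute[of Y] scalar_left_commute[of Y] scalar_commute[of b] scalar_left_commute[of b]
        scalar_simps)
  also have "\<dots> = scalar k * f1 - scalar (k * m * c) * f2"
    unfolding mc scalar_add f1_def f2_def by (simp add: algebra_simps scalar_simps)
  also have "\<dots> \<in> ?J" by (intro C.J_diff C.J_left f1 f2 C_closed)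
  finally show ?thesis unfolding cyy Y_def[symmetric] .
qed

text \<open>Since \<alpha> kills the vacuum, \<alpha> \<beta> acts on it by the constant of the
  anticommutator. For the lift of s the eigenvalue is 1 / sqrt(det s), in accordance with \<chi>^2
  being the determinant on the dual space.\<close>

lemma mu_rep_vac:
  assumes \<alpha>: "\<alpha> \<in> carrier_vec n" and \<beta>: "\<beta> \<in> carrier_vec n"
  shows "spin_ev (mu_rep n \<alpha> \<beta> k q) vac = (\<lambda>I. (q - 2 * (\<beta> \<bullet> \<alpha>) * k) * vac I)"
proof -
  note c = cx_carrier[of n \<alpha>] cy_carrier[of n \<beta>]
  have "spin_ev (cx n \<alpha> * cy n \<beta>) vac + spin_ev (cy n \<beta> * cx n \<alpha>) vac
      + spin_ev (scalar (2 * (\<beta> \<bullet> \<alpha>))) vac = 0"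
    using spinor.ev_J[OF cx_cy[OF \<alpha> \<beta>], of vac] c by (simp add: spin.ev_add[of _ n] C_closed)
  moreover have "spin_ev (cy n \<beta> * cx n \<alpha>) vac = 0"
    using c spin.ev_zero_right[OF c(2)] by (simp add: spin.ev_mult[of _ n] spin_ev_cx_vac)
  ultimately have "spin_ev (cx n \<alpha> * cy n \<beta>) vac I = - (2 * (\<beta> \<bullet> \<alpha>)) * vac I" for I
    by (simp add: spin_ev_scalar fun_eq_iff eq_neg_iff_add_eq_0)
  then show ?thesis
    unfolding mu_rep_def
    by (simp add: spin.ev_add[of _ n] spin.ev_mult[of _ n] C_closed c spin_ev_scalar fun_eq_iff algebra_simps)
qed

section \<open>Monomials of the spinor module as iterated creations\<close>

definition basis_form :: "nat set \<Rightarrow> nat set \<Rightarrow> complex" where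
  "basis_form I = (\<lambda>K. if K = I then 1 else 0)"

lemma creat_basis_form:
  assumes "\<And>j. j \<in> I \<Longrightarrow> i < j"
  shows "creat i (basis_form I) = basis_form (insert i I)"
proof
  fix K
  have i: "i \<notin> I" using assms by blast
  show "creat i (basis_form I) K = basis_form (insert i I) K"
  proof (cases "K = insert i I")
    case True
    then have "{l \<in> K. l < i} = {}" using assms by force
    then have "even (card {l \<in> K. l < i})" by (simp only: card.empty even_zero)
    moreover have "K - {i} = I" "i \<in> K" using True i by auto
    ultimately have "creat i (basis_form I) K = 1"
      by (simp add: creat_def basis_form_def sgn_mult_def)
    then show ?thesis using True by (simp add: basis_form_def)
  next
    case False
    then have "i \<in> K \<Longrightarrow> K - {i} \<noteq> I" by auto
    then show ?thesis using False by (simp add: creat_def basis_form_def sgn_mult_def)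
  qed
qed

lemma foldr_creat_vac:
  assumes "sorted_wrt (<) xs"
  shows "foldr creat xs vac = basis_form (set xs)"
  using assms
proof (induction xs)
  case Nil
  then show ?case by (auto simp: vac_def basis_form_def)
next
  case (Cons x xs)
  then show ?case using creat_basis_form[of "set xs" x] by simp
qed

section \<open>The double cover\<close>

abbreviation pair_group :: "cherednik_data \<Rightarrow> (c_free set \<times> complex mat) set" where
  "pair_group D \<equiv> generate (units_of (C_alg (dm D)) \<times>\<times> GL (dm D))
    ((\<lambda>s. (mu D s, s)) ` refl_set D \<union> (\<lambda>s. (\<ominus>\<^bsub>C_alg (dm D)\<^esub> mu D s, s)) ` refl_set D)"

text \<open>
  The conditions below are stable under products and inverses, and determine both \<open>g\<close> and, up to the
  scalar \<open>c\<close>, the action of \<open>w\<close> on all of \<open>S\<close>, as \<open>S\<close> is generated by the vacuum under \<open>\<hh>\<close>.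
\<close>

definition lifts :: "cherednik_data \<Rightarrow> c_free set \<Rightarrow> complex mat \<Rightarrow> bool" where
  "lifts D w g \<longleftrightarrow> w \<in> Units (C_alg (dm D)) \<and> g \<in> grp D \<and>
    (\<forall>y\<in>carrier_vec (dm D). w \<otimes>\<^bsub>C_alg (dm D)\<^esub> c_class (dm D) (cy (dm D) y)
      = c_class (dm D) (cy (dm D) (g *\<^sub>v y)) \<otimes>\<^bsub>C_alg (dm D)\<^esub> w) \<and>
    (\<exists>c. c \<noteq> 0 \<and> spin_act w vac = (\<lambda>I. c * vac I))"

locale reflection_data =
  fixes D :: cherednik_data
  assumes cherednik: "cherednik D"
begin

abbreviation "n \<equiv> dm D"
abbreviation "Cl \<equiv> C_alg n"
abbreviation "vec_cl y \<equiv> c_class n (cy n y)"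

lemma grp_subgroup: "subgroup (grp D) (GL n)"
  and grp_finite: "finite (grp D)"
  using cherednik by (auto simp: cherednik_def)

lemma grp_GL: "g \<in> grp D \<Longrightarrow> g \<in> carrier (GL n)"
  using subgroup.subset[OF grp_subgroup] by auto

lemma grp_mat: "g \<in> grp D \<Longrightarrow> g \<in> carrier_mat n n"
  using GL_carrierD(1) grp_GL by blast

lemma grp_one: "1\<^sub>m n \<in> grp D"
  using subgroup.one_closed[OF grp_subgroup] by simp

lemma grp_mult: "g \<in> grp D \<Longrightarrow> h \<in> grp D \<Longrightarrow> g * h \<in> grp D"
  using subgroup.m_closed[OF grp_subgroup] by simp

lemma grp_inv: "g \<in> grp D \<Longrightarrow> inv\<^bsub>GL n\<^esub> g \<in> grp D"
  using subgroup.m_inv_closed[OF grp_subgroup] by simp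

lemma refl_grp: "s \<in> refl_set D \<Longrightarrow> s \<in> grp D"
  by (simp add: refl_set_def)

lemma vec_cl_closed: "vec_cl y \<in> carrier Cl"
  by (intro C.cls_closed cy_carrier)

lemma lifts_one: "lifts D \<one>\<^bsub>Cl\<^esub> (1\<^sub>m n)"
  unfolding lifts_def
proof (intro conjI ballI)
  show "\<exists>c. c \<noteq> 0 \<and> spin_act \<one>\<^bsub>Cl\<^esub> vac = (\<lambda>I. c * vac I)"
    by (intro exI[of _ 1]) (simp add: spin_act_one)
qed (use grp_one vec_cl_closed C.Q.Units_one_closed in simp_all)

lemma lifts_mult:
  assumes "lifts D w g" "lifts D w' g'"
  shows "lifts D (w \<otimes>\<^bsub>Cl\<^esub> w') (g * g')"
proof -
  have w: "w \<in> Units Cl" "w' \<in> Units Cl" "g \<in> grp D" "g' \<in> grp D"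
    using assms by (auto simp: lifts_def)
  note wc = C.Q.Units_closed[OF w(1)] C.Q.Units_closed[OF w(2)]
  note gm = grp_mat[OF w(3)] grp_mat[OF w(4)]
  have "(w \<otimes>\<^bsub>Cl\<^esub> w') \<otimes>\<^bsub>Cl\<^esub> vec_cl y = vec_cl (g * g' *\<^sub>v y) \<otimes>\<^bsub>Cl\<^esub> (w \<otimes>\<^bsub>Cl\<^esub> w')"
    if y: "y \<in> carrier_vec n" for y
  proof -
    have gy: "g' *\<^sub>v y \<in> carrier_vec n" using gm y by simp
    have "(w \<otimes>\<^bsub>Cl\<^esub> w') \<otimes>\<^bsub>Cl\<^esub> vec_cl y = w \<otimes>\<^bsub>Cl\<^esub> (w' \<otimes>\<^bsub>Cl\<^esub> vec_cl y)"
      by (rule C.Q.m_assoc) (simp_all add: wc vec_cl_closed)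
    also have "\<dots> = w \<otimes>\<^bsub>Cl\<^esub> (vec_cl (g' *\<^sub>v y) \<otimes>\<^bsub>Cl\<^esub> w')"
      using assms(2) y by (simp add: lifts_def)
    also have "\<dots> = (w \<otimes>\<^bsub>Cl\<^esub> vec_cl (g' *\<^sub>v y)) \<otimes>\<^bsub>Cl\<^esub> w'"
      by (rule C.Q.m_assoc[symmetric]) (simp_all add: wc vec_cl_closed)
    also have "\<dots> = (vec_cl (g *\<^sub>v (g' *\<^sub>v y)) \<otimes>\<^bsub>Cl\<^esub> w) \<otimes>\<^bsub>Cl\<^esub> w'"
      using assms(1) gy by (simp add: lifts_def)
    also have "\<dots> = vec_cl (g *\<^sub>v (g' *\<^sub>v y)) \<otimes>\<^bsub>Cl\<^esub> (w \<otimes>\<^bsub>Cl\<^esub> w')"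
      by (rule C.Q.m_assoc) (simp_all add: wc vec_cl_closed)
    finally show ?thesis using gm y by (simp add: assoc_mult_mat_vec[of _ n n _ n])
  qed
  moreover have "\<exists>c. c \<noteq> 0 \<and> spin_act (w \<otimes>\<^bsub>Cl\<^esub> w') vac = (\<lambda>I. c * vac I)"
  proof -
    obtain c c' where c: "c \<noteq> 0" "spin_act w vac = (\<lambda>I. c * vac I)"
      and c': "c' \<noteq> 0" "spin_act w' vac = (\<lambda>I. c' * vac I)"
      using assms by (auto simp: lifts_def)
    show ?thesis
      by (intro exI[of _ "c' * c"])
        (use c c' in \<open>simp add: spin_act_mult[OF wc] spin_act_times[OF wc(1)] mult.assoc\<close>)
  qed
  ultimately show ?thesis
    using w grp_mult C.Q.Units_m_closed by (simp add: lifts_def)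
qed

lemma lifts_inv:
  assumes "lifts D w g"
  shows "lifts D (inv\<^bsub>Cl\<^esub> w) (inv\<^bsub>GL n\<^esub> g)"
proof -
  have w: "w \<in> Units Cl" "g \<in> grp D" using assms by (auto simp: lifts_def)
  note wc = C.Q.Units_closed[OF w(1)] C.Q.Units_inv_closed[OF w(1)]
  note gm = GL_carrierD[OF grp_GL[OF w(2)]]
  let ?v = "inv\<^bsub>Cl\<^esub> w"
  have "?v \<otimes>\<^bsub>Cl\<^esub> vec_cl y = vec_cl (inv\<^bsub>GL n\<^esub> g *\<^sub>v y) \<otimes>\<^bsub>Cl\<^esub> ?v"
    if y: "y \<in> carrier_vec n" for y
  proof -
    let ?z = "inv\<^bsub>GL n\<^esub> g *\<^sub>v y"
    have z: "?z \<in> carrier_vec n" using gm y by simp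
    have "g *\<^sub>v ?z = (g * inv\<^bsub>GL n\<^esub> g) *\<^sub>v y"
      by (rule assoc_mult_mat_vec[OF gm(1,2) y, symmetric])
    then have "w \<otimes>\<^bsub>Cl\<^esub> vec_cl ?z = vec_cl y \<otimes>\<^bsub>Cl\<^esub> w"
      using assms z y gm by (simp add: lifts_def)
    \<comment> \<open>The commutation rule of w at the preimage of y, multiplied by the inverse of w
      on both sides.\<close>
    then have "?v \<otimes>\<^bsub>Cl\<^esub> (w \<otimes>\<^bsub>Cl\<^esub> vec_cl ?z) \<otimes>\<^bsub>Cl\<^esub> ?v = ?v \<otimes>\<^bsub>Cl\<^esub> (vec_cl y \<otimes>\<^bsub>Cl\<^esub> w) \<otimes>\<^bsub>Cl\<^esub> ?v"
      by simp
    moreover have "?v \<otimes>\<^bsub>Cl\<^esub> (w \<otimes>\<^bsub>Cl\<^esub> vec_cl ?z) = vec_cl ?z"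
      using wc vec_cl_closed C.Q.Units_l_inv[OF w(1)] by (simp flip: C.Q.m_assoc)
    moreover have "?v \<otimes>\<^bsub>Cl\<^esub> (vec_cl y \<otimes>\<^bsub>Cl\<^esub> w) \<otimes>\<^bsub>Cl\<^esub> ?v = ?v \<otimes>\<^bsub>Cl\<^esub> vec_cl y"
      using wc vec_cl_closed C.Q.Units_r_inv[OF w(1)] by (simp add: C.Q.m_assoc)
    ultimately show ?thesis by simp
  qed
  moreover have "\<exists>c. c \<noteq> 0 \<and> spin_act ?v vac = (\<lambda>I. c * vac I)"
  proof -
    obtain c where c: "c \<noteq> 0" "spin_act w vac = (\<lambda>I. c * vac I)"
      using assms by (auto simp: lifts_def)
    have "vac = spin_act (?v \<otimes>\<^bsub>Cl\<^esub> w) vac"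
      using C.Q.Units_l_inv[OF w(1)] by (simp add: spin_act_one)
    also have "\<dots> = (\<lambda>I. c * spin_act ?v vac I)"
      by (simp add: spin_act_mult[OF wc(2,1)] c spin_act_times[OF wc(2)])
    finally have "vac I = c * spin_act ?v vac I" for I by (rule fun_cong)
    then show ?thesis
      using c by (intro exI[of _ "1 / c"]) (simp add: fun_eq_iff)
  qed
  ultimately show ?thesis
    using w grp_inv C.Q.Units_inv_Units by (simp add: lifts_def)
qed

lemma mu_eq:
  "mu D s = c_class n (mu_rep n (root D s) (coroot D s)
    ((csqrt (det s) - 1 / csqrt (det s)) / (2 * (coroot D s \<bullet> root D s))) (csqrt (det s)))"
  by (simp add: mu_def mu_rep_def mult.assoc)

text \<open>With s(y) = y + m \<langle>y, \<alpha>\<rangle> \<beta> one has q^2 = det s = 1 + m N.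
  The coefficient k in \<open>mu\<close> is made so that 2 N k = q - 1/q: this gives the inverse and
  the vacuum eigenvalue q - 2 N k = 1/q, while m = 2 k q gives the conjugation rule.\<close>

lemma lifts_mu:
  assumes "s \<in> refl_set D"
  shows "lifts D (mu D s) s"
proof -
  define \<alpha> \<beta> q N where "\<alpha> = root D s" and "\<beta> = coroot D s" and "q = csqrt (det s)" and "N = \<beta> \<bullet> \<alpha>"
  have s: "s \<in> grp D" "Suc (kernel_dim (s - 1\<^sub>m n)) = n" using assms by (auto simp: refl_set_def)
  have D: "\<alpha> \<in> carrier_vec n" "\<alpha> \<noteq> 0\<^sub>v n" "\<And>y. y \<in> carrier_vec n \<Longrightarrow> s *\<^sub>v y = y \<Longrightarrow> y \<bullet> \<alpha> = 0"
    "\<beta> \<in> carrier_vec n" "\<beta> \<noteq> 0\<^sub>v n" "\<And>x. x \<in> carrier_vec n \<Longrightarrow> dual_mat n s *\<^sub>v x = x \<Longrightarrow> \<beta> \<bullet> x = 0"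
    using cherednik assms by (auto simp: cherednik_def \<alpha>_def \<beta>_def)
  obtain m where m: "m \<noteq> 0" and sy: "\<And>y. y \<in> carrier_vec n \<Longrightarrow> s *\<^sub>v y = y + (m * (y \<bullet> \<alpha>)) \<cdot>\<^sub>v \<beta>"
    using reflection_rank_one[OF grp_GL[OF s(1)] s(2) D] by blast
  have N: "N \<noteq> 0" unfolding N_def
    by (rule finite_order_pairing_nonzero[OF grp_subgroup grp_finite s(1) m D(1,2,4,5) sy])
  have det: "det s = 1 + m * N"
    unfolding N_def by (rule det_rank_one_update[OF grp_mat[OF s(1)] D(1,4) sy])
  have "det s \<noteq> 0"
  proof -
    note i = GL_carrierD[OF grp_GL[OF s(1)]]
    have "det s * det (inv\<^bsub>GL n\<^esub> s) = 1" using det_mult[OF i(1,2)] i(3) by simp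
    then show ?thesis by auto
  qed
  then have q: "q \<noteq> 0" by (simp add: q_def)
  have qq: "q * q = 1 + m * N" using power2_csqrt[of "det s"] det by (simp add: q_def power2_eq_square)
  define k where "k = (q - 1 / q) / (2 * N)"
  have kN: "2 * N * k = q - 1 / q" using N by (simp add: k_def)
  \<comment> \<open>N m = q^2 - 1 = q (q - 1/q) = 2 N k q, and N can be cancelled.\<close>
  have mk: "m = 2 * k * q"
  proof -
    have "N * m = q * (2 * N * k)" unfolding kN using qq q by (simp add: field_simps)
    with N show ?thesis by (simp add: algebra_simps)
  qed
  let ?m = "mu_rep n \<alpha> \<beta> k q" and ?i = "mu_rep n \<alpha> \<beta> (- k) (1 / q)"
  have mu: "mu D s = c_class n ?m"
    by (simp add: mu_eq \<alpha>_def \<beta>_def q_def k_def N_def)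
  note c = mu_rep_carrier[of n \<alpha> \<beta>]
  have kk: "k * (1 / q) + q * (- k) = 2 * (\<beta> \<bullet> \<alpha>) * (k * (- k))"
  proof -
    have "2 * (\<beta> \<bullet> \<alpha>) * (k * (- k)) = - (2 * N * k) * k" by (simp add: N_def)
    also have "\<dots> = k * (1 / q) + q * (- k)" unfolding kN by (simp add: algebra_simps)
    finally show ?thesis ..
  qed
  have "c_class n ?m \<otimes>\<^bsub>Cl\<^esub> c_class n ?i = \<one>\<^bsub>Cl\<^esub>"
    using mu_rep_mult[OF D(1,4) _ kk] q by (simp add: C.cls_mult C.cls_one c C_closed C.cls_eq_iff)
  moreover have "c_class n ?i \<otimes>\<^bsub>Cl\<^esub> c_class n ?m = \<one>\<^bsub>Cl\<^esub>"
    using mu_rep_mult[OF D(1,4), of q "1 / q" "- k" k] kk q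
    by (simp add: C.cls_mult C.cls_one c C_closed C.cls_eq_iff algebra_simps)
  ultimately have unit: "c_class n ?m \<in> Units Cl"
    unfolding Units_def using C.cls_closed[OF c] by blast
  have "2 * k + 2 * (\<beta> \<bullet> \<alpha>) * k * m = m * q"
  proof -
    have "2 * k + 2 * (\<beta> \<bullet> \<alpha>) * k * m = 2 * k * (1 + m * N)" by (simp add: N_def algebra_simps)
    also have "\<dots> = 2 * k * (q * q)" by (simp only: qq)
    also have "\<dots> = m * q" by (simp add: mk)
    finally show ?thesis .
  qed
  then have "c_class n ?m \<otimes>\<^bsub>Cl\<^esub> vec_cl y = vec_cl (s *\<^sub>v y) \<otimes>\<^bsub>Cl\<^esub> c_class n ?m"
    if "y \<in> carrier_vec n" for y
    using mu_rep_conj[OF D(1,4) that] sy[OF that]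
    by (simp add: C.cls_mult c cy_carrier C_closed C.cls_eq_iff)
  moreover have "spin_act (c_class n ?m) vac = (\<lambda>I. 1 / q * vac I)"
    using kN unfolding N_def
    by (simp add: spin_act_class[OF c] mu_rep_vac[OF D(1,4)])
  then have "\<exists>c. c \<noteq> 0 \<and> spin_act (c_class n ?m) vac = (\<lambda>I. c * vac I)"
    using q by (intro exI[of _ "1 / q"]) simp
  ultimately show ?thesis
    unfolding lifts_def mu using unit s(1) by auto
qed

lemma lifts_uminus:
  assumes "lifts D w g"
  shows "lifts D (\<ominus>\<^bsub>Cl\<^esub> w) g"
proof -
  have w: "w \<in> Units Cl" using assms by (simp add: lifts_def)
  note wc = C.Q.Units_closed[OF w]
  have "\<ominus>\<^bsub>Cl\<^esub> w \<in> Units Cl"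
    unfolding Units_def using wc C.Q.Units_inv_closed[OF w] C.Q.Units_l_inv[OF w] C.Q.Units_r_inv[OF w]
    by (auto intro!: bexI[of _ "\<ominus>\<^bsub>Cl\<^esub> (inv\<^bsub>Cl\<^esub> w)"] simp: C.Q.l_minus C.Q.r_minus)
  moreover obtain c where c: "c \<noteq> 0" "spin_act w vac = (\<lambda>I. c * vac I)"
    using assms by (auto simp: lifts_def)
  then have "- c \<noteq> 0 \<and> spin_act (\<ominus>\<^bsub>Cl\<^esub> w) vac = (\<lambda>I. - c * vac I)"
    using wc by (simp add: spin_act_uminus fun_eq_iff)
  moreover have "(\<ominus>\<^bsub>Cl\<^esub> w) \<otimes>\<^bsub>Cl\<^esub> vec_cl y = vec_cl (g *\<^sub>v y) \<otimes>\<^bsub>Cl\<^esub> (\<ominus>\<^bsub>Cl\<^esub> w)"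
    if "y \<in> carrier_vec n" for y
    using assms that wc vec_cl_closed by (simp add: lifts_def C.Q.l_minus C.Q.r_minus)
  ultimately show ?thesis
    using assms unfolding lifts_def by blast
qed

section \<open>The covering map on the generated groups\<close>

lemma inv_units_of_pair:
  assumes "lifts D w g"
  shows "inv\<^bsub>units_of Cl \<times>\<times> GL n\<^esub> (w, g) = (inv\<^bsub>Cl\<^esub> w, inv\<^bsub>GL n\<^esub> g)"
  using assms grp_GL C.Q.units_group GL_group
  by (simp add: lifts_def inv_DirProd units_of_carrier C.Q.units_of_inv)

lemma pair_group_lifts:
  assumes "p \<in> pair_group D"
  shows "lifts D (fst p) (snd p)"
  using assms
proof (induction p rule: generate.induct)
  case one
  then show ?case using lifts_one by (simp add: units_of_one)
next
  case (incl p)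
  then show ?case using lifts_mu lifts_uminus by auto
next
  case (inv p)
  then have "lifts D (fst p) (snd p)" using lifts_mu lifts_uminus by auto
  then show ?case using lifts_inv inv_units_of_pair[of "fst p" "snd p"] by simp
next
  case (eng p p')
  then show ?case using lifts_mult[OF eng.IH] by (simp add: mult_DirProd' units_of_mult)
qed

text \<open>Cancelling the unit w identifies the classes of g y and g' y in C(V). Applied to the
  vacuum they yield y-coordinates as the coefficients of singletons, so every column of g equals
  that of g'.\<close>

lemma lifts_unique:
  assumes "lifts D w g" "lifts D w g'"
  shows "g = g'"
proof -
  have w: "w \<in> Units Cl" "g \<in> grp D" "g' \<in> grp D" using assms by (auto simp: lifts_def)
  note wc = C.Q.Units_closed[OF w(1)] C.Q.Units_inv_closed[OF w(1)]
  note gm = grp_mat[OF w(2)] grp_mat[OF w(3)]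
  show ?thesis
  proof (rule eq_matI)
    fix i j assume "i < dim_row g'" "j < dim_col g'"
    then have ij: "i < n" "j < n" using gm by auto
    let ?e = "unit_vec n j"
    have "vec_cl (g *\<^sub>v ?e) \<otimes>\<^bsub>Cl\<^esub> w = vec_cl (g' *\<^sub>v ?e) \<otimes>\<^bsub>Cl\<^esub> w"
      using assms by (simp add: lifts_def)
    then have "vec_cl (g *\<^sub>v ?e) \<otimes>\<^bsub>Cl\<^esub> w \<otimes>\<^bsub>Cl\<^esub> inv\<^bsub>Cl\<^esub> w = vec_cl (g' *\<^sub>v ?e) \<otimes>\<^bsub>Cl\<^esub> w \<otimes>\<^bsub>Cl\<^esub> inv\<^bsub>Cl\<^esub> w"
      by simp
    then have "vec_cl (g *\<^sub>v ?e) = vec_cl (g' *\<^sub>v ?e)"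
      using wc vec_cl_closed C.Q.Units_r_inv[OF w(1)] by (simp add: C.Q.m_assoc)
    then have "spin_act (vec_cl (g *\<^sub>v ?e)) vac = spin_act (vec_cl (g' *\<^sub>v ?e)) vac" by simp
    then have "wedge_vec n (g *\<^sub>v ?e) vac = wedge_vec n (g' *\<^sub>v ?e) vac"
      by (simp add: spin_act_class[OF cy_carrier] spin_ev_cy)
    then have "wedge_vec n (g *\<^sub>v ?e) vac {i} = wedge_vec n (g' *\<^sub>v ?e) vac {i}" by simp
    moreover have "wedge_vec n v vac {i} = v $ i" for v
    proof -
      have "{l. l = i \<and> l < i} = {}" by auto
      then have "even (card {l. l = i \<and> l < i})" by (simp only: card.empty even_zero)
      then have "wedge_vec n v vac {i} = (\<Sum>j<n. if j = i then v $ i else 0)"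
        unfolding wedge_vec_def
        by (intro sum.cong refl) (auto simp: creat_def vac_def sgn_mult_def)
      then show ?thesis using ij by simp
    qed
    ultimately show "g $$ (i, j) = g' $$ (i, j)" using ij gm by simp
  qed (use gm in auto)
qed

lemma Wt_pair: "w \<in> Wt D \<Longrightarrow> \<exists>g. (w, g) \<in> pair_group D"
  unfolding Wt_def
proof (induction w rule: generate.induct)
  case one
  show ?case
    using generate.one[of "units_of Cl \<times>\<times> GL n"] by (auto simp: intro!: exI[of _ "1\<^sub>m n"])
next
  case (incl w)
  then show ?case by (auto intro!: generate.incl)
next
  case (inv w)
  then obtain s where s: "(w, s) \<in> (\<lambda>s. (mu D s, s)) ` refl_set D \<union> (\<lambda>s. (\<ominus>\<^bsub>Cl\<^esub> mu D s, s)) ` refl_set D"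
    by auto
  then have "lifts D w s" using lifts_mu lifts_uminus by auto
  with generate.inv[OF s, of "units_of Cl \<times>\<times> GL n"] show ?case
    by (auto simp: inv_units_of_pair lifts_def C.Q.units_of_inv)
next
  case (eng w w')
  then obtain g g' where "(w, g) \<in> pair_group D" "(w', g') \<in> pair_group D" by blast
  from generate.eng[OF this] show ?case by auto
qed

text \<open>\<open>Wt_pair\<close> gives existence and \<open>lifts_unique\<close> uniqueness for
  the definite description in \<open>cover\<close>. From here on the cover is accessed only through
  \<open>lifts\<close>.\<close>

lemma lifts_cover:
  assumes "w \<in> Wt D"
  shows "lifts D w (cover D w)"
proof -
  obtain g where g: "(w, g) \<in> pair_group D" using Wt_pair[OF assms] by blast
  have "(w, cover D w) \<in> pair_group D"
    unfolding cover_def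
    by (rule theI[where P = "\<lambda>g. (w, g) \<in> pair_group D" and a = g, OF g]) (use pair_group_lifts[OF g] pair_group_lifts lifts_unique in fastforce)
  then show ?thesis using pair_group_lifts by fastforce
qed

section \<open>Spinors as the exterior algebra twisted by the vacuum character\<close>

lemma wedge_vec_unit: "i < n \<Longrightarrow> wedge_vec n (unit_vec n i) \<phi> = creat i \<phi>"
proof -
  assume "i < n"
  have "wedge_vec n (unit_vec n i) \<phi> I = (\<Sum>j<n. if j = i then creat i \<phi> I else 0)" for I
    unfolding wedge_vec_def by (intro sum.cong refl) (use \<open>i < n\<close> in auto)
  then show ?thesis using \<open>i < n\<close> by (simp add: fun_eq_iff)
qed

lemma wedge_vec_times: "wedge_vec n v (\<lambda>I. c * \<phi> I) = (\<lambda>I. c * wedge_vec n v \<phi> I)"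
  by (simp add: spin_ev_times flip: spin_ev_cy)

text \<open>A monomial is a product of creation operators applied to the vacuum. Moving w to the
  right past each of them turns y into p(w) y, until w meets the vacuum and leaves the factor
  \<chi>(w).\<close>

lemma spin_act_basis_form:
  assumes w: "w \<in> Wt D" and I: "I \<subseteq> {..<n}"
  shows "spin_act w (basis_form I) = (\<lambda>K. chi w * w_wedge n (cover D w) I K)"
proof -
  let ?g = "cover D w"
  have l: "lifts D w ?g" by (rule lifts_cover[OF w])
  have wc: "w \<in> carrier Cl" using l C.Q.Units_closed by (auto simp: lifts_def)
  \<comment> \<open>The eigenvalue is the coefficient at the empty set, where \<open>vac\<close> is
    1; this is how \<open>chi\<close> is defined.\<close>
  have vac: "spin_act w vac = (\<lambda>I. chi w * vac I)"
    using l by (auto simp: lifts_def chi_def vac_def)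
  have conj: "spin_act w (wedge_vec n v \<phi>) = wedge_vec n (?g *\<^sub>v v) (spin_act w \<phi>)"
    if "v \<in> carrier_vec n" for v \<phi>
  proof -
    have "spin_act (w \<otimes>\<^bsub>Cl\<^esub> vec_cl v) \<phi> = spin_act (vec_cl (?g *\<^sub>v v) \<otimes>\<^bsub>Cl\<^esub> w) \<phi>"
      using l that by (simp add: lifts_def)
    then show ?thesis
      by (simp add: spin_act_mult wc vec_cl_closed spin_act_class[OF cy_carrier] spin_ev_cy)
  qed
  have *: "spin_act w (foldr creat xs vac)
      = (\<lambda>K. chi w * foldr (\<lambda>i. wedge_vec n (?g *\<^sub>v unit_vec n i)) xs vac K)"
    if "set xs \<subseteq> {..<n}" for xs
    using that
  proof (induction xs)
    case (Cons x xs)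
    then have "spin_act w (foldr creat (x # xs) vac)
      = wedge_vec n (?g *\<^sub>v unit_vec n x) (spin_act w (foldr creat xs vac))"
      using conj[of "unit_vec n x"] by (simp add: wedge_vec_unit)
    with Cons show ?case by (simp add: wedge_vec_times)
  qed (simp add: vac)
  have fin: "finite I" using I finite_subset by blast
  then have "basis_form I = foldr creat (sorted_list_of_set I) vac"
    using foldr_creat_vac[of "sorted_list_of_set I"] by simp
  then show ?thesis
    using *[of "sorted_list_of_set I"] fin I by (simp add: w_wedge_def)
qed

end

section \<open>The action of \<open>H \<otimes> C(V)\<close> on \<open>M \<otimes> S\<close>\<close>

lemma words_Times_submonoid: "submonoid_algebra (words G \<times> words G')"
  by unfold_locales (auto simp: zero_prod_def plus_prod_def words_zero words_add)

context reflection_data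
begin

lemma H_gen:
  "i < n \<Longrightarrow> gen (HX i) \<in> carrier (H_free D)"
  "i < n \<Longrightarrow> gen (HY i) \<in> carrier (H_free D)"
  "g \<in> grp D \<Longrightarrow> gen (HW g) \<in> carrier (H_free D)"
  using gen_carrier[of _ "hgens D"] by (auto simp: H_free_def hgens_def simp del: carrier_monoid_algebra)

lemmas H_closed = submonoid_algebra.F_closed[OF words_submonoid[of "hgens D"], folded H_free_def]
lemmas HC_closed = submonoid_algebra.F_closed[OF words_Times_submonoid[of "hgens D" "vgens n"], folded HC_free_def]

lemma hx_carrier: "hx n v \<in> carrier (H_free D)"
  and hy_carrier: "hy n v \<in> carrier (H_free D)"
  unfolding hx_def hy_def by (intro H_closed H_gen; simp)+

lemma H_rels_carrier: "H_rels D \<subseteq> carrier (H_free D)"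
  unfolding H_rels_def
  by (intro Un_least) (auto intro!: H_closed H_gen hx_carrier hy_carrier grp_one grp_mult dest: refl_grp)

lemma tens_carrier:
  "f \<in> carrier (H_free D) \<Longrightarrow> g \<in> carrier (C_free n) \<Longrightarrow> tens f g \<in> carrier (HC_free D)"
  using keys_tens[of f g] by (force simp: H_free_def C_free_def HC_free_def)

lemma HC_rels_carrier: "HC_rels D \<subseteq> carrier (HC_free D)"
  unfolding HC_rels_def
  using H_rels_carrier C_rels_carrier[of n] tens_carrier H_closed(6) C_closed(6) by blast

sublocale H: presented_algebra "words (hgens D)" "H_rels D"
  rewrites "monoid_algebra (words (hgens D)) = H_free D"
    and "a_r_coset (H_free D) (Idl\<^bsub>H_free D\<^esub> (H_rels D)) = h_class D"
    and "H_free D Quot (Idl\<^bsub>H_free D\<^esub> (H_rels D)) = H_alg D"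
  by unfold_locales
    (use H_rels_carrier words_zero words_add in \<open>simp_all add: H_free_def h_class_def[abs_def] H_alg_def\<close>)

sublocale HC: presented_algebra "words (hgens D) \<times> words (vgens n)" "HC_rels D"
  rewrites "monoid_algebra (words (hgens D) \<times> words (vgens n)) = HC_free D"
    and "a_r_coset (HC_free D) (Idl\<^bsub>HC_free D\<^esub> (HC_rels D)) = hc_class D"
    and "HC_free D Quot (Idl\<^bsub>HC_free D\<^esub> (HC_rels D)) = HC D"
  by unfold_locales
    (use HC_rels_carrier in
      \<open>auto simp: words_zero words_add zero_prod_def plus_prod_def HC_free_def hc_class_def[abs_def] HC_def\<close>)

text \<open>With 1 in the second factor, multiples by h become multiples by h \<otimes> 1, so ideal
  induction applies; a general g enters at the end through right multiplication by 1 \<otimes>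
  g.\<close>

lemma tens_H_ideal:
  assumes "f \<in> Idl\<^bsub>H_free D\<^esub> (H_rels D)" "g \<in> carrier (C_free n)"
  shows "tens f g \<in> Idl\<^bsub>HC_free D\<^esub> (HC_rels D)"
proof -
  have "tens f 1 \<in> Idl\<^bsub>HC_free D\<^esub> (HC_rels D)"
    using assms(1)
  proof (induction f rule: H.J_induct)
    case (rel r)
    then show ?case by (intro HC.J_rel) (simp add: HC_rels_def)
  next
    case (left f h)
    then show ?case
      using HC.J_left[of "tens f 1" "tens h 1"] tens_carrier[OF _ C_closed(6)] by (simp add: tens_mult)
  next
    case (right f h)
    then show ?case
      using HC.J_right[of "tens f 1" "tens h 1"] tens_carrier[OF _ C_closed(6)] by (simp add: tens_mult)
  qed (simp_all add: HC.J_zero HC.J_add HC.J_uminus tens_add_left tens_uminus_left)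
  then show ?thesis
    using HC.J_right[of "tens f 1" "tens 1 g"] tens_carrier[OF H_closed(6) assms(2)] by (simp add: tens_mult)
qed

lemma tens_C_ideal:
  assumes "g \<in> Idl\<^bsub>C_free n\<^esub> (C_rels n)" "f \<in> carrier (H_free D)"
  shows "tens f g \<in> Idl\<^bsub>HC_free D\<^esub> (HC_rels D)"
proof -
  have "tens 1 g \<in> Idl\<^bsub>HC_free D\<^esub> (HC_rels D)"
    using assms(1)
  proof (induction g rule: C.J_induct)
    case (rel r)
    then show ?case by (intro HC.J_rel) (simp add: HC_rels_def)
  next
    case (left f h)
    then show ?case
      using HC.J_left[of "tens 1 f" "tens 1 h"] tens_carrier[OF H_closed(6)] by (simp add: tens_mult)
  next
    case (right f h)
    then show ?case
      using HC.J_right[of "tens 1 f" "tens 1 h"] tens_carrier[OF H_closed(6)] by (simp add: tens_mult)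
  qed (simp_all add: HC.J_zero HC.J_add HC.J_uminus tens_add_right tens_uminus_right)
  then show ?thesis
    using HC.J_left[of "tens 1 g" "tens f 1"] tens_carrier[OF assms(2) C_closed(6)] by (simp add: tens_mult)
qed

text \<open>All members of the union coincide, because f' \<otimes> g' - f \<otimes> g = (f' - f)
  \<otimes> g' + f \<otimes> (g' - g) lies in the ideal.\<close>

lemma ctens_class:
  assumes f: "f \<in> carrier (H_free D)" and g: "g \<in> carrier (C_free n)"
  shows "ctens D (h_class D f) (c_class n g) = hc_class D (tens f g)"
proof -
  have "hc_class D (tens f' g') = hc_class D (tens f g)"
    if "f' \<in> h_class D f" "g' \<in> c_class n g" for f' g'
  proof -
    note f' = H.mem_cls[OF f that(1)] and g' = C.mem_cls[OF g that(2)]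
    have "tens f' g' - tens f g = tens (f' - f) g' + tens f (g' - g)"
      by (simp add: tens_diff_left tens_diff_right)
    also have "\<dots> \<in> Idl\<^bsub>HC_free D\<^esub> (HC_rels D)"
      by (intro HC.J_add tens_H_ideal tens_C_ideal f' g' f)
    finally show ?thesis
      using HC.cls_eq_iff tens_carrier f g f'(1) g'(1) by blast
  qed
  then show ?thesis
    unfolding ctens_def using H.cls_self[OF f] C.cls_self[OF g] by blast
qed

section \<open>The parity automorphism on cosets\<close>

abbreviation par :: "hgen word \<times> vgen word \<Rightarrow> complex" where
  "par \<equiv> \<lambda>(u, v). (- 1) ^ length (letters v)"

lemma par_mult: "par (p + p') = par p * par p'"
  by (cases p; cases p') (simp add: plus_word_def power_add)

lemma par_par: "rescale par (rescale par f) = f"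
  by (rule poly_mapping_eqI) (auto simp: lookup_rescale simp flip: mult.assoc power_mult_distrib)

lemma rescale_par_carrier: "f \<in> carrier (HC_free D) \<Longrightarrow> rescale par f \<in> carrier (HC_free D)"
  by (fastforce simp: HC_free_def in_keys_iff lookup_rescale)

lemma rescale_par_tens:
  "rescale par (tens f g) = tens f (rescale (\<lambda>v. (- 1) ^ length (letters v)) g)"
  by (rule poly_mapping_eqI) (auto simp: lookup_rescale lookup_tens)

text \<open>The Clifford relations involve only words of length 2 and 0, which is why the parity
  grading descends to the quotient.\<close>

lemma even_C_rels:
  assumes "r \<in> C_rels n"
  shows "rescale (\<lambda>v. (- 1) ^ length (letters v)) r = r"
proof -
  have ev: "even (length (letters v))" if "v \<in> Poly_Mapping.keys r" for v
  proof -
    have g: "Poly_Mapping.keys (gen x * gen y + gen y * gen x - scalar k)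
        \<subseteq> {Word [x, y], Word [y, x], Word []}" for x y :: vgen and k
      by (auto simp: gen_def scalar_def mult_single plus_word_def zero_word_def in_keys_iff lookup_minus
          lookup_add lookup_single when_def split: if_splits)
    \<comment> \<open>One shape covers the three families of relations, with k = 0 in the first
      two.\<close>
    obtain x y k where "r = gen x * gen y + gen y * gen x - scalar k"
    proof -
      note that' = that
      from assms consider
        i j where "r = gen (VX i) * gen (VX j) + gen (VX j) * gen (VX i)"
        | i j where "r = gen (VY i) * gen (VY j) + gen (VY j) * gen (VY i)"
        | i j where "r = gen (VX i) * gen (VY j) + gen (VY j) * gen (VX i) - scalar (if i = j then - 2 else 0)"
        unfolding C_rels_def by blast
      then show thesis
      proof cases
        case (1 i j)
        then show thesis by (intro that'[of "VX i" "VX j" 0]) simp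
      next
        case (2 i j)
        then show thesis by (intro that'[of "VY i" "VY j" 0]) simp
      next
        case (3 i j)
        then show thesis by (rule that')
      qed
    qed
    with g[of x y k] that show ?thesis by auto
  qed
  show ?thesis
  proof (rule poly_mapping_eqI)
    fix v
    show "Poly_Mapping.lookup (rescale (\<lambda>v. (- 1) ^ length (letters v)) r) v = Poly_Mapping.lookup r v"
      using ev[of v] by (cases "Poly_Mapping.lookup r v = 0") (simp_all add: lookup_rescale in_keys_iff)
  qed
qed

lemma rescale_par_ideal:
  assumes "f \<in> Idl\<^bsub>HC_free D\<^esub> (HC_rels D)"
  shows "rescale par f \<in> Idl\<^bsub>HC_free D\<^esub> (HC_rels D)"
  using assms
proof (induction f rule: HC.J_induct)
  case (rel r)
  have "rescale (\<lambda>v. (- 1) ^ length (letters v)) 1 = (1 :: c_free)"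
    by (rule poly_mapping_eqI) (auto simp: lookup_rescale lookup_one when_def zero_word_def)
  then have "rescale par r = r"
    using rel by (auto simp: HC_rels_def rescale_par_tens even_C_rels)
  then show ?case using HC.J_rel[OF rel] by simp
qed (simp_all add: HC.J_zero HC.J_add HC.J_uminus HC.J_left HC.J_right rescale_add rescale_uminus
    rescale_zero rescale_mult par_mult rescale_par_carrier)

text \<open>The rescaling preserves the ideal and is its own inverse, so the image of a coset is
  again a full coset.\<close>

lemma parity_closed:
  assumes "X \<in> carrier (HC D)"
  shows "parity X \<in> carrier (HC D)"
proof -
  obtain f where f: "f \<in> carrier (HC_free D)" "X = hc_class D f"
    using assms by (rule HC.carrier_Q_cases)
  have cls: "g \<in> hc_class D f' \<longleftrightarrow> g - f' \<in> Idl\<^bsub>HC_free D\<^esub> (HC_rels D)"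
    if "f' \<in> carrier (HC_free D)" for f' g
  proof
    assume d: "g - f' \<in> Idl\<^bsub>HC_free D\<^esub> (HC_rels D)"
    have g: "g \<in> carrier (HC_free D)"
      using HC_closed(1)[OF HC.J_carrier[OF d] that] by simp
    then show "g \<in> hc_class D f'" using HC.cls_eq_iff[OF g that] d HC.cls_self[OF g] by simp
  qed (use HC.mem_cls(3)[OF that] in blast)
  have res: "rescale par g - rescale par f' = rescale par (g - f')" for g f'
    using rescale_add[of par g "- f'"] by (simp add: rescale_uminus)
  have "parity X = hc_class D (rescale par f)"
  proof (intro equalityI subsetI)
    fix g assume "g \<in> parity X"
    then obtain h where "h \<in> hc_class D f" "g = rescale par h" by (auto simp: parity_def f)
    then show "g \<in> hc_class D (rescale par f)"
      using cls f rescale_par_carrier rescale_par_ideal res by simp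
  next
    fix g assume "g \<in> hc_class D (rescale par f)"
    then have "rescale par (g - rescale par f) \<in> Idl\<^bsub>HC_free D\<^esub> (HC_rels D)"
      using cls f rescale_par_carrier rescale_par_ideal by simp
    then have "rescale par g \<in> hc_class D f" using cls f by (simp add: par_par flip: res)
    then show "g \<in> parity X" unfolding parity_def f by (metis image_eqI par_par)
  qed
  then show ?thesis using HC.cls_closed rescale_par_carrier f by simp
qed

end

section \<open>Modules over H and the induced action on M \<otimes> S\<close>

locale cherednik_module = reflection_data D for D +
  fixes act :: "h_free set \<Rightarrow> 'm::ab_group_add \<Rightarrow> 'm"
  assumes H_module: "H_module D act"
begin

abbreviation T :: "h_free \<Rightarrow> 'm \<Rightarrow> 'm" where
  "T f \<equiv> act (h_class D f)"

lemma T_add_right: "f \<in> carrier (H_free D) \<Longrightarrow> T f (m + m') = T f m + T f m'"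
  using H_module H.cls_closed[of f] by (simp add: H_module_def)

lemma T_add: "f \<in> carrier (H_free D) \<Longrightarrow> g \<in> carrier (H_free D) \<Longrightarrow> T (f + g) m = T f m + T g m"
  using H_module H.cls_closed[of f] H.cls_closed[of g] by (simp add: H_module_def flip: H.cls_add)

lemma T_mult: "f \<in> carrier (H_free D) \<Longrightarrow> g \<in> carrier (H_free D) \<Longrightarrow> T (f * g) m = T f (T g m)"
  using H_module H.cls_closed[of f] H.cls_closed[of g] by (simp add: H_module_def flip: H.cls_mult)

lemma T_one: "T 1 m = m"
  using H_module by (simp add: H_module_def H.cls_one)

lemma T_zero: "T 0 m = 0"
  using T_add[of 0 0 m] H_closed(5) by simp

lemma T_uminus: "f \<in> carrier (H_free D) \<Longrightarrow> T (- f) m = - T f m"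
  using T_add[of f "- f" m] H_closed(2)[of f] by (simp add: T_zero eq_neg_iff_add_eq_0 add.commute)

lemma T_additive: "f \<in> carrier (H_free D) \<Longrightarrow> additive (T f)"
  by unfold_locales (rule T_add_right)

lemma T_zero_right: "f \<in> carrier (H_free D) \<Longrightarrow> T f 0 = 0"
  using T_add_right[of f 0 0] by simp

lemma T_sum_right: "f \<in> carrier (H_free D) \<Longrightarrow> T f (sum h I) = (\<Sum>i\<in>I. T f (h i))"
  by (rule additive.sum[OF T_additive])

lemma T_ideal: "f \<in> Idl\<^bsub>H_free D\<^esub> (H_rels D) \<Longrightarrow> T f m = 0"
  using H.cls_eq_iff[of f 0] H.J_carrier[of f] H_closed(5) by (simp add: T_zero)

lemma T_scalar_add: "T (scalar (k + l)) m = T (scalar k) m + T (scalar l) m"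
  by (simp add: scalar_add T_add H_closed)

lemma T_scalar_mult: "T (scalar (k * l)) m = T (scalar k) (T (scalar l) m)"
  by (simp add: scalar_mult T_mult H_closed)

lemma T_scalar_commute: "f \<in> carrier (H_free D) \<Longrightarrow> T f (T (scalar k) m) = T (scalar k) (T f m)"
  by (simp add: scalar_commute H_closed flip: T_mult)

lemma single_carrier: "u \<in> words (hgens D) \<Longrightarrow> Poly_Mapping.single u k \<in> carrier (H_free D)"
  by (simp add: H_free_def)

abbreviation basis_act :: "hgen word \<times> vgen word \<Rightarrow> complex \<Rightarrow> (nat set \<Rightarrow> 'm) \<Rightarrow> nat set \<Rightarrow> 'm" where
  "basis_act \<equiv> \<lambda>(u, v) k \<psi> I. T (Poly_Mapping.single u k) (spin_word v \<psi> I)"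

definition hc_ev :: "hc_free \<Rightarrow> (nat set \<Rightarrow> 'm) \<Rightarrow> nat set \<Rightarrow> 'm" where
  "hc_ev = monoid_module.ev basis_act"

sublocale hc: monoid_module "words (hgens D) \<times> words (vgens n)" basis_act
  rewrites "monoid_algebra (words (hgens D) \<times> words (vgens n)) = HC_free D"
    and "monoid_module.ev basis_act = hc_ev"
proof -
  show "monoid_module (words (hgens D) \<times> words (vgens n)) basis_act"
  proof (intro monoid_module.intro words_Times_submonoid monoid_module_axioms.intro)
    fix p q k l \<phi> \<psi>
    assume p: "p \<in> words (hgens D) \<times> words (vgens n)"
    obtain u v where uv: "p = (u, v)" "u \<in> words (hgens D)" using p by auto
    show "basis_act p k (\<phi> + \<psi>) = basis_act p k \<phi> + basis_act p k \<psi>"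
      using uv by (simp add: spin_word_add T_add_right single_carrier fun_eq_iff)
    show "basis_act p (k + l) \<psi> = basis_act p k \<psi> + basis_act p l \<psi>"
      using uv by (simp add: single_add T_add single_carrier fun_eq_iff)
    assume q: "q \<in> words (hgens D) \<times> words (vgens n)"
    obtain u' v' where uv': "q = (u', v')" "u' \<in> words (hgens D)" using q by auto
    \<comment> \<open>The Clifford word v has to pass the coefficient action of u', which is
      additive.\<close>
    show "basis_act (p + q) (k * l) \<psi> = basis_act p k (basis_act q l \<psi>)"
      using uv uv' spin_word_natural[OF T_additive[OF single_carrier[OF uv'(2), of l]], of v "spin_word v' \<psi>"]
      by (simp add: plus_prod_def spin_word_plus T_mult single_carrier fun_eq_iff flip: mult_single)
  next
    fix \<psi>
    show "basis_act 0 1 \<psi> = \<psi>"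
      by (simp add: zero_prod_def spin_word_zero T_one)
  qed
qed (simp_all add: HC_free_def hc_ev_def)

lemma hc_ev_tens_left:
  assumes "f \<in> carrier (H_free D)"
  shows "hc_ev (tens f 1) \<psi> = (\<lambda>I. T f (\<psi> I))"
  using assms unfolding H_free_def
proof (induction f rule: monoid_algebra_induct)
  case zero
  then show ?case by (simp add: T_zero fun_eq_iff)
next
  case (single u k)
  then show ?case
    using hc.ev_single[of "(u, 0)" k \<psi>] tens_single[of u k "0 :: vgen word" 1]
    by (simp add: words_zero spin_word_zero)
next
  case (add f g)
  then show ?case
    by (simp add: tens_add_left hc.ev_add tens_carrier C_closed T_add fun_eq_iff
        flip: H_free_def del: carrier_monoid_algebra)
qed

lemma hc_ev_tens_single:
  "v \<in> words (vgens n) \<Longrightarrow> hc_ev (tens 1 (Poly_Mapping.single v k)) \<psi> = (\<lambda>I. T (scalar k) (spin_word v \<psi> I))"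
  using hc.ev_single[of "(0, v)" k \<psi>] tens_single[of "0 :: hgen word" 1 v k] by (simp add: words_zero scalar_def)

lemma hc_ev_tens_gen: "x \<in> vgens n \<Longrightarrow> hc_ev (tens 1 (gen x)) \<psi> = spin_gen x \<psi>"
  using hc_ev_tens_single[of "Word [x]" 1 \<psi>] by (simp add: gen_def words_def spin_word_single T_one)

lemma hc_ev_tens_scalar: "hc_ev (tens 1 (scalar k)) \<psi> = (\<lambda>I. T (scalar k) (\<psi> I))"
  using hc_ev_tens_single[of 0 k \<psi>] by (simp add: words_zero spin_word_zero scalar_def)

lemma hc_ev_tens_mult:
  assumes "f \<in> carrier (C_free n)" "g \<in> carrier (C_free n)"
  shows "hc_ev (tens 1 (f * g)) \<psi> = hc_ev (tens 1 f) (hc_ev (tens 1 g) \<psi>)"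
  using hc.ev_mult[of "tens 1 f" "tens 1 g" \<psi>] tens_carrier assms H_closed(6) by (simp add: tens_mult)

lemma hc_ev_rel:
  assumes "r \<in> HC_rels D"
  shows "hc_ev r \<psi> = 0"
proof -
  have H: "hc_ev (tens r 1) \<psi> = 0" if "r \<in> H_rels D" for r
    using hc_ev_tens_left[of r \<psi>] H.J_rel[OF that] H.J_carrier T_ideal by (simp add: fun_eq_iff)
  \<comment> \<open>Reconciles the scalar -2, acting through H, with the group negation in which the
    Clifford relations on M \<otimes> S are written.\<close>
  have m2: "T (scalar (- 2)) m = - m - m" for m
    using T_scalar_add[of "- 1" "- 1" m] T_uminus[of 1 m] H_closed(6)
    by (simp add: scalar_uminus T_one)
  have vg: "VX i \<in> vgens n" "VY i \<in> vgens n" if "i < n" for i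
    using that by (auto simp: vgens_def)
  have C: "hc_ev (tens 1 r) \<psi> = 0" if "r \<in> C_rels n" for r
  proof -
    have e: "hc_ev (tens 1 (gen x * gen y + gen y * gen x)) \<psi>
        = spin_gen x (spin_gen y \<psi>) + spin_gen y (spin_gen x \<psi>)"
      if "x \<in> vgens n" "y \<in> vgens n" for x y
      using that gen_carrier[of _ "vgens n"]
      by (simp add: tens_add_right hc.ev_add tens_carrier H_closed C_closed hc_ev_tens_mult hc_ev_tens_gen
          flip: C_free_def del: carrier_monoid_algebra)
    have "hc_ev (tens 1 (f - scalar k)) \<psi> = hc_ev (tens 1 f) \<psi> - (\<lambda>I. T (scalar k) (\<psi> I))"
      if "f \<in> carrier (C_free n)" for f k
      using that by (simp add: tens_diff_right hc.ev_diff tens_carrier H_closed C_closed hc_ev_tens_scalar)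
    then have e': "hc_ev (tens 1 (gen x * gen y + gen y * gen x - scalar k)) \<psi>
        = spin_gen x (spin_gen y \<psi>) + spin_gen y (spin_gen x \<psi>) - (\<lambda>I. T (scalar k) (\<psi> I))"
      if "x \<in> vgens n" "y \<in> vgens n" for x y k
      using that gen_carrier[of _ "vgens n"] e[OF that]
      by (simp add: C_closed flip: C_free_def del: carrier_monoid_algebra)
    from that consider
      i j where "i < n" "j < n" "r = gen (VX i) * gen (VX j) + gen (VX j) * gen (VX i)"
      | i j where "i < n" "j < n" "r = gen (VY i) * gen (VY j) + gen (VY j) * gen (VY i)"
      | i j where "i < n" "j < n"
        "r = gen (VX i) * gen (VY j) + gen (VY j) * gen (VX i) - scalar (if i = j then - 2 else 0)"
      unfolding C_rels_def by blast
    then show ?thesis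
    proof cases
      case (1 i j)
      then show ?thesis by (simp only: e vg spin_gen_clifford)
    next
      case (2 i j)
      then show ?thesis by (simp only: e vg spin_gen_clifford)
    next
      case (3 i j)
      then show ?thesis
        by (simp only: e' vg spin_gen_clifford) (simp add: m2 T_zero fun_eq_iff)
    qed
  qed
  from assms show ?thesis unfolding HC_rels_def using H C by blast
qed

sublocale hcm: presented_module "words (hgens D) \<times> words (vgens n)" "HC_rels D" basis_act
  rewrites "monoid_algebra (words (hgens D) \<times> words (vgens n)) = HC_free D"
    and "monoid_module.ev basis_act = hc_ev"
    and "a_r_coset (HC_free D) (Idl\<^bsub>HC_free D\<^esub> (HC_rels D)) = hc_class D"
    and "HC_free D Quot (Idl\<^bsub>HC_free D\<^esub> (HC_rels D)) = HC D"
proof -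
  show "presented_module (words (hgens D) \<times> words (vgens n)) (HC_rels D) basis_act"
    by (intro presented_module.intro HC.presented_algebra_axioms hc.monoid_module_axioms
        presented_module_axioms.intro) (simp add: hc_ev_rel flip: hc_ev_def)
qed (simp_all add: HC_free_def hc_ev_def hc_class_def[abs_def] HC_def)

lemma hc_ev_eq:
  "hc_ev f \<psi> = (\<lambda>I. \<Sum>(u, v)\<in>Poly_Mapping.keys f.
    T (Poly_Mapping.single u (Poly_Mapping.lookup f (u, v))) (spin_word v \<psi> I))"
proof -
  have "hc_ev f \<psi> = (\<Sum>p\<in>Poly_Mapping.keys f. basis_act p (Poly_Mapping.lookup f p) \<psi>)"
    unfolding hc_ev_def by (rule monoid_module.ev_def[OF hc.monoid_module_axioms])
  then show ?thesis by (simp add: fun_eq_iff sum_fun_apply case_prod_unfold)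
qed

lemma hc_act_class: "f \<in> carrier (HC_free D) \<Longrightarrow> hc_act D act (hc_class D f) \<psi> = hc_ev f \<psi>"
  using hcm.ev_some_representative[of f \<psi>] by (simp add: hc_act_def Let_def hc_ev_eq)

lemma hc_act_add:
  assumes "X \<in> carrier (HC D)" "Y \<in> carrier (HC D)"
  shows "hc_act D act (X \<oplus>\<^bsub>HC D\<^esub> Y) \<psi> = hc_act D act X \<psi> + hc_act D act Y \<psi>"
  using assms by (elim HC.carrier_Q_cases) (simp add: HC.cls_add hc_act_class HC_closed hc.ev_add)

lemma hc_act_minus:
  assumes "X \<in> carrier (HC D)" "Y \<in> carrier (HC D)"
  shows "hc_act D act (X \<ominus>\<^bsub>HC D\<^esub> Y) \<psi> = hc_act D act X \<psi> - hc_act D act Y \<psi>"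
  using assms by (elim HC.carrier_Q_cases) (simp add: HC.cls_minus hc_act_class HC_closed hc.ev_diff)

lemma hc_act_mult:
  assumes "X \<in> carrier (HC D)" "Y \<in> carrier (HC D)"
  shows "hc_act D act (X \<otimes>\<^bsub>HC D\<^esub> Y) \<psi> = hc_act D act X (hc_act D act Y \<psi>)"
  using assms by (elim HC.carrier_Q_cases) (simp add: HC.cls_mult hc_act_class HC_closed hc.ev_mult)

lemma hc_act_zero: "hc_act D act \<zero>\<^bsub>HC D\<^esub> \<psi> = 0"
  by (simp add: HC.cls_zero hc_act_class HC_closed)

lemma hc_act_zero_right: "X \<in> carrier (HC D) \<Longrightarrow> hc_act D act X 0 = 0"
  by (elim HC.carrier_Q_cases) (simp add: hc_act_class hc.ev_zero_right)

lemma hc_act_finsum: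
  assumes "finite I" "\<And>i. i \<in> I \<Longrightarrow> X i \<in> carrier (HC D)"
  shows "hc_act D act (\<Oplus>\<^bsub>HC D\<^esub>i\<in>I. X i) \<psi> = (\<Sum>i\<in>I. hc_act D act (X i) \<psi>)"
  using assms
proof (induction I rule: finite_induct)
  case (insert i I)
  then show ?case
    by (simp add: HC.Q.finsum_insert Pi_def hc_act_add HC.Q.finsum_closed)
qed (simp add: hc_act_zero)

lemma hc_scalar_closed: "hc_scalar D k \<in> carrier (HC D)"
  unfolding hc_scalar_def by (intro HC.cls_closed HC_closed)

lemma hc_act_scalar: "hc_act D act (hc_scalar D k) \<psi> = (\<lambda>I. mscale D act k (\<psi> I))"
proof -
  have "scalar k = tens (scalar k :: h_free) (1 :: c_free)"
    using tens_single[of "0 :: hgen word" k "0 :: vgen word" 1] by (simp add: scalar_def zero_prod_def)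
  then have "hc_scalar D k = hc_class D (tens (scalar k) 1)"
    unfolding hc_scalar_def by (rule arg_cong)
  then show ?thesis
    by (simp add: hc_act_class tens_carrier C_closed hc_ev_tens_left H_closed mscale_def)
qed

section \<open>Supports and matrix coefficients\<close>

lemma MS_add: "\<phi> \<in> MS k \<Longrightarrow> \<psi> \<in> MS k \<Longrightarrow> \<phi> + \<psi> \<in> MS k" for \<phi> \<psi> :: "nat set \<Rightarrow> 'm"
  by (simp add: MS_def)

lemma spin_gen_MS:
  fixes \<psi> :: "nat set \<Rightarrow> 'm"
  assumes "x \<in> vgens n" "\<psi> \<in> MS n"
  shows "spin_gen x \<psi> \<in> MS n"
proof (cases x)
  case (VX j)
  then have j: "j < n" using assms by (auto simp: vgens_def)
  have "contr j \<psi> \<in> MS n" using assms(2) j by (auto simp: MS_def contr_def sgn_mult_def)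
  then show ?thesis using VX MS_add by simp
next
  case (VY j)
  then have j: "j < n" using assms by (auto simp: vgens_def)
  have "creat j \<psi> I = 0" if "\<not> I \<subseteq> {..<n}" for I
  proof -
    have "\<not> I - {j} \<subseteq> {..<n}" using that j by auto
    then have "\<psi> (I - {j}) = 0" using assms(2) by (simp add: MS_def)
    then show ?thesis by (simp add: creat_def sgn_mult_def)
  qed
  then show ?thesis using VY by (simp add: MS_def)
qed

lemma spin_word_MS:
  fixes \<psi> :: "nat set \<Rightarrow> 'm"
  assumes "v \<in> words (vgens n)" "\<psi> \<in> MS n"
  shows "spin_word v \<psi> \<in> MS n"
proof -
  have "foldr spin_gen vs \<psi> \<in> MS n" if "set vs \<subseteq> vgens n" for vs
    using that assms(2) by (induction vs) (simp_all add: spin_gen_MS)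
  then show ?thesis using assms(1) by (simp add: spin_word_def words_def)
qed

lemma hc_act_MS:
  assumes "X \<in> carrier (HC D)" "\<psi> \<in> MS n"
  shows "hc_act D act X \<psi> \<in> MS n"
proof -
  obtain f where f: "f \<in> carrier (HC_free D)" "X = hc_class D f"
    using assms(1) by (rule HC.carrier_Q_cases)
  have "hc_ev f \<psi> \<in> MS n"
    unfolding MS_def mem_Collect_eq
  proof (intro allI impI)
    fix I assume I: "\<not> I \<subseteq> {..<n}"
    show "hc_ev f \<psi> I = 0"
      unfolding hc_ev_eq
    proof (intro sum.neutral ballI, clarify)
      fix u v assume "(u, v) \<in> Poly_Mapping.keys f"
      then have uv: "u \<in> words (hgens D)" "v \<in> words (vgens n)" using f(1) by (auto simp: HC_free_def)
      have "spin_word v \<psi> I = 0" using spin_word_MS[OF uv(2) assms(2)] I by (simp add: MS_def)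
      then show "T (Poly_Mapping.single u (Poly_Mapping.lookup f (u, v))) (spin_word v \<psi> I) = 0"
        using T_zero_right[OF single_carrier[OF uv(1)]] by simp
    qed
  qed
  then show ?thesis using f by (simp add: hc_act_class)
qed

text \<open>Expand \<psi> in monomials; each term is the image of a complex form under the additive
  map k \<mapsto> k \<psi>(I), with which Clifford words commute. Membership in \<open>MS n\<close>
  ensures that the monomials indexed by subsets of \<open>{..<n}\<close> suffice.\<close>

lemma spin_word_matrix:
  assumes \<psi>: "\<psi> \<in> MS n"
  shows "spin_word v \<psi> K = (\<Sum>I\<in>Pow {..<n}. T (scalar (spin_word v (basis_form I) K)) (\<psi> I))"
proof -
  have "\<psi> = (\<Sum>I\<in>Pow {..<n}. (\<lambda>K. T (scalar (basis_form I K)) (\<psi> I)))"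
  proof
    fix K
    have "(\<Sum>I\<in>Pow {..<n}. T (scalar (basis_form I K)) (\<psi> I)) = (\<Sum>I\<in>Pow {..<n}. if I = K then \<psi> K else 0)"
      by (intro sum.cong refl) (auto simp: basis_form_def T_one T_zero)
    also have "\<dots> = \<psi> K" using \<psi> by (auto simp: MS_def)
    finally show "\<psi> K = (\<Sum>I\<in>Pow {..<n}. (\<lambda>K. T (scalar (basis_form I K)) (\<psi> I))) K"
      by (simp add: sum_fun_apply)
  qed
  then have "spin_word v \<psi> = spin_word v (\<Sum>I\<in>Pow {..<n}. (\<lambda>K. T (scalar (basis_form I K)) (\<psi> I)))"
    by simp
  also have "\<dots> = (\<Sum>I\<in>Pow {..<n}. spin_word v (\<lambda>K. T (scalar (basis_form I K)) (\<psi> I)))"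
    by (rule additive.sum[where f = "spin_word v"]) (unfold_locales, rule spin_word_add)
  also have "\<dots> = (\<Sum>I\<in>Pow {..<n}. (\<lambda>K. T (scalar (spin_word v (basis_form I) K)) (\<psi> I)))"
    by (intro sum.cong refl spin_word_natural) (unfold_locales, rule T_scalar_add)
  finally show ?thesis by (simp add: sum_fun_apply)
qed

text \<open>The transfer from S to M \<otimes> S: a Clifford element acts there by its matrix on the
  monomials of S.\<close>

lemma hc_ev_tens_right:
  assumes \<psi>: "\<psi> \<in> MS n" and f: "f \<in> carrier (C_free n)"
  shows "hc_ev (tens 1 f) \<psi> K = (\<Sum>I\<in>Pow {..<n}. T (scalar (spin_ev f (basis_form I) K)) (\<psi> I))"
  using f unfolding C_free_def
proof (induction f rule: monoid_algebra_induct)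
  case zero
  then show ?case by (simp add: T_zero)
next
  case (single v k)
  then show ?case
    by (simp add: hc_ev_tens_single spin_word_matrix[OF \<psi>] spin.ev_single[of _ n] T_sum_right H_closed
        T_scalar_mult)
next
  case (add f g)
  then show ?case
    by (simp add: tens_add_right hc.ev_add tens_carrier H_closed spin.ev_add[of _ n] T_scalar_add sum.distrib
        flip: C_free_def del: carrier_monoid_algebra)
qed

lemma hc_ev_tens:
  assumes "f \<in> carrier (H_free D)" "g \<in> carrier (C_free n)"
  shows "hc_ev (tens f g) \<psi> = (\<lambda>I. T f (hc_ev (tens 1 g) \<psi> I))"
  using assms hc.ev_mult[of "tens f 1" "tens 1 g" \<psi>] hc_ev_tens_left[OF assms(1)]
  by (simp add: tens_mult tens_carrier H_closed C_closed)

section \<open>The diagonal copy of the double cover\<close>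

lemma Wt_closed: "w \<in> Wt D \<Longrightarrow> w \<in> carrier Cl"
  using lifts_cover C.Q.Units_closed by (auto simp: lifts_def)

lemma cover_grp: "w \<in> Wt D \<Longrightarrow> cover D w \<in> grp D"
  using lifts_cover by (auto simp: lifts_def)

lemma Delta_grp_class:
  assumes "w \<in> Wt D"
  obtains f where "f \<in> carrier (C_free n)" "w = c_class n f"
    "Delta_grp D w = hc_class D (tens (gen (HW (cover D w))) f)"
proof -
  obtain f where f: "f \<in> carrier (C_free n)" "w = c_class n f"
    using Wt_closed[OF assms] by (rule C.carrier_Q_cases)
  show thesis
    using that[OF f] f ctens_class[OF H_gen(3)[OF cover_grp[OF assms]] f(1)] by (simp add: Delta_grp_def)
qed

lemma Delta_grp_closed:
  assumes "w \<in> Wt D"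
  shows "Delta_grp D w \<in> carrier (HC D)"
proof -
  obtain f where f: "f \<in> carrier (C_free n)"
    "Delta_grp D w = hc_class D (tens (gen (HW (cover D w))) f)"
    using Delta_grp_class[OF assms] by blast
  show ?thesis
    unfolding f(2) by (intro HC.cls_closed tens_carrier H_gen cover_grp assms f(1))
qed

text \<open>By \<open>spin_act_basis_form\<close> the matrix of w on S is \<chi>(w) times that of
  p(w) on the exterior algebra. Scalars commute with the action of p(w) on M, so they can be pulled
  out to form the diagonal action.\<close>

lemma hc_act_Delta_grp:
  assumes w: "w \<in> Wt D" and \<psi>: "\<psi> \<in> MS n"
  shows "hc_act D act (Delta_grp D w) \<psi> = (\<lambda>K. mscale D act (chi w) (w_diag D act (cover D w) \<psi> K))"
proof
  fix K
  obtain f where f: "f \<in> carrier (C_free n)" "w = c_class n f"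
    "Delta_grp D w = hc_class D (tens (gen (HW (cover D w))) f)"
    by (rule Delta_grp_class[OF w])
  let ?g = "gen (HW (cover D w))"
  have g: "?g \<in> carrier (H_free D)" by (rule H_gen(3)[OF cover_grp[OF w]])
  have se: "spin_ev f (basis_form I) K = chi w * w_wedge n (cover D w) I K" if "I \<subseteq> {..<n}" for I
    using fun_cong[OF spin_act_basis_form[OF w that], of K] unfolding f(2) spin_act_class[OF f(1)] .
  have "hc_act D act (Delta_grp D w) \<psi> K = T ?g (hc_ev (tens 1 f) \<psi> K)"
    using f g by (simp add: hc_act_class tens_carrier hc_ev_tens)
  also have "\<dots> = T ?g (\<Sum>I\<in>Pow {..<n}. T (scalar (chi w * w_wedge n (cover D w) I K)) (\<psi> I))"
    unfolding hc_ev_tens_right[OF \<psi> f(1)] by (simp add: se)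
  also have "\<dots> = T (scalar (chi w)) (\<Sum>I\<in>Pow {..<n}. T (scalar (w_wedge n (cover D w) I K)) (T ?g (\<psi> I)))"
    by (simp add: T_sum_right g H_closed T_scalar_mult T_scalar_commute[OF g])
  finally show "hc_act D act (Delta_grp D w) \<psi> K = mscale D act (chi w) (w_diag D act (cover D w) \<psi> K)"
    by (simp add: mscale_def w_diag_def)
qed

lemma Delta_closed:
  assumes "Poly_Mapping.keys z \<subseteq> Wt D"
  shows "Delta D z \<in> carrier (HC D)"
  unfolding Delta_def using assms
  by (intro HC.Q.finsum_closed) (auto intro!: HC.Q.m_closed hc_scalar_closed Delta_grp_closed)

lemma hc_act_Delta:
  assumes z: "Poly_Mapping.keys z \<subseteq> Wt D" and \<psi>: "\<psi> \<in> MS n"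
  shows "hc_act D act (Delta D z) \<psi> = (\<Sum>w\<in>Poly_Mapping.keys z. (\<lambda>K. mscale D act (Poly_Mapping.lookup z w)
    (mscale D act (chi w) (w_diag D act (cover D w) \<psi> K))))"
proof -
  have "hc_act D act (Delta D z) \<psi> = (\<Sum>w\<in>Poly_Mapping.keys z.
      hc_act D act (hc_scalar D (Poly_Mapping.lookup z w) \<otimes>\<^bsub>HC D\<^esub> Delta_grp D w) \<psi>)"
    unfolding Delta_def using z
    by (intro hc_act_finsum) (auto intro!: HC.Q.m_closed hc_scalar_closed Delta_grp_closed)
  also have "\<dots> = (\<Sum>w\<in>Poly_Mapping.keys z. (\<lambda>K. mscale D act (Poly_Mapping.lookup z w)
    (mscale D act (chi w) (w_diag D act (cover D w) \<psi> K))))"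
  proof (intro sum.cong refl)
    fix w assume "w \<in> Poly_Mapping.keys z"
    then have w: "w \<in> Wt D" using z by auto
    show "hc_act D act (hc_scalar D (Poly_Mapping.lookup z w) \<otimes>\<^bsub>HC D\<^esub> Delta_grp D w) \<psi>
      = (\<lambda>K. mscale D act (Poly_Mapping.lookup z w) (mscale D act (chi w) (w_diag D act (cover D w) \<psi> K)))"
      by (simp add: hc_act_mult hc_scalar_closed Delta_grp_closed w hc_act_scalar hc_act_Delta_grp[OF w \<psi>])
  qed
  finally show ?thesis .
qed

section \<open>Half-Dirac operators as differentials\<close>

lemma Dx_summand: "i \<in> {..<n} \<Longrightarrow> tens (gen (HX i)) (gen (VY i)) \<in> carrier (HC_free D)"
  by (intro tens_carrier H_gen C_gen) auto

lemma Dx_class: "Dx D = hc_class D (\<Sum>i<n. tens (gen (HX i)) (gen (VY i)))"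
proof -
  have "Dx D = (\<Oplus>\<^bsub>HC D\<^esub>i\<in>{..<n}. hc_class D (tens (gen (HX i)) (gen (VY i))))"
    unfolding Dx_def
  proof (rule HC.Q.finsum_cong')
    show "(\<lambda>i. hc_class D (tens (gen (HX i)) (gen (VY i)))) \<in> {..<n} \<rightarrow> carrier (HC D)"
      using Dx_summand HC.cls_closed by blast
  qed (simp_all add: ctens_class H_gen C_gen)
  also have "\<dots> = hc_class D (\<Sum>i<n. tens (gen (HX i)) (gen (VY i)))"
    by (rule HC.cls_sum[OF Dx_summand])
  finally show ?thesis .
qed

lemma Dx_closed: "Dx D \<in> carrier (HC D)"
  unfolding Dx_class by (intro HC.cls_closed HC_closed(8) Dx_summand)

lemma hc_act_Dx: "hc_act D act (Dx D) \<psi> = d_op D act \<psi>"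
proof -
  have "hc_act D act (Dx D) \<psi> = (\<Sum>i<n. hc_ev (tens (gen (HX i)) (gen (VY i))) \<psi>)"
    unfolding Dx_class
    by (simp only: hc_act_class[OF HC_closed(8)[OF Dx_summand]] hc.ev_sum[OF Dx_summand])
  also have "\<dots> = (\<Sum>i<n. (\<lambda>I. T (gen (HX i)) (spin_gen (VY i) \<psi> I)))"
    by (intro sum.cong refl) (simp add: hc_ev_tens H_gen C_gen hc_ev_tens_gen vgens_def)
  finally show ?thesis
    by (simp add: d_op_def sum_fun_apply fun_eq_iff)
qed

lemma Dy_summand: "i \<in> {..<n} \<Longrightarrow> tens (gen (HY i)) (gen (VX i)) \<in> carrier (HC_free D)"
  by (intro tens_carrier H_gen C_gen) auto

lemma Dy_class: "Dy D = hc_class D (\<Sum>i<n. tens (gen (HY i)) (gen (VX i)))"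
proof -
  have "Dy D = (\<Oplus>\<^bsub>HC D\<^esub>i\<in>{..<n}. hc_class D (tens (gen (HY i)) (gen (VX i))))"
    unfolding Dy_def
  proof (rule HC.Q.finsum_cong')
    show "(\<lambda>i. hc_class D (tens (gen (HY i)) (gen (VX i)))) \<in> {..<n} \<rightarrow> carrier (HC D)"
      using Dy_summand HC.cls_closed by blast
  qed (simp_all add: ctens_class H_gen C_gen)
  also have "\<dots> = hc_class D (\<Sum>i<n. tens (gen (HY i)) (gen (VX i)))"
    by (rule HC.cls_sum[OF Dy_summand])
  finally show ?thesis .
qed

lemma Dy_closed: "Dy D \<in> carrier (HC D)"
  unfolding Dy_class by (intro HC.cls_closed HC_closed(8) Dy_summand)

text \<open>The factor 2 comes from the doubled contraction in \<open>spin_gen\<close> and is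
  written as a sum, since M carries just its addition.\<close>

lemma hc_act_Dy: "hc_act D act (Dy D) \<psi> = bd_op D act \<psi> + bd_op D act \<psi>"
proof -
  have "hc_act D act (Dy D) \<psi> = (\<Sum>i<n. hc_ev (tens (gen (HY i)) (gen (VX i))) \<psi>)"
    unfolding Dy_class
    by (simp only: hc_act_class[OF HC_closed(8)[OF Dy_summand]] hc.ev_sum[OF Dy_summand])
  also have "\<dots> = (\<Sum>i<n. (\<lambda>I. T (gen (HY i)) (spin_gen (VX i) \<psi> I)))"
    by (intro sum.cong refl) (simp add: hc_ev_tens H_gen C_gen hc_ev_tens_gen vgens_def)
  finally show ?thesis
    by (simp add: bd_op_def sum_fun_apply fun_eq_iff T_add_right H_gen sum.distrib)
qed

lemma d_op_add: "d_op D act (\<phi> + \<psi>) = d_op D act \<phi> + d_op D act \<psi>"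
  by (simp add: d_op_def creat_add T_add_right H_gen sum.distrib fun_eq_iff)

lemma bd_op_add: "bd_op D act (\<phi> + \<psi>) = bd_op D act \<phi> + bd_op D act \<psi>"
  by (simp add: bd_op_def contr_add T_add_right H_gen sum.distrib fun_eq_iff)

text \<open>The term \<epsilon>(a) E applies the operator \<epsilon>(a) to E \<psi> = 0;
  \<open>parity_closed\<close> guarantees that it is an operator of the algebra.\<close>

lemma hc_act_delta:
  assumes "E \<in> carrier (HC D)" "a \<in> carrier (HC D)" "hc_act D act E \<psi> = 0"
  shows "hc_act D act (delta D E a) \<psi> = hc_act D act E (hc_act D act a \<psi>)"
  unfolding delta_def
  using assms parity_closed[OF assms(2)]
  by (simp add: hc_act_minus HC.Q.m_closed hc_act_mult hc_act_zero_right)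

end

section \<open>Vogan's morphism and isotypical components\<close>

context cherednik_module
begin

text \<open>Stated for an abstract E and differential \<open>op\<close> so that both halves of the
  theorem are instances: the premises linking them hold for E = op as well as for E = 2 op.\<close>

lemma zeta_star_isotypical:
  assumes E: "E \<in> carrier (HC D)"
    and kernel: "\<And>\<psi>. op \<psi> = 0 \<Longrightarrow> hc_act D act E \<psi> = 0"
    and image: "\<And>\<psi>. \<psi> \<in> MS n \<Longrightarrow> hc_act D act E \<psi> \<in> total_im n op"
    and op_add: "\<And>\<phi> \<psi>. op (\<phi> + \<psi>) = op \<phi> + op \<psi>"
    and irr: "irreducible_rep D (sc :: complex \<Rightarrow> 'u \<Rightarrow> 'u::ab_group_add) \<sigma>"
    and B: "B \<subseteq> ker_delta D E"
    and vogan: "vogan_morphism D E B \<zeta>"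
    and iso: "isotypical_component D act op B sc \<sigma> \<beta>"
    and b: "b \<in> B"
  shows "zeta_star D \<zeta> sc (twist_chi D sc \<sigma>) b = \<beta> b"
proof -
  let ?N = "total_im n op"
  interpret op: additive op by unfold_locales (rule op_add)
  have N0: "0 \<in> ?N" unfolding total_im_def
    by (intro image_eqI[of _ _ 0]) (simp_all add: op.zero MS_def)
  have Nadd: "x + y \<in> ?N" if "x \<in> ?N" "y \<in> ?N" for x y
    using that unfolding total_im_def by (auto simp: MS_add simp flip: op_add)
  have Nminus: "- x \<in> ?N" if "x \<in> ?N" for x
  proof -
    obtain \<psi> where "\<psi> \<in> MS n" "x = op \<psi>" using \<open>x \<in> ?N\<close> by (auto simp: total_im_def)
    then show ?thesis unfolding total_im_def
      by (intro image_eqI[of _ _ "- \<psi>"]) (simp_all add: op.minus MS_def)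
  qed
  have Ndiff: "x - y \<in> ?N" if "x \<in> ?N" "y \<in> ?N" for x y
    using Nadd[OF that(1) Nminus[OF that(2)]] by simp
  have coset: "x \<in> y +o ?N \<longleftrightarrow> x - y \<in> ?N" for x y
  proof
    assume "x - y \<in> ?N"
    then have "y + (x - y) \<in> y +o ?N" by (rule set_plus_intro2)
    then show "x \<in> y +o ?N" by simp
  next
    assume "x \<in> y +o ?N"
    then obtain z where "z \<in> ?N" "x = y + z" by (auto simp: elt_set_plus_def)
    then show "x - y \<in> ?N" by simp
  qed
  have coset_eq: "x +o ?N = y +o ?N" if "x - y \<in> ?N" for x y
  proof -
    have "z - x \<in> ?N \<longleftrightarrow> z - y \<in> ?N" for z
      using Nadd[OF _ that, of "z - x"] Ndiff[OF _ that, of "z - y"] by auto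
    then show ?thesis by (auto simp: coset)
  qed
  obtain \<Phi> :: "'u \<Rightarrow> (nat set \<Rightarrow> 'm) set" where \<Phi>: "inj \<Phi> \<and> range \<Phi> \<subseteq> total_coh n op \<and>
      (\<forall>u v. \<Phi> (u + v) = \<Phi> u + \<Phi> v) \<and>
      (\<forall>k u. \<Phi> (sc k u) = on_cosets n op (\<lambda>\<psi> I. mscale D act k (\<psi> I)) (\<Phi> u)) \<and>
      (\<forall>w\<in>grp D. \<forall>u. \<Phi> (\<sigma> w u) = on_cosets n op (w_diag D act w) (\<Phi> u)) \<and>
      (\<forall>b\<in>B. \<forall>u. on_cosets n op (hc_act D act b) (\<Phi> u)
        = on_cosets n op (\<lambda>\<psi> I. mscale D act (\<beta> b) (\<psi> I)) (\<Phi> u))"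
    using iso unfolding isotypical_component_def by (rule exE)
  note inj = \<Phi>[THEN conjunct1]
    and range = \<Phi>[THEN conjunct2, THEN conjunct1]
    and \<Phi>_add = \<Phi>[THEN conjunct2, THEN conjunct2, THEN conjunct1, rule_format]
    and \<Phi>_scale = \<Phi>[THEN conjunct2, THEN conjunct2, THEN conjunct2, THEN conjunct1, rule_format]
    and \<Phi>_grp = \<Phi>[THEN conjunct2, THEN conjunct2, THEN conjunct2, THEN conjunct2, THEN conjunct1, rule_format]
    and \<Phi>_B = \<Phi>[THEN conjunct2, THEN conjunct2, THEN conjunct2, THEN conjunct2, THEN conjunct2, rule_format]
  have \<Phi>_rep: "\<exists>\<psi>\<in>MS n. op \<psi> = 0 \<and> \<Phi> u = \<psi> +o ?N" for u
    using range by (auto simp: total_coh_def)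
  have \<Phi>_eq: "\<Phi> u = x +o ?N" if "x \<in> \<Phi> u" for x u
    using \<Phi>_rep[of u] that coset coset_eq by metis
  have \<Phi>_diff: "y - x \<in> ?N" if "x \<in> \<Phi> u" "y \<in> \<Phi> u" for x y u
    using that \<Phi>_eq coset by metis
  text \<open>
    A union of cosets that is itself a coset contains the image of every representative, so no
    operator has to be shown to preserve \<open>im op\<close>.
  \<close>
  have on_cosets_mem: "f x \<in> on_cosets n op f (\<Phi> u)" if "x \<in> \<Phi> u" for f x u
    using that N0 coset[of "f x" "f x"] unfolding on_cosets_def by auto
  have \<Phi>_plus: "x + y \<in> \<Phi> (u + v)" if "x \<in> \<Phi> u" "y \<in> \<Phi> v" for x y u v
    using that by (auto simp: \<Phi>_add set_plus_def)
  \<comment> \<open>Additivity of \<Phi> makes twice a representative of \<Phi>(0) again a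
    representative, so it is a boundary. This is the base case for finite sums.\<close>
  have \<Phi>_zero: "0 \<in> \<Phi> 0"
  proof -
    obtain x where x: "x \<in> \<Phi> 0" using \<Phi>_rep[of 0] coset N0 by fastforce
    have "x + x \<in> \<Phi> 0" using \<Phi>_plus[OF x x] by simp
    then have "- x \<in> ?N" using \<Phi>_diff[OF x] Nminus by fastforce
    then show ?thesis using \<Phi>_eq[OF x] coset[of 0 x] by simp
  qed
  have \<Phi>_sum: "sum g I \<in> \<Phi> (sum h I)" if "finite I" "\<And>i. i \<in> I \<Longrightarrow> g i \<in> \<Phi> (h i)" for g h and I :: "c_free set set"
    using that by (induction I rule: finite_induct) (simp_all add: \<Phi>_zero \<Phi>_plus)
  have carrier: "a \<in> carrier (HC D)" if "a \<in> A_inv D" for a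
    using that by (simp add: A_inv_def A_alg_def)
  have bc: "b \<in> carrier (HC D)" using B b carrier by (auto simp: ker_delta_def)
  obtain a where a: "a \<in> A_inv D" "b \<ominus>\<^bsub>HC D\<^esub> \<zeta> b = delta D E a"
    using vogan b by (auto simp: vogan_morphism_def im_delta_def)
  \<comment> \<open>A witness is required for uniqueness: without any z over \<zeta> b, every scalar
    would satisfy the condition in \<open>zeta_star\<close>.\<close>
  obtain z0 where z0: "z0 \<in> Wt_inv D" "Delta D z0 = \<zeta> b"
    using vogan b by (auto simp: vogan_morphism_def)
  have main: "group_alg_act sc (twist_chi D sc \<sigma>) z u = sc (\<beta> b) u"
    if z: "z \<in> Wt_inv D" "Delta D z = \<zeta> b" for z u
  proof -
    have keys: "Poly_Mapping.keys z \<subseteq> Wt D" using z by (simp add: Wt_inv_def)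
    obtain \<psi> where \<psi>: "\<psi> \<in> MS n" "op \<psi> = 0" "\<Phi> u = \<psi> +o ?N" using \<Phi>_rep by blast
    have \<psi>u: "\<psi> \<in> \<Phi> u" using \<psi>(3) coset N0 by simp
    have "hc_act D act (Delta D z) \<psi> \<in> \<Phi> (group_alg_act sc (twist_chi D sc \<sigma>) z u)"
      unfolding hc_act_Delta[OF keys \<psi>(1)] group_alg_act_def twist_chi_def
    proof (rule \<Phi>_sum)
      fix w assume "w \<in> Poly_Mapping.keys z"
      then have g: "cover D w \<in> grp D" using keys cover_grp by auto
      have "w_diag D act (cover D w) \<psi> \<in> \<Phi> (\<sigma> (cover D w) u)"
        using on_cosets_mem[OF \<psi>u] \<Phi>_grp[OF g] by simp
      from on_cosets_mem[OF this, of "\<lambda>\<psi> I. mscale D act (chi w) (\<psi> I)"]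
      have "(\<lambda>I. mscale D act (chi w) (w_diag D act (cover D w) \<psi> I)) \<in> \<Phi> (sc (chi w) (\<sigma> (cover D w) u))"
        by (simp add: \<Phi>_scale)
      from on_cosets_mem[OF this, of "\<lambda>\<psi> I. mscale D act (Poly_Mapping.lookup z w) (\<psi> I)"]
      show "(\<lambda>I. mscale D act (Poly_Mapping.lookup z w) (mscale D act (chi w) (w_diag D act (cover D w) \<psi> I)))
          \<in> \<Phi> (sc (Poly_Mapping.lookup z w) (sc (chi w) (\<sigma> (cover D w) u)))"
        by (simp add: \<Phi>_scale)
    qed simp
    moreover have "hc_act D act b \<psi> \<in> \<Phi> (sc (\<beta> b) u)"
      using on_cosets_mem[OF \<psi>u, of "hc_act D act b"] \<Phi>_B[OF b] \<Phi>_scale by simp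
    moreover have "hc_act D act b \<psi> - hc_act D act (Delta D z) \<psi> \<in> ?N"
    proof -
      have "hc_act D act b \<psi> - hc_act D act (Delta D z) \<psi> = hc_act D act (delta D E a) \<psi>"
        using hc_act_minus[OF bc Delta_closed[OF keys]] a(2) z(2) by simp
      also have "\<dots> = hc_act D act E (hc_act D act a \<psi>)"
        by (rule hc_act_delta[OF E carrier[OF a(1)] kernel[OF \<psi>(2)]])
      also have "\<dots> \<in> ?N" by (rule image[OF hc_act_MS[OF carrier[OF a(1)] \<psi>(1)]])
      finally show ?thesis .
    qed
    \<comment> \<open>Two representatives that differ by a boundary give the same coset; injectivity
      of \<Phi> then brings the equality back to the representation.\<close>
    ultimately have "\<Phi> (group_alg_act sc (twist_chi D sc \<sigma>) z u) = \<Phi> (sc (\<beta> b) u)"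
      using \<Phi>_eq coset_eq by metis
    with inj show ?thesis by (simp add: inj_eq)
  qed
  show ?thesis
    unfolding zeta_star_def
  proof (rule the_equality)
    show "\<forall>z\<in>Wt_inv D. Delta D z = \<zeta> b \<longrightarrow> (\<forall>u. group_alg_act sc (twist_chi D sc \<sigma>) z u = sc (\<beta> b) u)"
      using main by blast
  next
    fix k
    assume "\<forall>z\<in>Wt_inv D. Delta D z = \<zeta> b \<longrightarrow> (\<forall>u. group_alg_act sc (twist_chi D sc \<sigma>) z u = sc k u)"
    then have "sc k u = sc (\<beta> b) u" for u
      using main[OF z0] z0 by simp
    moreover obtain u :: 'u where "u \<noteq> 0" using irr by (auto simp: irreducible_rep_def)
    moreover have "vector_space sc" using irr by (simp add: irreducible_rep_def)
    ultimately show "k = \<beta> b" using vector_space.scale_right_imp_eq by blast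
  qed
qed

end

theorem theoremA:
  fixes D :: cherednik_data
    and act :: "h_free set \<Rightarrow> 'm::ab_group_add \<Rightarrow> 'm"
    and sc :: "complex \<Rightarrow> 'u::ab_group_add \<Rightarrow> 'u"
    and \<sigma> :: "complex mat \<Rightarrow> 'u \<Rightarrow> 'u"
  assumes "cherednik D"
    and "H_module D act"
    and "irreducible_rep D sc \<sigma>"
  shows
    "(\<forall>B \<zeta> \<beta>.
        abelian_subalgebra D B \<and> B \<subseteq> ker_delta D (Dx D) \<inter> HC_even D \<and>
        vogan_morphism D (Dx D) B \<zeta> \<and> alg_character D B \<beta> \<and>
        isotypical_component D act (d_op D act) B sc \<sigma> \<beta> \<longrightarrow>
        (\<forall>b\<in>B. zeta_star D \<zeta> sc (twist_chi D sc \<sigma>) b = \<beta> b)) \<and>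
     (\<forall>B \<zeta> \<beta>.
        abelian_subalgebra D B \<and> B \<subseteq> ker_delta D (Dy D) \<inter> HC_even D \<and>
        vogan_morphism D (Dy D) B \<zeta> \<and> alg_character D B \<beta> \<and>
        isotypical_component D act (bd_op D act) B sc \<sigma> \<beta> \<longrightarrow>
        (\<forall>b\<in>B. zeta_star D \<zeta> sc (twist_chi D sc \<sigma>) b = \<beta> b))"
proof -
  interpret cherednik_module D act
    by unfold_locales (rule assms)+
  show ?thesis
  proof (intro conjI allI impI ballI; elim conjE)
    fix B \<zeta> \<beta> b
    assume B: "B \<subseteq> ker_delta D (Dx D) \<inter> HC_even D" "b \<in> B"
      and vogan: "vogan_morphism D (Dx D) B \<zeta>"
      and iso: "isotypical_component D act (d_op D act) B sc \<sigma> \<beta>"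
    show "zeta_star D \<zeta> sc (twist_chi D sc \<sigma>) b = \<beta> b"
    proof (rule zeta_star_isotypical[OF Dx_closed _ _ d_op_add assms(3) _ vogan iso B(2)])
      show "hc_act D act (Dx D) \<psi> \<in> total_im (dm D) (d_op D act)" if "\<psi> \<in> MS (dm D)" for \<psi>
        using that by (simp add: hc_act_Dx total_im_def)
    qed (use B in \<open>auto simp: hc_act_Dx\<close>)
  next
    fix B \<zeta> \<beta> b
    assume B: "B \<subseteq> ker_delta D (Dy D) \<inter> HC_even D" "b \<in> B"
      and vogan: "vogan_morphism D (Dy D) B \<zeta>"
      and iso: "isotypical_component D act (bd_op D act) B sc \<sigma> \<beta>"
    show "zeta_star D \<zeta> sc (twist_chi D sc \<sigma>) b = \<beta> b"
    proof (rule zeta_star_isotypical[OF Dy_closed _ _ bd_op_add assms(3) _ vogan iso B(2)])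
      \<comment> \<open>Twice a boundary is the boundary of \<psi> + \<psi>.\<close>
      show "hc_act D act (Dy D) \<psi> \<in> total_im (dm D) (bd_op D act)" if "\<psi> \<in> MS (dm D)" for \<psi>
        using MS_add[OF that that] by (simp add: hc_act_Dy total_im_def flip: bd_op_add)
    qed (use B in \<open>auto simp: hc_act_Dy\<close>)
  qed
qed

end
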